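(* (Dong's lemma) Let $\mathbb V=\bigoplus_{n\in\mathbb N}\mathbb V(n)$ be graded by a diagonalizable operator $L_0$, and let $A(z),B(z),C(z)$ be mutually local homogeneous fields on $\mathbb V$. Then for each $n\in\mathbb Z$, $C(z)$ is local to $(A_nB)(z)$.
   Context: All vector spaces are over $\mathbb C$; $\mathbb C^\times=\mathbb C\setminus\{0\}$; $\mathrm{Conf}^2(\mathbb C^\times)=\{(z_1,z_2)\in(\mathbb C^\times)^2:z_1\neq z_2\}$. $L_0$ acts on $\mathbb V(n)$ as $n$; $\mathbb V(n)$ need not be finite-dimensional. $\mathbb V'=\bigoplus_n\mathbb V(n)^*$; $P_n:\prod_{m}\mathbb V(m)\to\mathbb V(n)$ is the canonical projection. A homogeneous field on $\mathbb V$ is $A(z)=\sum_{n\in\mathbb Z}A_nz^{-n-1}$ with $A_n\in\mathrm{End}(\mathbb V)$ such that for some integer $\Delta_A$, $[L_0,A_n]=(\Delta_A-n-1)A_n$ for all $n$. A series of functions $\sum_nf_n$ converges absolutely and locally uniformly (a.l.u.) on $\Omega$ if every point of $\Omega$ has a neighborhood $U$ with $\sup_{x\in U}\sum_n|f_n(x)|<+\infty$. Homogeneous fields $A(z),B(z)$ are local to each other (complex analytic version) if for each $v\in\mathbb V,v'\in\mathbb V'$: (i) the series $\sum_{n\in\mathbb N}\langle v',A(z_1)P_nB(z_2)v\rangle$ and $\sum_{n\in\mathbb N}\langle v',B(z_2)P_nA(z_1)v\rangle$ converge a.l.u. on $\{0<|z_2|<|z_1|\}$ and $\{0<|z_1|<|z_2|\}$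 respectively; (ii) their sums can be analytically continued to the same holomorphic function $f_{v,v'}$ on $\mathrm{Conf}^2(\mathbb C^\times)$, and there is $N\in\mathbb N$ depending only on $A,B$ (not on $v,v'$) such that $(z_1-z_2)^Nf_{v,v'}(z_1,z_2)$ is holomorphic on $\mathbb C^\times\times\mathbb C^\times$. (This is equivalent to the existence of $N\in\mathbb N$ with $(z_1-z_2)^N[A(z_1),B(z_2)]=0$ in $\mathrm{End}(\mathbb V)[[z_1^{\pm1},z_2^{\pm1}]]$.) Mutually local means pairwise local. For local $A,B$ and $n\in\mathbb Z$, $(A_nB)(z)$ is defined by $$\langle v',(A_nB)(z_2)v\rangle=\oint_{C(z_2)}(z_1-z_2)^nf_{v,v'}(z_1,z_2)\frac{dz_1}{2\pi i},$$ $C(z_2)$ being a small circle in $\mathbb C^\times$ around $z_2$ (not enclosing $0$); expanding as a Laurent series in $z_2$, this gives a homogeneous field $(A_nB)(z)=\sum_k(A_nB)_kz^{-k-1}$ on $\mathbb V$ of weight $\Delta_A+\Delta_B-n-1$. *)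

theory Defs
  imports "HOL-Complex_Analysis.Complex_Analysis"
begin

definition punctured :: "complex set" where
  "punctured = UNIV - {0}"

definition Conf2 :: "(complex \<times> complex) set" where
  "Conf2 = {p \<in> punctured \<times> punctured. fst p \<noteq> snd p}"

text \<open>Holomorphy in two variables: the real Frechet derivative exists and is complex linear.\<close>

definition holomorphic2_on ::
    "(complex \<times> complex \<Rightarrow> complex) \<Rightarrow> (complex \<times> complex) set \<Rightarrow> bool" where
  "holomorphic2_on f S \<longleftrightarrow>
     (\<forall>p\<in>S. \<exists>a b. (f has_derivative (\<lambda>h. a * fst h + b * snd h)) (at p within S))"

definition alu_convergent_on :: "(nat \<Rightarrow> 'x::topological_space \<Rightarrow> complex) \<Rightarrow> 'x set \<Rightarrow> bool" where
  "alu_convergent_on f S \<longleftrightarrow>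
     (\<forall>p\<in>S. \<exists>U. open U \<and> p \<in> U \<and>
        (SUP x\<in>U \<inter> S. \<Sum>n. ennreal (norm (f n x))) < \<infinity>)"

text \<open>
  A complex vector space that is the internal direct sum of subspaces \<open>V n\<close>, on which
  \<open>L0\<close> acts as the scalar \<open>n\<close>.
\<close>

locale graded_space = vector_space scale
  for scale :: "complex \<Rightarrow> 'v::ab_group_add \<Rightarrow> 'v" +
  fixes V :: "nat \<Rightarrow> 'v set"
    and L0 :: "'v \<Rightarrow> 'v"
  assumes subspace_V: "subspace (V n)"
    and direct_sum: "\<exists>!c :: nat \<Rightarrow> 'v. (\<forall>n. c n \<in> V n) \<and> finite {n. c n \<noteq> 0} \<and>
                        v = (\<Sum>n | c n \<noteq> 0. c n)"
    and linear_L0: "Vector_Spaces.linear scale scale L0"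
    and L0_eigen: "v \<in> V n \<Longrightarrow> L0 v = scale (of_nat n) v"
begin

definition proj :: "nat \<Rightarrow> 'v \<Rightarrow> 'v" where
  "proj n v = (THE c. (\<forall>m. c m \<in> V m) \<and> finite {m. c m \<noteq> 0} \<and>
                 v = (\<Sum>m | c m \<noteq> 0. c m)) n"

text \<open>
  The direct sum of the dual spaces of the \<open>V n\<close>, realized as the functionals on the whole space
  that vanish on all but finitely many \<open>V n\<close>.
\<close>

definition graded_dual :: "('v \<Rightarrow> complex) set" where
  "graded_dual = {\<phi>. Vector_Spaces.linear scale (*) \<phi> \<and> finite {n. \<exists>v\<in>V n. \<phi> v \<noteq> 0}}"

text \<open>
  The pairing of the graded dual with the product of the \<open>V n\<close>, an element of the product being a
  function \<open>w\<close> with \<open>w n \<in> V n\<close>. For \<open>\<phi>\<close> in the graded dual the sum is finite.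
\<close>

definition pairing :: "('v \<Rightarrow> complex) \<Rightarrow> (nat \<Rightarrow> 'v) \<Rightarrow> complex" where
  "pairing \<phi> w = (\<Sum>n | \<phi> (w n) \<noteq> 0. \<phi> (w n))"

text \<open>
  A family \<open>A\<close> of modes stands for the formal series with coefficient \<open>A n\<close> at
  \<open>z powi (- n - 1)\<close>.
\<close>

definition homogeneous_field :: "(int \<Rightarrow> 'v \<Rightarrow> 'v) \<Rightarrow> bool" where
  "homogeneous_field A \<longleftrightarrow>
     (\<forall>n. Vector_Spaces.linear scale scale (A n)) \<and>
     (\<exists>\<Delta>::int. \<forall>n v. L0 (A n v) - A n (L0 v) = scale (of_int (\<Delta> - n - 1)) (A n v))"

text \<open>
  The element \<open>A(z) v\<close> of the product of the \<open>V n\<close>, so that \<open>field_at A z v n\<close> is the projection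
  of \<open>A(z) v\<close> to \<open>V n\<close>. For a homogeneous field each component is a finite sum, because the
  mode \<open>A k\<close> maps \<open>V d\<close> to the \<open>L0\<close>-eigenspace for the eigenvalue \<open>d + \<Delta> - k - 1\<close>.
\<close>

definition field_at :: "(int \<Rightarrow> 'v \<Rightarrow> 'v) \<Rightarrow> complex \<Rightarrow> 'v \<Rightarrow> nat \<Rightarrow> 'v" where
  "field_at A z v n =
     (\<Sum>k | proj n (A k v) \<noteq> 0. scale (z powi (- k - 1)) (proj n (A k v)))"

definition product_term ::
    "('v \<Rightarrow> complex) \<Rightarrow> (int \<Rightarrow> 'v \<Rightarrow> 'v) \<Rightarrow> complex \<Rightarrow> nat \<Rightarrow> (int \<Rightarrow> 'v \<Rightarrow> 'v) \<Rightarrow> complex \<Rightarrow> 'v \<Rightarrow> complex"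
  where
  "product_term \<phi> A z\<^sub>1 n B z\<^sub>2 v = pairing \<phi> (field_at A z\<^sub>1 (field_at B z\<^sub>2 v n))"

definition is_correlation ::
    "(int \<Rightarrow> 'v \<Rightarrow> 'v) \<Rightarrow> (int \<Rightarrow> 'v \<Rightarrow> 'v) \<Rightarrow> ('v \<Rightarrow> complex) \<Rightarrow> 'v \<Rightarrow> (complex \<times> complex \<Rightarrow> complex) \<Rightarrow> bool"
  where
  "is_correlation A B \<phi> v f \<longleftrightarrow>
     holomorphic2_on f Conf2 \<and>
     (\<forall>z\<^sub>1 z\<^sub>2. 0 < norm z\<^sub>2 \<and> norm z\<^sub>2 < norm z\<^sub>1 \<longrightarrow>
        f (z\<^sub>1, z\<^sub>2) = (\<Sum>n. product_term \<phi> A z\<^sub>1 n B z\<^sub>2 v)) \<and>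
     (\<forall>z\<^sub>1 z\<^sub>2. 0 < norm z\<^sub>1 \<and> norm z\<^sub>1 < norm z\<^sub>2 \<longrightarrow>
        f (z\<^sub>1, z\<^sub>2) = (\<Sum>n. product_term \<phi> B z\<^sub>2 n A z\<^sub>1 v))"

definition local_fields :: "(int \<Rightarrow> 'v \<Rightarrow> 'v) \<Rightarrow> (int \<Rightarrow> 'v \<Rightarrow> 'v) \<Rightarrow> bool" where
  "local_fields A B \<longleftrightarrow>
     homogeneous_field A \<and> homogeneous_field B \<and>
     (\<forall>v. \<forall>\<phi>\<in>graded_dual.
        alu_convergent_on (\<lambda>n (z\<^sub>1, z\<^sub>2). product_term \<phi> A z\<^sub>1 n B z\<^sub>2 v)
          {(z\<^sub>1, z\<^sub>2). 0 < norm z\<^sub>2 \<and> norm z\<^sub>2 < norm z\<^sub>1} \<and>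
        alu_convergent_on (\<lambda>n (z\<^sub>1, z\<^sub>2). product_term \<phi> B z\<^sub>2 n A z\<^sub>1 v)
          {(z\<^sub>1, z\<^sub>2). 0 < norm z\<^sub>1 \<and> norm z\<^sub>1 < norm z\<^sub>2}) \<and>
     (\<exists>N::nat. \<forall>v. \<forall>\<phi>\<in>graded_dual. \<exists>f. is_correlation A B \<phi> v f \<and>
        (\<exists>g. holomorphic2_on g (punctured \<times> punctured) \<and>
           (\<forall>(z\<^sub>1, z\<^sub>2)\<in>Conf2. g (z\<^sub>1, z\<^sub>2) = (z\<^sub>1 - z\<^sub>2) ^ N * f (z\<^sub>1, z\<^sub>2))))"

text \<open>On \<open>Conf2\<close>, which is connected, \<open>correlation\<close> does not depend on the choice.\<close>

definition correlation ::
    "(int \<Rightarrow> 'v \<Rightarrow> 'v) \<Rightarrow> (int \<Rightarrow> 'v \<Rightarrow> 'v) \<Rightarrow> ('v \<Rightarrow> complex) \<Rightarrow> 'v \<Rightarrow> complex \<times> complex \<Rightarrow> complex"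
  where
  "correlation A B \<phi> v = (SOME f. is_correlation A B \<phi> v f)"

text \<open>
  For local \<open>A\<close>, \<open>B\<close> the integral does not depend on the radius \<open>r\<close>: the integrand is holomorphic
  in \<open>z\<^sub>1\<close> away from \<open>0\<close> and \<open>z\<close>. The bound on \<open>r\<close> keeps \<open>0\<close> outside the circle.
\<close>

definition nth_product ::
    "(int \<Rightarrow> 'v \<Rightarrow> 'v) \<Rightarrow> int \<Rightarrow> (int \<Rightarrow> 'v \<Rightarrow> 'v) \<Rightarrow> int \<Rightarrow> 'v \<Rightarrow> 'v" where
  "nth_product A n B = (THE D. homogeneous_field D \<and>
     (\<forall>v. \<forall>\<phi>\<in>graded_dual. \<forall>z\<in>punctured. \<forall>r. 0 < r \<and> r < norm z \<longrightarrow>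
        pairing \<phi> (field_at D z v) =
          contour_integral (circlepath z r)
            (\<lambda>z\<^sub>1. (z\<^sub>1 - z) powi n * correlation A B \<phi> v (z\<^sub>1, z)) / (2 * of_real pi * \<i>)))"

end

end

theory Submission
  imports Defs "HOL-Library.Function_Algebras"
begin

text \<open>
  Locality is proved in two equivalent forms. Analytically, the two products of \<open>A(z1)\<close> and
  \<open>B(z2)\<close> continue to one function with a pole of bounded order along \<open>z1 = z2\<close>. In terms of modes,
  the coefficients of \<open>(z1 - z2) ^ N\<close> times the commutator of \<open>A(z1)\<close> and \<open>B(z2)\<close> all vanish
  (\<open>mode_local\<close>). Between homogeneous vectors and functionals everything depends, up to a monomial,
  on one variable, because only the modes \<open>A m\<close>, \<open>B (s - m)\<close> with a fixed sum \<open>s\<close> contribute. The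
  two orderings then give sequences \<open>a m\<close> and \<open>b m\<close>, which vanish for small \<open>m\<close> and for large \<open>m\<close>
  respectively, and the mode form of locality says that the \<open>N\<close>-th difference of \<open>a - b\<close> is zero.

  From the analytic form to modes (\<open>correlation_imp_coefficients\<close>): with \<open>z2 = 1\<close>, the function
  \<open>(z1 - 1) ^ N * f (z1, 1)\<close> is holomorphic away from \<open>0\<close>, and its expansions for large and for small
  \<open>z1\<close> have as coefficients the \<open>N\<close>-th differences of \<open>a\<close> and of \<open>b\<close>. One expansion is bounded in
  one direction and the other in the opposite direction, so that Liouville's theorem makes them the
  same finite Laurent polynomial (\<open>laurent_coeffs_eq\<close>).

  From modes to the analytic form (\<open>mode_local_imp_local\<close>): a sequence with vanishing \<open>N\<close>-th
  difference is a combination of the binomial polynomials \<open>m gchoose i\<close> with \<open>i < N\<close>. The restriction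
  of such a polynomial to \<open>m \<ge> 0\<close> and the negative of its restriction to \<open>m < 0\<close> are the coefficients
  of the expansions of one and the same pole \<open>(z1 - z2) powi (- i - 1)\<close> on the two sides of
  \<open>norm z1 = norm z2\<close>. Hence the two products converge to an explicit rational function, a Laurent
  polynomial plus a polar part along the diagonal. The same formula allows the residues that define
  the \<open>n\<close>-th product to be computed: the modes of the product are
  \<open>\<Sum>j. (-1) ^ j * (n gchoose j) * (A (n - j) B (k + j) - (-1) ^ n * B (n + k - j) A j)\<close>
  (\<open>nth_product_eq\<close>).

  It remains to prove Dong's lemma for modes. The product arises from the two orderings of \<open>A\<close> and
  \<open>B\<close> by multiplying them with the two expansions of \<open>(z1 - z2) powi n\<close> and taking the coefficient of
  \<open>1 / z1\<close>. Let \<open>u\<close> be what is obtained from the commutator with \<open>C(z3)\<close> before that coefficient is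
  taken. A power of \<open>z1 - z2\<close> annihilates \<open>u\<close>, because \<open>A\<close> and \<open>B\<close> are local, and
  \<open>(z1 - z3) ^ q * (z2 - z3) ^ r\<close> annihilates it, because \<open>C\<close> is local to both. Since
  \<open>z2 - z3 = (z1 - z3) - (z1 - z2)\<close>, a power of \<open>z2 - z3\<close> alone annihilates \<open>u\<close> (\<open>dong_array\<close>), and
  multiplication by it commutes with taking the coefficient in \<open>z1\<close>.
\<close>

section \<open>Nilpotent differences of commuting maps\<close>

lemma additive_funpow:
  fixes f :: "'g::ab_group_add \<Rightarrow> 'g"
  assumes "Modules.additive f"
  shows "Modules.additive (f ^^ n)"
proof (induction n)
  case 0
  show ?case by (simp add: Modules.additive_def)
next
  case (Suc n)
  then show ?case using assms by (simp add: Modules.additive_def)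
qed

lemma funpow_commute_point:
  assumes "\<And>u. x (y u) = y (x u)"
  shows "(x ^^ n) (y u) = y ((x ^^ n) u)"
  by (induction n) (simp_all add: assms)

lemma funpow_funpow_commute:
  assumes "\<And>u. x (y u) = y (x u)"
  shows "(x ^^ n) ((y ^^ k) u) = (y ^^ k) ((x ^^ n) u)"
  by (rule funpow_commute_point, rule funpow_commute_point[symmetric], rule assms[symmetric])

lemma funpow_eq_0_mono:
  fixes f :: "'g::ab_group_add \<Rightarrow> 'g"
  assumes "Modules.additive f" "(f ^^ n) u = 0" "n \<le> k"
  shows "(f ^^ k) u = 0"
proof -
  have "(f ^^ k) u = (f ^^ (k - n)) ((f ^^ n) u)"
    using assms(3) by (simp flip: funpow_add o_apply[of "f ^^ (k - n)" "f ^^ n"])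
  also have "\<dots> = 0"
    using Modules.additive.zero[OF additive_funpow[OF assms(1)]] assms(2) by simp
  finally show ?thesis .
qed

text \<open>
  Each monomial of \<open>(x - y) ^ (p + q)\<close> contains \<open>x\<close> at least \<open>p\<close> times or \<open>y\<close> at least \<open>q\<close> times.
  The induction splits off one factor at a time and so works without binomial coefficients.
\<close>

lemma funpow_diff_eq_0:
  fixes x y :: "'g::ab_group_add \<Rightarrow> 'g"
  assumes "Modules.additive x" "Modules.additive y" and comm: "\<And>u. x (y u) = y (x u)"
    and "(x ^^ p) w = 0" "(y ^^ q) w = 0"
  shows "((\<lambda>u. x u - y u) ^^ (p + q)) w = 0"
  using assms(4,5)
proof (induction "p + q" arbitrary: p q w)
  case 0
  then show ?case by simp
next
  case (Suc n)
  let ?z = "\<lambda>u. x u - y u"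
  have z: "Modules.additive ?z"
    using assms(1,2) by (simp add: Modules.additive_def)
  show ?case
  proof (cases "p = 0 \<or> q = 0")
    case True
    then have "w = 0" using Suc.prems by auto
    then show ?thesis using Modules.additive.zero[OF additive_funpow[OF z]] by simp
  next
    case False
    then obtain p' q' where pq: "p = Suc p'" "q = Suc q'"
      by (metis not0_implies_Suc)
    have "(x ^^ p') (x w) = 0" "(y ^^ q') (y w) = 0"
      using Suc.prems by (simp_all add: pq funpow_swap1)
    moreover have "(y ^^ q) (x w) = 0" "(x ^^ p) (y w) = 0"
      using Suc.prems funpow_commute_point[of y x q w] funpow_commute_point[of x y p w] comm
        Modules.additive.zero[OF assms(1)] Modules.additive.zero[OF assms(2)] by simp_all
    ultimately have "(?z ^^ (p' + q)) (x w) = 0" "(?z ^^ (p + q')) (y w) = 0"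
      using Suc.hyps(1)[of p' q "x w"] Suc.hyps(1)[of p q' "y w"] Suc.hyps(2) pq by simp_all
    moreover have "n = p' + q" "n = p + q'" using Suc.hyps(2) pq by simp_all
    ultimately have "(?z ^^ n) (x w - y w) = 0"
      using Modules.additive.diff[OF additive_funpow[OF z]] by simp
    then show ?thesis
      by (simp only: funpow_Suc_right o_apply flip: Suc.hyps(2))
  qed
qed

section \<open>Formal distributions and expansions of powers of a difference\<close>

text \<open>
  A function \<open>X\<close> stands for the formal distribution with coefficient \<open>X m k\<close> at
  \<open>z1 powi (- m - 1) * z2 powi (- k - 1)\<close>; in this reading \<open>sdiff\<close> is multiplication by \<open>z1 - z2\<close>.
\<close>

definition sdiff :: "(int \<Rightarrow> int \<Rightarrow> 'b::ab_group_add) \<Rightarrow> int \<Rightarrow> int \<Rightarrow> 'b" where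
  "sdiff X m k = X (m + 1) k - X m (k + 1)"

text \<open>
  The powers of \<open>z2\<close> are bounded below, uniformly in the power of \<open>z1\<close>. Each coefficient of the
  product with a power series in \<open>z2 / z1\<close> is then a finite sum.
\<close>

definition truncated :: "(int \<Rightarrow> int \<Rightarrow> complex) \<Rightarrow> bool" where
  "truncated x \<longleftrightarrow> (\<exists>K. \<forall>m k. K \<le> k \<longrightarrow> x m k = 0)"

text \<open>
  Multiplication by \<open>(z1 - z2) powi n\<close>, expanded for \<open>norm z2 < norm z1\<close>; \<open>iota2\<close> below uses the
  expansion for \<open>norm z1 < norm z2\<close>. The index set makes the sum finite, hence meaningful, for
  truncated distributions.
\<close>

definition iota1 :: "int \<Rightarrow> (int \<Rightarrow> int \<Rightarrow> complex) \<Rightarrow> int \<Rightarrow> int \<Rightarrow> complex" where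
  "iota1 n x m k = (\<Sum>j | x (m + n - int j) (k + int j) \<noteq> 0.
     (-1) ^ j * (of_int n gchoose j) * x (m + n - int j) (k + int j))"

definition iota2 :: "int \<Rightarrow> (int \<Rightarrow> int \<Rightarrow> complex) \<Rightarrow> int \<Rightarrow> int \<Rightarrow> complex" where
  "iota2 n x m k = (-1) powi n * iota1 n (\<lambda>k m. x m k) k m"

lemma iota1_eq:
  assumes "\<And>m k. K \<le> k \<Longrightarrow> x m k = 0" "K \<le> k + int J"
  shows "iota1 n x m k = (\<Sum>j<J. (-1) ^ j * (of_int n gchoose j) * x (m + n - int j) (k + int j))"
  unfolding iota1_def
proof (rule sum.mono_neutral_left)
  show "{j. x (m + n - int j) (k + int j) \<noteq> 0} \<subseteq> {..<J}"
  proof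
    fix j assume "j \<in> {j. x (m + n - int j) (k + int j) \<noteq> 0}"
    then have "\<not> K \<le> k + int j" using assms(1) by auto
    then show "j \<in> {..<J}" using assms(2) by auto
  qed
qed auto

lemma truncated_diff:
  assumes "truncated x" "truncated y"
  shows "truncated (\<lambda>m k. x m k - y m k)"
proof -
  obtain K1 K2 where "\<And>m k. K1 \<le> k \<Longrightarrow> x m k = 0" "\<And>m k. K2 \<le> k \<Longrightarrow> y m k = 0"
    using assms unfolding truncated_def by metis
  then show ?thesis unfolding truncated_def by (intro exI[of _ "max K1 K2"]) simp
qed

lemma truncated_shift:
  assumes "truncated x"
  shows "truncated (\<lambda>m k. x (m + 1) k)" "truncated (\<lambda>m k. x m (k + 1))"
  using assms unfolding truncated_def by (meson, smt (verit))

lemma iota1_diff: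
  assumes "truncated x" "truncated y"
  shows "iota1 n (\<lambda>m k. x m k - y m k) m k = iota1 n x m k - iota1 n y m k"
proof -
  obtain K1 K2 where K: "\<And>m k. K1 \<le> k \<Longrightarrow> x m k = 0" "\<And>m k. K2 \<le> k \<Longrightarrow> y m k = 0"
    using assms unfolding truncated_def by metis
  define J where "J = nat (max K1 K2 - k)"
  have J: "K1 \<le> k + int J" "K2 \<le> k + int J" "max K1 K2 \<le> k + int J"
    by (auto simp: J_def)
  have "iota1 n (\<lambda>m k. x m k - y m k) m k =
      (\<Sum>j<J. (-1) ^ j * (of_int n gchoose j) *
         (x (m + n - int j) (k + int j) - y (m + n - int j) (k + int j)))"
    using K J by (intro iota1_eq[where K = "max K1 K2"]) auto
  then show ?thesis
    using iota1_eq[of K1 x k J n m] iota1_eq[of K2 y k J n m] K J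
    by (simp add: sum_subtractf right_diff_distrib)
qed

text \<open>
  Pascal's rule, in the form \<open>(z1 - z2) * (z1 - z2) powi n = (z1 - z2) powi (n + 1)\<close>.
\<close>

lemma sdiff_iota1:
  assumes "truncated x"
  shows "sdiff (iota1 n x) = iota1 (n + 1) x"
proof (intro ext)
  fix m k
  obtain K where K: "\<And>m k. K \<le> k \<Longrightarrow> x m k = 0"
    using assms unfolding truncated_def by metis
  define J where "J = nat (K - k)"
  let ?c = "\<lambda>n j. (-1) ^ j * (of_int n gchoose j :: complex)"
  let ?x = "\<lambda>j. x (m + n + 1 - int j) (k + int j)"
  have "iota1 n x (m + 1) k = (\<Sum>j<Suc J. ?c n j * ?x j)"
    using K by (subst iota1_eq[of K x k "Suc J"]) (auto simp: J_def algebra_simps)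
  also have "\<dots> = ?x 0 + (\<Sum>j<J. ?c n (Suc j) * ?x (Suc j))"
    by (subst sum.lessThan_Suc_shift) simp
  finally have 1: "iota1 n x (m + 1) k = ?x 0 + (\<Sum>j<J. ?c n (Suc j) * ?x (Suc j))" .
  have 2: "iota1 n x m (k + 1) = (\<Sum>j<J. ?c n j * ?x (Suc j))"
    using K by (subst iota1_eq[of K x "k + 1" J]) (auto simp: J_def algebra_simps)
  have "iota1 (n + 1) x m k = (\<Sum>j<Suc J. ?c (n + 1) j * ?x j)"
    using K by (subst iota1_eq[of K x k "Suc J"]) (auto simp: J_def algebra_simps)
  also have "\<dots> = ?x 0 + (\<Sum>j<J. ?c (n + 1) (Suc j) * ?x (Suc j))"
    by (subst sum.lessThan_Suc_shift) simp
  also have "(\<Sum>j<J. ?c (n + 1) (Suc j) * ?x (Suc j)) =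
      (\<Sum>j<J. ?c n (Suc j) * ?x (Suc j) - ?c n j * ?x (Suc j))"
  proof (rule sum.cong, goal_cases)
    case (2 j)
    have "(of_int (n + 1) gchoose Suc j :: complex) = (of_int n gchoose j) + (of_int n gchoose Suc j)"
      using gbinomial_Suc_Suc[of "of_int n :: complex" j] by simp
    then show ?case by (simp add: algebra_simps)
  qed simp
  finally show "sdiff (iota1 n x) m k = iota1 (n + 1) x m k"
    by (simp add: sdiff_def 1 2 sum_subtractf)
qed

lemma sdiff_iota2:
  assumes "truncated (\<lambda>k m. x m k)"
  shows "sdiff (iota2 n x) = iota2 (n + 1) x"
proof (intro ext)
  fix m k
  have "sdiff (iota2 n x) m k = - ((-1) powi n * sdiff (iota1 n (\<lambda>k m. x m k)) k m)"
    by (simp add: sdiff_def iota2_def algebra_simps)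
  then show "sdiff (iota2 n x) m k = iota2 (n + 1) x m k"
    by (simp add: sdiff_iota1[OF assms] iota2_def power_int_add)
qed

lemma iota1_0:
  assumes "truncated x"
  shows "iota1 0 x = x"
proof (intro ext)
  fix m k
  obtain K where K: "\<And>m k. K \<le> k \<Longrightarrow> x m k = 0"
    using assms unfolding truncated_def by metis
  have "iota1 0 x m k = (\<Sum>j<Suc (nat (K - k)). (-1) ^ j * (0 gchoose j) * x (m - int j) (k + int j))"
    using K by (subst iota1_eq[of K x k "Suc (nat (K - k))"]) auto
  also have "\<dots> = x m k"
    by (subst sum.lessThan_Suc_shift) simp
  finally show "iota1 0 x m k = x m k" .
qed

lemma iota2_0:
  assumes "truncated (\<lambda>k m. x m k)"
  shows "iota2 0 x = x"
  by (intro ext) (simp add: iota2_def iota1_0[OF assms])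

lemma funpow_sdiff_iota1:
  assumes "truncated x"
  shows "(sdiff ^^ p) (iota1 n x) = iota1 (n + int p) x"
  by (induction p) (simp_all add: sdiff_iota1[OF assms] add_ac)

lemma funpow_sdiff_iota2:
  assumes "truncated (\<lambda>k m. x m k)"
  shows "(sdiff ^^ p) (iota2 n x) = iota2 (n + int p) x"
  by (induction p) (simp_all add: sdiff_iota2[OF assms] add_ac)

lemma iota1_nat:
  assumes "truncated x"
  shows "iota1 (int q) x = (sdiff ^^ q) x"
  using funpow_sdiff_iota1[OF assms, of q 0] by (simp add: iota1_0[OF assms])

lemma iota2_nat:
  assumes "truncated (\<lambda>k m. x m k)"
  shows "iota2 (int q) x = (sdiff ^^ q) x"
  using funpow_sdiff_iota2[OF assms, of q 0] by (simp add: iota2_0[OF assms])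

lemma additive_sdiff: "Modules.additive sdiff"
  by (simp add: Modules.additive_def sdiff_def fun_eq_iff)

section \<open>Dong's lemma for arrays of numbers\<close>

type_synonym distribution3 = "int \<Rightarrow> int \<Rightarrow> int \<Rightarrow> complex"

text \<open>
  With \<open>X m k l\<close> as the coefficient at
  \<open>z1 powi (- m - 1) * z2 powi (- k - 1) * z3 powi (- l - 1)\<close>, these are the multiplications by
  \<open>z1 - z2\<close>, \<open>z1 - z3\<close> and \<open>z2 - z3\<close>.
\<close>

definition diff12 :: "distribution3 \<Rightarrow> distribution3" where
  "diff12 X = (\<lambda>m k l. X (m + 1) k l - X m (k + 1) l)"

definition diff13 :: "distribution3 \<Rightarrow> distribution3" where
  "diff13 X = (\<lambda>m k l. X (m + 1) k l - X m k (l + 1))"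

definition diff23 :: "distribution3 \<Rightarrow> distribution3" where
  "diff23 X = (\<lambda>m k l. X m (k + 1) l - X m k (l + 1))"

lemma additive_diff: "Modules.additive diff12" "Modules.additive diff13" "Modules.additive diff23"
  by (simp_all add: Modules.additive_def diff12_def diff13_def diff23_def fun_eq_iff)

lemma diff_commute:
  "diff12 (diff13 X) = diff13 (diff12 X)" "diff12 (diff23 X) = diff23 (diff12 X)"
  "diff13 (diff23 X) = diff23 (diff13 X)"
  by (simp_all add: diff12_def diff13_def diff23_def fun_eq_iff)

text \<open>
  The relation \<open>z2 - z3 = (z1 - z3) - (z1 - z2)\<close>, on which Dong's lemma rests.
\<close>

lemma diff23_eq: "diff23 = (\<lambda>X. diff13 X - diff12 X)"
  by (simp add: diff12_def diff13_def diff23_def fun_eq_iff)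

lemma funpow_diff12: "(diff12 ^^ p) X m k l = (sdiff ^^ p) (\<lambda>m k. X m k l) m k"
  by (induction p arbitrary: m k) (simp_all add: diff12_def sdiff_def)

lemma funpow_diff13: "(diff13 ^^ p) X m k l = (sdiff ^^ p) (\<lambda>m l. X m k l) m l"
  by (induction p arbitrary: m l) (simp_all add: diff13_def sdiff_def)

lemma funpow_diff23: "(diff23 ^^ p) X m k l = (sdiff ^^ p) (X m) k l"
  by (induction p arbitrary: k l) (simp_all add: diff23_def sdiff_def)

definition expand1 :: "int \<Rightarrow> distribution3 \<Rightarrow> distribution3" where
  "expand1 n X = (\<lambda>m k l. iota1 n (\<lambda>m k. X m k l) m k)"

definition expand2 :: "int \<Rightarrow> distribution3 \<Rightarrow> distribution3" where
  "expand2 n X = (\<lambda>m k l. iota2 n (\<lambda>m k. X m k l) m k)"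

text \<open>
  The bound may depend on \<open>l\<close>: for modes, \<open>B k (C l v)\<close> vanishes for large \<open>k\<close>, but how large depends
  on the vector \<open>C l v\<close>.
\<close>

definition trunc1 :: "distribution3 \<Rightarrow> bool" where
  "trunc1 X \<longleftrightarrow> (\<forall>l. truncated (\<lambda>m k. X m k l))"

definition trunc2 :: "distribution3 \<Rightarrow> bool" where
  "trunc2 X \<longleftrightarrow> (\<forall>l. truncated (\<lambda>k m. X m k l))"

lemma trunc_minus:
  "trunc1 X \<Longrightarrow> trunc1 Y \<Longrightarrow> trunc1 (X - Y)"
  "trunc2 X \<Longrightarrow> trunc2 Y \<Longrightarrow> trunc2 (X - Y)"
  by (simp_all add: trunc1_def trunc2_def truncated_diff)

lemma trunc_diff:
  "trunc1 X \<Longrightarrow> trunc1 (diff13 X)" "trunc1 X \<Longrightarrow> trunc1 (diff23 X)"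
  "trunc2 X \<Longrightarrow> trunc2 (diff13 X)" "trunc2 X \<Longrightarrow> trunc2 (diff23 X)"
proof -
  note shift1 = truncated_shift[of "\<lambda>m k. X m k l" for l]
  note shift2 = truncated_shift[of "\<lambda>k m. X m k l" for l]
  show "trunc1 X \<Longrightarrow> trunc1 (diff13 X)" "trunc1 X \<Longrightarrow> trunc1 (diff23 X)"
    unfolding trunc1_def diff13_def diff23_def using shift1 by (auto intro!: truncated_diff)
  show "trunc2 X \<Longrightarrow> trunc2 (diff13 X)" "trunc2 X \<Longrightarrow> trunc2 (diff23 X)"
    unfolding trunc2_def diff13_def diff23_def using shift2 by (auto intro!: truncated_diff)
qed

lemma trunc_funpow:
  "trunc1 X \<Longrightarrow> trunc1 ((diff13 ^^ p) X)" "trunc1 X \<Longrightarrow> trunc1 ((diff23 ^^ p) X)"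
  "trunc2 X \<Longrightarrow> trunc2 ((diff13 ^^ p) X)" "trunc2 X \<Longrightarrow> trunc2 ((diff23 ^^ p) X)"
  by (induction p) (simp_all add: trunc_diff)

lemma expand1_minus:
  "trunc1 X \<Longrightarrow> trunc1 Y \<Longrightarrow> expand1 n (X - Y) = expand1 n X - expand1 n Y"
  by (simp add: expand1_def trunc1_def fun_eq_iff iota1_diff)

lemma expand2_minus:
  "trunc2 X \<Longrightarrow> trunc2 Y \<Longrightarrow> expand2 n (X - Y) = expand2 n X - expand2 n Y"
  by (simp add: expand2_def iota2_def trunc2_def fun_eq_iff iota1_diff right_diff_distrib)

lemma iota1_shift:
  "iota1 n (\<lambda>m k. x (m + 1) k) m k = iota1 n x (m + 1) k"
  "iota1 n (\<lambda>m k. x m (k + 1)) m k = iota1 n x m (k + 1)"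
  by (simp_all add: iota1_def algebra_simps)

lemma expand_diff:
  "trunc1 X \<Longrightarrow> diff13 (expand1 n X) = expand1 n (diff13 X)"
  "trunc1 X \<Longrightarrow> diff23 (expand1 n X) = expand1 n (diff23 X)"
  "trunc2 X \<Longrightarrow> diff13 (expand2 n X) = expand2 n (diff13 X)"
  "trunc2 X \<Longrightarrow> diff23 (expand2 n X) = expand2 n (diff23 X)"
proof -
  note shift1 = truncated_shift[of "\<lambda>m k. X m k l" for l]
  note shift2 = truncated_shift[of "\<lambda>k m. X m k l" for l]
  note iota = iota1_shift[of n "\<lambda>m k. X m k l" for l] iota1_shift[of n "\<lambda>k m. X m k l" for l]
  show "diff13 (expand1 n X) = expand1 n (diff13 X)" "diff23 (expand1 n X) = expand1 n (diff23 X)"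
    if "trunc1 X"
    using that unfolding trunc1_def expand1_def diff13_def diff23_def
    by (simp_all add: fun_eq_iff iota1_diff shift1 iota)
  show "diff13 (expand2 n X) = expand2 n (diff13 X)" "diff23 (expand2 n X) = expand2 n (diff23 X)"
    if "trunc2 X"
    using that unfolding trunc2_def expand2_def iota2_def diff13_def diff23_def
    by (simp_all add: fun_eq_iff iota1_diff shift2 iota right_diff_distrib)
qed

lemma expand_funpow:
  "trunc1 X \<Longrightarrow> (diff13 ^^ p) (expand1 n X) = expand1 n ((diff13 ^^ p) X)"
  "trunc1 X \<Longrightarrow> (diff23 ^^ p) (expand1 n X) = expand1 n ((diff23 ^^ p) X)"
  "trunc2 X \<Longrightarrow> (diff13 ^^ p) (expand2 n X) = expand2 n ((diff13 ^^ p) X)"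
  "trunc2 X \<Longrightarrow> (diff23 ^^ p) (expand2 n X) = expand2 n ((diff23 ^^ p) X)"
  by (induction p) (simp_all add: trunc_funpow expand_diff)

lemma expand_0: "expand1 n 0 = 0" "expand2 n 0 = 0"
  by (simp_all add: expand1_def expand2_def iota2_def iota1_def fun_eq_iff)

text \<open>
  A negative power of \<open>z1 - z2\<close> has two different expansions, but both become the same polynomial
  after multiplication by a large power of \<open>z1 - z2\<close>.
\<close>

lemma funpow_diff12_expand:
  assumes "trunc1 X" "trunc2 Y" "int q = n + int p"
  shows "(diff12 ^^ p) (expand1 n X - expand2 n Y) = (diff12 ^^ q) (X - Y)"
proof -
  have "(diff12 ^^ p) (expand1 n X) = (diff12 ^^ q) X"
    using assms(1,3)
    by (simp add: fun_eq_iff funpow_diff12 expand1_def trunc1_def funpow_sdiff_iota1 flip: iota1_nat)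
  moreover have "(diff12 ^^ p) (expand2 n Y) = (diff12 ^^ q) Y"
    using assms(2,3)
    by (simp add: fun_eq_iff funpow_diff12 expand2_def trunc2_def funpow_sdiff_iota2 flip: iota2_nat)
  ultimately show ?thesis
    by (simp add: Modules.additive.diff[OF additive_funpow[OF additive_diff(1)]])
qed

text \<open>
  The arrays \<open>a\<close>, \<open>b\<close>, \<open>c\<close>, \<open>d\<close> are the coefficients of the products in the orders \<open>ABC\<close>, \<open>BAC\<close>,
  \<open>CAB\<close>, \<open>CBA\<close>. Multiplication by \<open>z1 - z3\<close> and \<open>z2 - z3\<close> commutes with both expansions, so
  \<open>(z1 - z3) ^ q * (z2 - z3) ^ r\<close> annihilates the combination; \<open>(z1 - z2) ^ (p + nat (- n))\<close> annihilates
  it because the exponent compensates \<open>n\<close> and leaves at least \<open>p\<close>. The claim follows by writing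
  \<open>z2 - z3\<close> as the difference of \<open>z1 - z3\<close> and \<open>z1 - z2\<close>. The exponent is explicit because it has to
  be the same for all vectors and functionals.
\<close>

lemma dong_array:
  assumes T: "trunc1 a" "trunc2 b" "trunc1 c" "trunc2 d"
    and ab: "(diff12 ^^ p) (a - b) = 0" and cd: "(diff12 ^^ p) (c - d) = 0"
    and ac: "(diff13 ^^ q) ((diff23 ^^ r) (a - c)) = 0"
    and bd: "(diff13 ^^ q) ((diff23 ^^ r) (b - d)) = 0"
  shows "(diff23 ^^ (q + (p + nat (- n)) + r))
           ((expand1 n a - expand2 n b) - (expand1 n c - expand2 n d)) = 0"
proof -
  let ?u = "(expand1 n a - expand2 n b) - (expand1 n c - expand2 n d)"
  have add: "Modules.additive (diff12 ^^ i)" "Modules.additive (diff13 ^^ i)" "Modules.additive (diff23 ^^ i)" for i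
    by (simp_all add: additive_funpow additive_diff)
  have u: "?u = expand1 n (a - c) - expand2 n (b - d)"
    using T by (simp add: expand1_minus expand2_minus)
  moreover have "(diff13 ^^ q) ((diff23 ^^ r) (expand1 n (a - c))) = 0"
    by (simp only: expand_funpow trunc_funpow trunc_minus T ac expand_0)
  moreover have "(diff13 ^^ q) ((diff23 ^^ r) (expand2 n (b - d))) = 0"
    by (simp only: expand_funpow trunc_funpow trunc_minus T bd expand_0)
  ultimately have 13: "(diff13 ^^ q) ((diff23 ^^ r) ?u) = 0"
    by (simp only: u Modules.additive.diff[OF add(2)] Modules.additive.diff[OF add(3)] diff_self)
  \<comment> \<open>Since \<open>n + P \<ge> p\<close>, both expansions turn into the polynomial \<open>(z1 - z2) ^ Q\<close>.\<close>
  define P where "P = p + nat (- n)"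
  define Q where "Q = nat (n + int P)"
  have Q: "int Q = n + int P" "p \<le> Q" by (auto simp: Q_def P_def)
  have "(diff12 ^^ Q) (a - b) = 0" "(diff12 ^^ Q) (c - d) = 0"
    by (rule funpow_eq_0_mono[OF additive_diff(1) ab Q(2)],
        rule funpow_eq_0_mono[OF additive_diff(1) cd Q(2)])
  then have "(diff12 ^^ P) ?u = 0"
    unfolding Modules.additive.diff[OF add(1), of P "expand1 n a - expand2 n b"]
      funpow_diff12_expand[OF T(1,2) Q(1)] funpow_diff12_expand[OF T(3,4) Q(1)] by simp
  then have 12: "(diff12 ^^ P) ((diff23 ^^ r) ?u) = 0"
    by (simp only: funpow_funpow_commute[of diff12 diff23, OF diff_commute(2)]
        Modules.additive.zero[OF add(3)])
  have "(diff23 ^^ (q + P)) ((diff23 ^^ r) ?u) = 0"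
    by (subst (1) diff23_eq)
      (rule funpow_diff_eq_0[OF additive_diff(2,1) diff_commute(1)[symmetric] 13 12])
  then show ?thesis by (simp add: funpow_add P_def)
qed

section \<open>Newton interpolation\<close>

definition fdiff :: "(int \<Rightarrow> complex) \<Rightarrow> int \<Rightarrow> complex" where
  "fdiff x m = x (m + 1) - x m"

lemma additive_fdiff: "Modules.additive fdiff"
  by (simp add: Modules.additive_def fdiff_def fun_eq_iff)

lemma fdiff_eq_0_imp_const:
  assumes "fdiff x = 0"
  shows "x m = x 0"
proof (induction m rule: int_induct[where k = 0])
  case (step1 i)
  then show ?case using fun_cong[OF assms, of i] by (simp add: fdiff_def)
next
  case (step2 i)
  then show ?case using fun_cong[OF assms, of "i - 1"] by (simp add: fdiff_def)
qed simp

lemma fdiff_gbinomial: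
  "fdiff (\<lambda>m. of_int m gchoose Suc i) = (\<lambda>m. of_int m gchoose i)"
  using gbinomial_Suc_Suc[of "of_int _ :: complex" i] by (simp add: fdiff_def fun_eq_iff)

text \<open>
  Newton's forward difference formula. It also holds for negative \<open>m\<close>, since a sequence on all
  integers is determined by its difference and its value at \<open>0\<close>.
\<close>

lemma newton_expansion:
  assumes "(fdiff ^^ N) x = 0"
  shows "x m = (\<Sum>i<N. (fdiff ^^ i) x 0 * (of_int m gchoose i))"
  using assms
proof (induction N arbitrary: x m)
  case 0
  then show ?case by simp
next
  case (Suc N)
  define y where "y = (\<lambda>m. x m - (\<Sum>i<Suc N. (fdiff ^^ i) x 0 * (of_int m gchoose i)))"
  have "fdiff x m = (\<Sum>i<N. (fdiff ^^ i) (fdiff x) 0 * (of_int m gchoose i))" for m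
    using Suc.prems by (intro Suc.IH) (simp add: funpow_swap1)
  moreover have y_eq: "y = (\<lambda>m. x m - (x 0 + (\<Sum>i<N. (fdiff ^^ i) (fdiff x) 0 * (of_int m gchoose Suc i))))"
    unfolding y_def by (subst sum.lessThan_Suc_shift) (simp add: funpow_swap1)
  moreover have "fdiff y m = fdiff x m -
      (\<Sum>i<N. (fdiff ^^ i) (fdiff x) 0 * fdiff (\<lambda>m. of_int m gchoose Suc i) m)" for m
    unfolding y_eq fdiff_def[of "\<lambda>m. x m - _ m"] fdiff_def[of "\<lambda>m. of_int m gchoose _"]
    by (simp add: fdiff_def[of x m] right_diff_distrib sum_subtractf)
  ultimately have "fdiff y m = 0" for m
    by (simp only: fdiff_gbinomial diff_self)
  then have "y m = y 0" by (intro fdiff_eq_0_imp_const) (simp add: fun_eq_iff)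
  moreover have "y 0 = 0" unfolding y_def
    by (subst sum.lessThan_Suc_shift) simp
  ultimately show ?case by (simp add: y_def)
qed

text \<open>
  Multiplication by \<open>z1 - z2\<close> preserves homogeneity. On the coefficients of one total degree it is the
  difference operator in the index of \<open>z1\<close>.
\<close>

lemma funpow_sdiff_eq_fdiff:
  "(sdiff ^^ N) X m k = (fdiff ^^ N) (\<lambda>i. X i (m + k + int N - i)) m"
proof (induction N arbitrary: m k)
  case (Suc N)
  then show ?case by (simp add: sdiff_def fdiff_def algebra_simps)
qed simp

section \<open>Two-sided series over the integers\<close>

text \<open>
  Sums over the integers make shifts of the index trivial. These two lemmas return to series
  over the natural numbers when the terms vanish on one side.
\<close>

lemma has_sum_int_up:
  fixes f :: "int \<Rightarrow> complex"
  assumes "\<And>m. m < M \<Longrightarrow> f m = 0"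
  shows "((\<lambda>n. f (M + int n)) has_sum S) UNIV \<longleftrightarrow> (f has_sum S) UNIV"
proof -
  have "(f has_sum S) UNIV \<longleftrightarrow> (f has_sum S) {M..}"
    using assms by (intro has_sum_cong_neutral) auto
  also have "\<dots> \<longleftrightarrow> ((\<lambda>n. f (M + int n)) has_sum S) UNIV"
    by (rule has_sum_reindex_bij_witness[of _ "\<lambda>n. M + int n" "\<lambda>m. nat (m - M)"]) auto
  finally show ?thesis by simp
qed

lemma has_sum_int_down:
  fixes f :: "int \<Rightarrow> complex"
  assumes "\<And>m. M < m \<Longrightarrow> f m = 0"
  shows "((\<lambda>n. f (M - int n)) has_sum S) UNIV \<longleftrightarrow> (f has_sum S) UNIV"
proof -
  have "(f has_sum S) UNIV \<longleftrightarrow> (f has_sum S) {..M}"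
    using assms by (intro has_sum_cong_neutral) auto
  also have "\<dots> \<longleftrightarrow> ((\<lambda>n. f (M - int n)) has_sum S) UNIV"
    by (rule has_sum_reindex_bij_witness[of _ "\<lambda>n. M - int n" "\<lambda>m. nat (M - m)"]) auto
  finally show ?thesis by simp
qed

lemma has_sum_sum:
  fixes f :: "'i \<Rightarrow> 'a \<Rightarrow> complex"
  assumes "finite I" "\<And>i. i \<in> I \<Longrightarrow> (f i has_sum S i) A"
  shows "((\<lambda>x. \<Sum>i\<in>I. f i x) has_sum (\<Sum>i\<in>I. S i)) A"
  using assms by (induction I rule: finite_induct) (simp_all add: has_sum_add)

lemma powser_has_sum:
  fixes a :: "nat \<Rightarrow> complex"
  assumes "\<And>t. norm t < 1 \<Longrightarrow> (\<lambda>n. a n * t ^ n) sums f t" "norm t < 1"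
  shows "((\<lambda>n. a n * t ^ n) has_sum f t) UNIV"
proof -
  obtain r where r: "norm t < r" "r < 1" using assms(2) dense by blast
  then have "norm (complex_of_real r) < 1" "norm t < norm (complex_of_real r)"
    using r norm_ge_zero[of t] by (auto simp del: norm_ge_zero)
  then have "summable (\<lambda>n. norm (a n * t ^ n))"
    using powser_insidea[of a "of_real r" t] assms(1)[of "of_real r"] sums_summable by blast
  then show ?thesis using assms by (intro norm_summable_imp_has_sum) auto
qed

lemma negative_binomial_sums:
  fixes t :: complex
  assumes "norm t < 1"
  shows "(\<lambda>n. of_nat ((n + i) choose i) * t ^ n) sums (1 / (1 - t) ^ Suc i)"
proof -
  have t: "1 - t \<noteq> 0" using assms by auto
  have "(\<lambda>n. (- of_nat (Suc i) gchoose n) * (- t) ^ n) sums (1 + (- t)) powr (- of_nat (Suc i))"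
    using assms by (intro gen_binomial_complex) simp
  moreover have "(- of_nat (Suc i) gchoose n) * (- t) ^ n = of_nat ((n + i) choose i) * t ^ n" for n
  proof -
    have "(- of_nat (Suc i) gchoose n :: complex) = (-1) ^ n * (of_nat (n + i) gchoose n)"
      by (subst gbinomial_minus) (simp add: algebra_simps)
    also have "(of_nat (n + i) gchoose n :: complex) = of_nat ((n + i) choose i)"
      using binomial_symmetric[of i "n + i"] by (simp flip: binomial_gbinomial del: of_nat_add)
    finally show ?thesis by (simp add: power_minus[of t])
  qed
  moreover have "(1 + (- t)) powr (- of_nat (Suc i)) = 1 / (1 - t) ^ Suc i"
    using t powr_nat'[of "1 - t" "Suc i"]
    by (simp only: powr_minus add_uminus_conv_diff inverse_eq_divide simp_thms)
  ultimately show ?thesis by simp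
qed

lemma powi_minus_Suc: "z powi (- int i - 1) = 1 / (z :: complex) ^ Suc i"
proof -
  have "- int i - 1 = - int (Suc i)" by simp
  then have "z powi (- int i - 1) = z powi (- int (Suc i))" by (simp only:)
  also have "\<dots> = 1 / z ^ Suc i"
    by (simp only: power_int_minus power_int_of_nat inverse_eq_divide)
  finally show ?thesis .
qed

text \<open>
  The expansions of a pole on the two sides of \<open>norm z1 = norm z2\<close> have as coefficients the two halves
  of one polynomial in \<open>m\<close>, with opposite signs: here \<open>m gchoose i\<close> on \<open>m \<ge> 0\<close>, and in
  \<open>polar_part_inner\<close> its negative on \<open>m < 0\<close>.
\<close>

lemma polar_part_outer:
  fixes z1 z2 :: complex
  assumes "0 < norm z2" "norm z2 < norm z1"
  shows "((\<lambda>m. (if 0 \<le> m then of_int m gchoose i else 0) * (z1 powi (-m-1) * z2 powi (m-s-1)))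
           has_sum (z2 powi (int i - s - 1) * (z1 - z2) powi (- int i - 1))) UNIV"
proof -
  have nz: "z1 \<noteq> 0" "z2 \<noteq> 0" "z1 \<noteq> z2" using assms by auto
  have t: "norm (z2 / z1) < 1" using assms by (simp add: norm_divide divide_simps)
  let ?P = "z1 powi (- int i - 1) * z2 powi (int i - s - 1)"
  have "((\<lambda>n. ?P * (of_nat ((n + i) choose i) * (z2 / z1) ^ n)) has_sum
          ?P * (1 / (1 - z2 / z1) ^ Suc i)) UNIV"
    by (rule has_sum_cmult_right, rule powser_has_sum[OF negative_binomial_sums t])
  moreover have "?P * (of_nat ((n + i) choose i) * (z2 / z1) ^ n) =
      (if 0 \<le> int i + int n then of_int (int i + int n) gchoose i else 0) *
        (z1 powi (-(int i + int n)-1) * z2 powi ((int i + int n)-s-1))" for n :: nat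
  proof -
    have "(of_int (int i + int n) gchoose i :: complex) = of_nat ((n + i) choose i)"
      by (simp add: binomial_gbinomial add.commute)
    moreover have "z1 powi (-(int i + int n)-1) = z1 powi (- int i - 1) / z1 ^ n"
      using nz power_int_diff[of z1 "- int i - 1" "int n"] by (simp add: algebra_simps)
    moreover have "z2 powi ((int i + int n)-s-1) = z2 powi (int i - s - 1) * z2 ^ n"
      using nz power_int_add[of z2 "int i - s - 1" "int n"] by (simp add: algebra_simps)
    ultimately show ?thesis by (simp add: power_divide)
  qed
  moreover have "?P * (1 / (1 - z2 / z1) ^ Suc i) =
      z2 powi (int i - s - 1) * (z1 - z2) powi (- int i - 1)"
  proof -
    have "(1 - z2 / z1) ^ Suc i = (z1 - z2) ^ Suc i / z1 ^ Suc i"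
      using nz by (simp only: power_divide[symmetric]) (simp add: divide_simps)
    then show ?thesis using nz by (simp add: powi_minus_Suc)
  qed
  ultimately have "((\<lambda>n. (if 0 \<le> int i + int n then of_int (int i + int n) gchoose i else 0) *
        (z1 powi (-(int i + int n)-1) * z2 powi ((int i + int n)-s-1))) has_sum
      z2 powi (int i - s - 1) * (z1 - z2) powi (- int i - 1)) UNIV"
    by (simp only:)
  then show ?thesis
  proof (subst (asm) has_sum_int_up, goal_cases)
    case (1 m)
    show ?case
    proof (cases "0 \<le> m")
      case True
      then have "(of_int m gchoose i :: complex) = of_nat (nat m choose i)"
        by (simp add: binomial_gbinomial)
      then show ?thesis using 1 True by (simp add: binomial_eq_0)
    qed simp
  qed
qed

lemma polar_part_inner:
  fixes z1 z2 :: complex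
  assumes "0 < norm z1" "norm z1 < norm z2"
  shows "((\<lambda>m. (if m < 0 then - (of_int m gchoose i) else 0) * (z1 powi (-m-1) * z2 powi (m-s-1)))
           has_sum (z2 powi (int i - s - 1) * (z1 - z2) powi (- int i - 1))) UNIV"
proof -
  have nz: "z1 \<noteq> 0" "z2 \<noteq> 0" "z1 \<noteq> z2" using assms by auto
  have t: "norm (z1 / z2) < 1" using assms by (simp add: norm_divide divide_simps)
  let ?P = "(-1) ^ Suc i * z2 powi (- s - 2)"
  have "((\<lambda>n. ?P * (of_nat ((n + i) choose i) * (z1 / z2) ^ n)) has_sum
          ?P * (1 / (1 - z1 / z2) ^ Suc i)) UNIV"
    by (rule has_sum_cmult_right, rule powser_has_sum[OF negative_binomial_sums t])
  moreover have "?P * (of_nat ((n + i) choose i) * (z1 / z2) ^ n) =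
      (if -1 - int n < 0 then - (of_int (-1 - int n) gchoose i) else 0) *
        (z1 powi (-(-1 - int n)-1) * z2 powi ((-1 - int n)-s-1))" for n
  proof -
    have "(of_int (-1 - int n) gchoose i :: complex) = (-1) ^ i * of_nat ((n + i) choose i)"
      by (subst gbinomial_negated_upper) (simp add: binomial_gbinomial add.commute)
    moreover have "z2 powi ((-1 - int n)-s-1) = z2 powi (- s - 2) / z2 ^ n"
      using nz power_int_diff[of z2 "- s - 2" "int n"] by (simp add: algebra_simps)
    ultimately show ?thesis by (simp add: power_divide)
  qed
  moreover have "?P * (1 / (1 - z1 / z2) ^ Suc i) =
      z2 powi (int i - s - 1) * (z1 - z2) powi (- int i - 1)"
  proof -
    have "(1 - z1 / z2) ^ Suc i = (z2 - z1) ^ Suc i / z2 ^ Suc i"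
      using nz by (simp only: power_divide[symmetric]) (simp add: divide_simps)
    moreover have "(z2 - z1) ^ Suc i = (-1) ^ Suc i * (z1 - z2) ^ Suc i"
      using power_minus[of "z1 - z2" "Suc i"] by simp
    moreover have "z2 powi (int i - s - 1) = z2 powi (- s - 2) * z2 ^ Suc i"
    proof -
      have "int i - s - 1 = (- s - 2) + int (Suc i)" by simp
      then show ?thesis using nz by (simp only: power_int_add power_int_of_nat simp_thms)
    qed
    ultimately show ?thesis using nz by (simp add: powi_minus_Suc divide_simps)
  qed
  ultimately have "((\<lambda>n. (if -1 - int n < 0 then - (of_int (-1 - int n) gchoose i) else 0) *
        (z1 powi (-(-1 - int n)-1) * z2 powi ((-1 - int n)-s-1))) has_sum
      z2 powi (int i - s - 1) * (z1 - z2) powi (- int i - 1)) UNIV"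
    by (simp only:)
  then show ?thesis
    by (subst (asm) has_sum_int_down) auto
qed

section \<open>Rational two-point functions\<close>

text \<open>
  The general homogeneous function of degree \<open>- s - 2\<close> with poles only along the axes and, of order
  at most \<open>N\<close>, along the diagonal: a Laurent polynomial with coefficients \<open>r\<close> on \<open>I\<close>, plus polar parts.
\<close>

definition rational2 ::
    "int \<Rightarrow> int set \<Rightarrow> (int \<Rightarrow> complex) \<Rightarrow> nat \<Rightarrow> (nat \<Rightarrow> complex) \<Rightarrow> complex \<times> complex \<Rightarrow> complex" where
  "rational2 s I r N c = (\<lambda>(z1, z2).
     (\<Sum>m\<in>I. r m * (z1 powi (-m-1) * z2 powi (m-s-1))) +
     (\<Sum>i<N. c i * (z2 powi (int i - s - 1) * (z1 - z2) powi (- int i - 1))))"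

lemma rational2_outer:
  fixes z1 z2 :: complex
  assumes "finite I" "\<And>m. m \<notin> I \<Longrightarrow> r m = 0"
    and "\<And>m. a m = r m + (if 0 \<le> m then (\<Sum>i<N. c i * (of_int m gchoose i)) else 0)"
    and "0 < norm z2" "norm z2 < norm z1"
  shows "((\<lambda>m. a m * (z1 powi (-m-1) * z2 powi (m-s-1))) has_sum rational2 s I r N c (z1, z2)) UNIV"
proof -
  let ?w = "\<lambda>m. z1 powi (-m-1) * z2 powi (m-s-1)"
  have "((\<lambda>m. r m * ?w m) has_sum (\<Sum>m\<in>I. r m * ?w m)) UNIV"
    using assms(1,2) by (intro has_sum_finite_neutralI[of I]) auto
  moreover have "((\<lambda>m. \<Sum>i<N. c i * ((if 0 \<le> m then of_int m gchoose i else 0) * ?w m)) has_sum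
      (\<Sum>i<N. c i * (z2 powi (int i - s - 1) * (z1 - z2) powi (- int i - 1)))) UNIV"
    by (intro has_sum_sum has_sum_cmult_right polar_part_outer assms) simp
  ultimately have "((\<lambda>m. r m * ?w m + (\<Sum>i<N. c i * ((if 0 \<le> m then of_int m gchoose i else 0) * ?w m)))
      has_sum rational2 s I r N c (z1, z2)) UNIV"
    unfolding rational2_def by (simp add: has_sum_add)
  moreover have "r m * ?w m + (\<Sum>i<N. c i * ((if 0 \<le> m then of_int m gchoose i else 0) * ?w m)) =
      a m * ?w m" for m
    by (simp add: assms(3) distrib_right sum_distrib_right mult.assoc)
  ultimately show ?thesis by simp
qed

lemma rational2_inner:
  fixes z1 z2 :: complex
  assumes "finite I" "\<And>m. m \<notin> I \<Longrightarrow> r m = 0"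
    and "\<And>m. b m = r m - (if m < 0 then (\<Sum>i<N. c i * (of_int m gchoose i)) else 0)"
    and "0 < norm z1" "norm z1 < norm z2"
  shows "((\<lambda>m. b m * (z1 powi (-m-1) * z2 powi (m-s-1))) has_sum rational2 s I r N c (z1, z2)) UNIV"
proof -
  let ?w = "\<lambda>m. z1 powi (-m-1) * z2 powi (m-s-1)"
  have "((\<lambda>m. r m * ?w m) has_sum (\<Sum>m\<in>I. r m * ?w m)) UNIV"
    using assms(1,2) by (intro has_sum_finite_neutralI[of I]) auto
  moreover have "((\<lambda>m. \<Sum>i<N. c i * ((if m < 0 then - (of_int m gchoose i) else 0) * ?w m)) has_sum
      (\<Sum>i<N. c i * (z2 powi (int i - s - 1) * (z1 - z2) powi (- int i - 1)))) UNIV"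
    by (intro has_sum_sum has_sum_cmult_right polar_part_inner assms) simp
  ultimately have "((\<lambda>m. r m * ?w m + (\<Sum>i<N. c i * ((if m < 0 then - (of_int m gchoose i) else 0) * ?w m)))
      has_sum rational2 s I r N c (z1, z2)) UNIV"
    unfolding rational2_def by (simp add: has_sum_add)
  moreover have "r m * ?w m + (\<Sum>i<N. c i * ((if m < 0 then - (of_int m gchoose i) else 0) * ?w m)) =
      b m * ?w m" for m
    by (simp add: assms(3) left_diff_distrib sum_distrib_right mult.assoc sum_negf)
  ultimately show ?thesis by simp
qed

section \<open>Holomorphic functions of two variables\<close>

lemma holomorphic2_const: "holomorphic2_on (\<lambda>_. c) S"
  unfolding holomorphic2_on_def by (intro ballI exI[of _ 0]) simp

lemma holomorphic2_fst: "holomorphic2_on fst S"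
  unfolding holomorphic2_on_def
  by (intro ballI exI[of _ 1] exI[of _ 0]) (auto intro!: derivative_eq_intros)

lemma holomorphic2_snd: "holomorphic2_on snd S"
  unfolding holomorphic2_on_def
  by (intro ballI exI[of _ 0] exI[of _ 1]) (auto intro!: derivative_eq_intros)

lemma holomorphic2_add:
  assumes "holomorphic2_on f S" "holomorphic2_on g S"
  shows "holomorphic2_on (\<lambda>p. f p + g p) S"
  unfolding holomorphic2_on_def
proof
  fix p assume "p \<in> S"
  then obtain a b a' b' where
    "(f has_derivative (\<lambda>h. a * fst h + b * snd h)) (at p within S)"
    "(g has_derivative (\<lambda>h. a' * fst h + b' * snd h)) (at p within S)"
    using assms unfolding holomorphic2_on_def by blast
  from has_derivative_add[OF this]
  have "((\<lambda>p. f p + g p) has_derivative (\<lambda>h. (a + a') * fst h + (b + b') * snd h)) (at p within S)"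
    by (simp add: algebra_simps)
  then show "\<exists>a b. ((\<lambda>p. f p + g p) has_derivative (\<lambda>h. a * fst h + b * snd h)) (at p within S)"
    by blast
qed

lemma holomorphic2_mult:
  assumes "holomorphic2_on f S" "holomorphic2_on g S"
  shows "holomorphic2_on (\<lambda>p. f p * g p) S"
  unfolding holomorphic2_on_def
proof
  fix p assume "p \<in> S"
  then obtain a b a' b' where
    "(f has_derivative (\<lambda>h. a * fst h + b * snd h)) (at p within S)"
    "(g has_derivative (\<lambda>h. a' * fst h + b' * snd h)) (at p within S)"
    using assms unfolding holomorphic2_on_def by blast
  from has_derivative_mult[OF this]
  have "((\<lambda>p. f p * g p) has_derivative
      (\<lambda>h. (f p * a' + a * g p) * fst h + (f p * b' + b * g p) * snd h)) (at p within S)"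
    by (simp add: algebra_simps)
  then show "\<exists>a b. ((\<lambda>p. f p * g p) has_derivative (\<lambda>h. a * fst h + b * snd h)) (at p within S)"
    by blast
qed

lemma holomorphic2_sum:
  assumes "\<And>i. i \<in> I \<Longrightarrow> holomorphic2_on (f i) S"
  shows "holomorphic2_on (\<lambda>p. \<Sum>i\<in>I. f i p) S"
  using assms
  by (induction I rule: infinite_finite_induct) (simp_all add: holomorphic2_const holomorphic2_add)

lemma holomorphic2_diff:
  assumes "holomorphic2_on f S" "holomorphic2_on g S"
  shows "holomorphic2_on (\<lambda>p. f p - g p) S"
  using holomorphic2_add[OF assms(1) holomorphic2_mult[OF holomorphic2_const[of "-1"] assms(2)]]
  by simp

lemma holomorphic2_powi:
  assumes "holomorphic2_on f S" "\<And>p. p \<in> S \<Longrightarrow> 0 \<le> k \<or> f p \<noteq> 0"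
  shows "holomorphic2_on (\<lambda>p. f p powi k) S"
  unfolding holomorphic2_on_def
proof
  fix p assume "p \<in> S"
  then obtain a b where f: "(f has_derivative (\<lambda>h. a * fst h + b * snd h)) (at p within S)"
    using assms unfolding holomorphic2_on_def by blast
  let ?D = "of_int k * f p powi (k - 1)"
  have "((\<lambda>w. w powi k) has_field_derivative ?D * 1) (at (f p))"
    using assms(2)[OF \<open>p \<in> S\<close>] by (intro DERIV_power_int) auto
  then have "((\<lambda>w. w powi k) has_derivative (*) ?D) (at (f p))"
    by (simp add: has_field_derivative_def)
  from has_derivative_compose[OF f this]
  have "((\<lambda>p. f p powi k) has_derivative (\<lambda>h. (?D * a) * fst h + (?D * b) * snd h)) (at p within S)"
    by (simp add: algebra_simps)
  then show "\<exists>a b. ((\<lambda>p. f p powi k) has_derivative (\<lambda>h. a * fst h + b * snd h)) (at p within S)"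
    by blast
qed

lemma holomorphic2_power:
  assumes "holomorphic2_on f S"
  shows "holomorphic2_on (\<lambda>p. f p ^ k) S"
  using holomorphic2_powi[OF assms, of "int k"] by simp

lemmas holomorphic2_intros = holomorphic2_const holomorphic2_fst holomorphic2_snd holomorphic2_add
  holomorphic2_diff holomorphic2_mult holomorphic2_sum holomorphic2_powi holomorphic2_power

lemma holomorphic2_imp_continuous:
  "holomorphic2_on f S \<Longrightarrow> continuous_on S f"
  unfolding holomorphic2_on_def continuous_on_eq_continuous_within
  using has_derivative_continuous by blast

text \<open>
  Fixing the second variable turns complex linearity of the derivative into complex
  differentiability.
\<close>

lemma holomorphic2_restrict_snd:
  assumes "holomorphic2_on f S" "T \<subseteq> {z. (z, b) \<in> S}"
  shows "(\<lambda>z. f (z, b)) holomorphic_on T"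
  unfolding holomorphic_on_def
proof
  fix z assume z: "z \<in> T"
  then obtain c d where f: "(f has_derivative (\<lambda>h. c * fst h + d * snd h)) (at (z, b) within S)"
    using assms unfolding holomorphic2_on_def by blast
  have "((\<lambda>z. (z, b)) has_derivative (\<lambda>h. (h, 0))) (at z within T)"
    by (auto intro!: derivative_eq_intros)
  moreover have "(\<lambda>z. (z, b)) ` T \<subseteq> S" using assms(2) by auto
  ultimately have "((\<lambda>z. f (z, b)) has_derivative (\<lambda>h. c * fst (h, 0 :: complex) + d * snd (h, 0 :: complex))) (at z within T)"
    by (intro has_derivative_in_compose[of "\<lambda>z. (z, b)" "\<lambda>h. (h, 0)" z T f] has_derivative_subset[OF f])
  then show "(\<lambda>z. f (z, b)) field_differentiable at z within T"
    unfolding field_differentiable_def has_field_derivative_def by (intro exI[of _ c]) simp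
qed

text \<open>
  The points with distinct norms are dense: a point with equal norms is the limit of the points that
  arise by stretching its first coordinate.
\<close>

lemma holomorphic2_Conf2_eqI:
  assumes "holomorphic2_on f Conf2" "holomorphic2_on g Conf2"
    and eq: "\<And>a b. (a, b) \<in> Conf2 \<Longrightarrow> norm a \<noteq> norm b \<Longrightarrow> f (a, b) = g (a, b)"
    and "(a, b) \<in> Conf2"
  shows "f (a, b) = g (a, b)"
proof (cases "norm a = norm b")
  case True
  have nz: "a \<noteq> 0" "b \<noteq> 0" using assms(4) by (auto simp: Conf2_def punctured_def)
  define x where "x = (\<lambda>n. (of_real (1 + 1 / real (Suc n)) * a, b))"
  have norm_x: "norm (fst (x n)) > norm b" for n
  proof -
    have "norm (fst (x n)) = (1 + 1 / real (Suc n)) * norm a"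
      unfolding x_def fst_conv norm_mult norm_of_real by simp
    then show ?thesis using nz True by (simp add: distrib_right)
  qed
  have x_in: "x n \<in> Conf2" for n
    using norm_x[of n] nz unfolding Conf2_def punctured_def x_def
    by (auto simp del: of_real_add of_real_divide)
  have "(\<lambda>n. 1 + 1 / real (Suc n)) \<longlonglongrightarrow> 1 + 0"
    using LIMSEQ_inverse_real_of_nat by (intro tendsto_add tendsto_const) (simp add: divide_inverse)
  then have "(\<lambda>n. of_real (1 + 1 / real (Suc n)) * a) \<longlonglongrightarrow> of_real (1 + 0) * a"
    by (intro tendsto_mult_right tendsto_of_real)
  then have x_lim: "x \<longlonglongrightarrow> (a, b)"
    unfolding x_def by (intro tendsto_Pair tendsto_const) simp
  have "(\<lambda>n. h (x n)) \<longlonglongrightarrow> h (a, b)" if "holomorphic2_on h Conf2" for h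
    using continuous_on_tendsto_compose[OF holomorphic2_imp_continuous[OF that] x_lim assms(4)] x_in
    by simp
  then have "(\<lambda>n. f (x n)) \<longlonglongrightarrow> f (a, b)" "(\<lambda>n. g (x n)) \<longlonglongrightarrow> g (a, b)"
    using assms(1,2) by blast+
  moreover have "f (x n) = g (x n)" for n
    using eq[of "fst (x n)" "snd (x n)"] x_in[of n] norm_x[of n] by (simp add: x_def)
  ultimately show ?thesis by (simp add: LIMSEQ_unique)
qed (use assms in auto)

lemma holomorphic2_rational2: "holomorphic2_on (rational2 s I r N c) Conf2"
  unfolding rational2_def case_prod_unfold
  by (intro holomorphic2_intros) (auto simp: Conf2_def punctured_def)

text \<open>
  The polar parts have order at most \<open>N\<close>, so that \<open>(z1 - z2) ^ N\<close> turns each of them into a polynomial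
  in \<open>z1 - z2\<close> times a power of \<open>z2\<close>.
\<close>

lemma rational2_pole_cleared:
  "\<exists>g. holomorphic2_on g (punctured \<times> punctured) \<and>
     (\<forall>(z1, z2)\<in>Conf2. g (z1, z2) = (z1 - z2) ^ N * rational2 s I r N c (z1, z2))"
proof (intro exI conjI)
  let ?g = "\<lambda>p. (fst p - snd p) ^ N * (\<Sum>m\<in>I. r m * (fst p powi (-m-1) * snd p powi (m-s-1))) +
     (\<Sum>i<N. c i * (snd p powi (int i - s - 1) * (fst p - snd p) ^ (N - Suc i)))"
  show "holomorphic2_on ?g (punctured \<times> punctured)"
    by (intro holomorphic2_intros) (auto simp: punctured_def)
  have "z ^ (N - Suc i) = z ^ N * z powi (- int i - 1)" if "z \<noteq> 0" "i < N" for z :: complex and i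
    using that by (simp add: powi_minus_Suc power_diff del: power_Suc)
  then show "\<forall>(z1, z2)\<in>Conf2. ?g (z1, z2) = (z1 - z2) ^ N * rational2 s I r N c (z1, z2)"
    by (auto simp: rational2_def distrib_left sum_distrib_left Conf2_def mult_ac intro!: sum.cong)
qed

section \<open>Local domination\<close>

text \<open>
  The Weierstrass criterion. It implies absolute and locally uniform convergence and, unlike the
  supremum in the definition of that notion, passes to finite sums without effort.
\<close>

definition locally_dominated :: "(nat \<Rightarrow> 'x::topological_space \<Rightarrow> complex) \<Rightarrow> 'x set \<Rightarrow> bool" where
  "locally_dominated f S \<longleftrightarrow> (\<forall>p\<in>S. \<exists>U g. open U \<and> p \<in> U \<and> summable g \<and>
     (\<forall>n. \<forall>x\<in>U \<inter> S. norm (f n x) \<le> g n))"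

lemma locally_dominatedE:
  assumes "locally_dominated f S" "p \<in> S"
  obtains U g where "open U" "p \<in> U" "summable g" "\<forall>n. \<forall>x\<in>U \<inter> S. norm (f n x) \<le> g n"
proof -
  from assms obtain U g where "open U \<and> p \<in> U \<and> summable g \<and> (\<forall>n. \<forall>x\<in>U \<inter> S. norm (f n x) \<le> g n)"
    unfolding locally_dominated_def by meson
  then show ?thesis by (intro that[of U g]) auto
qed

lemma locally_dominated_imp_alu:
  assumes "locally_dominated f S"
  shows "alu_convergent_on f S"
  unfolding alu_convergent_on_def
proof
  fix p assume "p \<in> S"
  from locally_dominatedE[OF assms this] obtain U g where U: "open U" "p \<in> U" and g: "summable g"
    and le': "\<forall>n. \<forall>x\<in>U \<inter> S. norm (f n x) \<le> g n" .
  have le: "norm (f n x) \<le> g n" if "x \<in> U \<inter> S" for n x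
    using le' that by simp
  have g0: "0 \<le> g n" for n
    by (rule order_trans[OF norm_ge_zero le]) (use U(2) \<open>p \<in> S\<close> in blast)
  have "(SUP x\<in>U \<inter> S. \<Sum>n. ennreal (norm (f n x))) \<le> (\<Sum>n. ennreal (g n))"
    by (intro SUP_least suminf_le ennreal_leI le) auto
  also have "\<dots> < \<infinity>"
    unfolding suminf_ennreal2[OF g0 g] by simp
  finally show "\<exists>U. open U \<and> p \<in> U \<and> (SUP x\<in>U \<inter> S. \<Sum>n. ennreal (norm (f n x))) < \<infinity>"
    using U by blast
qed

lemma alu_imp_summable:
  assumes "alu_convergent_on f S" "x \<in> S"
  shows "summable (\<lambda>n. norm (f n x))"
proof -
  obtain U where U: "x \<in> U" "(SUP x\<in>U \<inter> S. \<Sum>n. ennreal (norm (f n x))) < \<infinity>"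
    using assms unfolding alu_convergent_on_def by blast
  have "(\<Sum>n. ennreal (norm (f n x))) \<le> (SUP x\<in>U \<inter> S. \<Sum>n. ennreal (norm (f n x)))"
    using U assms(2) by (intro SUP_upper) auto
  from le_less_trans[OF this U(2)] show ?thesis
    by (intro summable_suminf_not_top) auto
qed

lemma locally_dominated_add:
  assumes "locally_dominated f S" "locally_dominated g S"
  shows "locally_dominated (\<lambda>n x. f n x + g n x) S"
  unfolding locally_dominated_def
proof
  fix p assume p: "p \<in> S"
  from locally_dominatedE[OF assms(1) p] obtain U u where U: "open U" "p \<in> U" "summable u"
    "\<forall>n. \<forall>x\<in>U \<inter> S. norm (f n x) \<le> u n" .
  from locally_dominatedE[OF assms(2) p] obtain W w where W: "open W" "p \<in> W" "summable w"
    "\<forall>n. \<forall>x\<in>W \<inter> S. norm (g n x) \<le> w n" .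
  show "\<exists>U g'. open U \<and> p \<in> U \<and> summable g' \<and> (\<forall>n. \<forall>x\<in>U \<inter> S. norm (f n x + g n x) \<le> g' n)"
  proof (intro exI conjI allI ballI)
    show "open (U \<inter> W)" "p \<in> U \<inter> W" "summable (\<lambda>n. u n + w n)"
      using U W by (auto intro: summable_add)
    fix n x assume "x \<in> (U \<inter> W) \<inter> S"
    then have "norm (f n x) \<le> u n" "norm (g n x) \<le> w n" using U W by auto
    then show "norm (f n x + g n x) \<le> u n + w n"
      using norm_triangle_ineq[of "f n x" "g n x"] by linarith
  qed
qed

lemma locally_dominated_sum:
  fixes f :: "'i \<Rightarrow> nat \<Rightarrow> 'x::topological_space \<Rightarrow> complex"
  assumes "finite I" "\<And>i. i \<in> I \<Longrightarrow> locally_dominated (f i) S"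
  shows "locally_dominated (\<lambda>n x. \<Sum>i\<in>I. f i n x) S"
  using assms
proof (induction I rule: finite_induct)
  case empty
  then show ?case unfolding locally_dominated_def
    by (intro ballI exI[of _ UNIV] exI[of _ "\<lambda>_. 0"]) auto
qed (simp add: locally_dominated_add)

lemma locally_dominated_powser:
  fixes h q :: "'x::topological_space \<Rightarrow> complex"
  assumes S: "open S" and h: "continuous_on S h" and q: "continuous_on S q"
    and q1: "\<And>x. x \<in> S \<Longrightarrow> norm (q x) < 1"
    and a: "\<And>t. norm t < 1 \<Longrightarrow> summable (\<lambda>n. a n * t ^ n)"
  shows "locally_dominated (\<lambda>n x. h x * (a n * q x ^ n)) S"
  unfolding locally_dominated_def
proof
  fix p assume p: "p \<in> S"
  obtain r where r: "norm (q p) < r" "r < 1" using q1[OF p] dense by blast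
  then have r0: "0 < r" using norm_ge_zero[of "q p"] by linarith
  obtain r' where r': "r < r'" "r' < 1" using r(2) dense by blast
  have sm: "summable (\<lambda>n. norm (a n * of_real r ^ n))"
    using r0 r' by (intro powser_insidea[of a "of_real r'"] a) auto
  define U where "U = S \<inter> (\<lambda>x. norm (h x)) -` {..<norm (h p) + 1} \<inter> (S \<inter> (\<lambda>x. norm (q x)) -` {..<r})"
  have "open (S \<inter> (\<lambda>x. norm (h x)) -` {..<norm (h p) + 1})"
    using S h by (intro continuous_open_preimage continuous_on_norm) auto
  moreover have "open (S \<inter> (\<lambda>x. norm (q x)) -` {..<r})"
    using S q by (intro continuous_open_preimage continuous_on_norm) auto
  ultimately have "open U" unfolding U_def by blast
  moreover have "p \<in> U" using p r by (auto simp: U_def)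
  moreover have "norm (h x * (a n * q x ^ n)) \<le> (norm (h p) + 1) * norm (a n * of_real r ^ n)"
    if "x \<in> U \<inter> S" for n x
  proof -
    have "norm (h x) \<le> norm (h p) + 1" "norm (q x) \<le> r" using that by (auto simp: U_def)
    then show ?thesis unfolding norm_mult norm_power
      using r0 by (intro mult_mono power_mono) auto
  qed
  ultimately show "\<exists>U g. open U \<and> p \<in> U \<and> summable g \<and>
      (\<forall>n. \<forall>x\<in>U \<inter> S. norm (h x * (a n * q x ^ n)) \<le> g n)"
    using summable_mult[OF sm] by blast
qed

section \<open>Residues\<close>

lemma higher_deriv_powi:
  fixes z :: complex
  assumes "z \<noteq> 0"
  shows "(deriv ^^ p) (\<lambda>w. w powi k) z = fact p * (of_int k gchoose p) * z powi (k - int p)"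
  using assms
proof (induction p arbitrary: z)
  case (Suc p)
  let ?c = "fact p * (of_int k gchoose p) :: complex"
  have "(deriv ^^ Suc p) (\<lambda>w. w powi k) z = deriv ((deriv ^^ p) (\<lambda>w. w powi k)) z" by simp
  also have "\<dots> = deriv (\<lambda>w. ?c * w powi (k - int p)) z"
  proof (rule deriv_cong_ev)
    have "eventually (\<lambda>w. w \<in> - {0}) (nhds z)"
      using Suc.prems by (intro eventually_nhds_in_open) auto
    then show "\<forall>\<^sub>F w in nhds z. (deriv ^^ p) (\<lambda>w. w powi k) w = ?c * w powi (k - int p)"
      by eventually_elim (use Suc.IH in auto)
  qed simp
  also have "\<dots> = ?c * (of_int (k - int p) * z powi (k - int p - 1))"
    using Suc.prems by (intro DERIV_imp_deriv) (auto intro!: derivative_eq_intros)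
  also have "\<dots> = fact (Suc p) * (of_int k gchoose Suc p) * z powi (k - int (Suc p))"
    unfolding gbinomial_mult_fact by (simp add: prod.atLeast0_lessThan_Suc algebra_simps)
  finally show ?case .
qed simp

lemma circle_integral_powi:
  fixes z :: complex
  assumes "0 < r" "r < norm z"
  shows "((\<lambda>w. (w - z) powi n * w powi k) has_contour_integral
      2 * of_real pi * \<i> * (if 0 \<le> n then 0 else (of_int k gchoose nat (- n - 1)) * z powi (k + n + 1)))
      (circlepath z r)"
proof -
  have nz: "w \<noteq> 0" if "w \<in> ball z (norm z)" for w using that by auto
  have sub: "cball z r \<subseteq> ball z (norm z)" using assms by auto
  show ?thesis
  proof (cases "0 \<le> n")
    case True
    have "(\<lambda>w. (w - z) powi n * w powi k) holomorphic_on ball z (norm z)"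
      using True nz by (intro holomorphic_intros) auto
    then have "((\<lambda>w. (w - z) powi n * w powi k) has_contour_integral 0) (circlepath z r)"
      using sub assms by (intro Cauchy_theorem_convex_simple[of _ "ball z (norm z)"]) auto
    then show ?thesis using True by simp
  next
    case False
    define p where "p = nat (- n - 1)"
    have n: "n = - int p - 1" using False by (simp add: p_def)
    have hol: "(\<lambda>w. w powi k) holomorphic_on ball z (norm z)"
      using nz by (intro holomorphic_intros) auto
    have "((\<lambda>u. u powi k / (u - z) ^ Suc p) has_contour_integral
        (2 * pi * \<i>) / fact p * (deriv ^^ p) (\<lambda>w. w powi k) z) (circlepath z r)"
      using sub assms
      by (intro Cauchy_has_contour_integral_higher_derivative_circlepath
          holomorphic_on_imp_continuous_on holomorphic_on_subset[OF hol]) auto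
    moreover have "(\<lambda>u. u powi k / (u - z) ^ Suc p) = (\<lambda>u. (u - z) powi n * u powi k)"
      by (simp add: fun_eq_iff n powi_minus_Suc)
    moreover have "(deriv ^^ p) (\<lambda>w. w powi k) z = fact p * (of_int k gchoose p) * z powi (k + n + 1)"
      using assms by (subst higher_deriv_powi) (auto simp: n)
    ultimately have "((\<lambda>u. (u - z) powi n * u powi k) has_contour_integral
        (2 * pi * \<i>) / fact p * (fact p * (of_int k gchoose p) * z powi (k + n + 1))) (circlepath z r)"
      by (simp only:)
    then show ?thesis using False by (simp add: p_def[symmetric] mult.assoc)
  qed
qed

text \<open>
  If \<open>n \<ge> 0\<close>, the Laurent polynomial contributes nothing and the factor \<open>(w - z) powi n\<close> selects the
  pole of order \<open>n + 1\<close>. If \<open>n < 0\<close>, Cauchy's formula gives a derivative of the Laurent polynomial,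
  and the polar parts contribute nothing, as all their terms have order at least two.
\<close>

lemma circle_integral_rational2:
  fixes z :: complex
  assumes "0 < \<rho>" "\<rho> < norm z"
  shows "((\<lambda>w. (w - z) powi n * rational2 s I r N c (w, z)) has_contour_integral
      2 * of_real pi * \<i> * (z powi (n - s - 1) *
      (if 0 \<le> n then (if nat n < N then c (nat n) else 0)
       else (\<Sum>m\<in>I. r m * (of_int (-m-1) gchoose nat (- n - 1))))))
      (circlepath z \<rho>)"
proof -
  have z: "z \<noteq> 0" using assms by auto
  let ?I = "\<lambda>n k. 2 * of_real pi * \<i> * (if 0 \<le> n then 0 else (of_int k gchoose nat (- n - 1)) * z powi (k + n + 1))"
  let ?R = "(\<Sum>m\<in>I. (r m * z powi (m-s-1)) * ?I n (-m-1)) +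
     (\<Sum>i<N. (c i * z powi (int i - s - 1)) * ?I (n - int i - 1) 0)"
  have sum_I: "((\<lambda>w. \<Sum>m\<in>I. (r m * z powi (m-s-1)) * ((w - z) powi n * w powi (-m-1))) has_contour_integral
     (\<Sum>m\<in>I. (r m * z powi (m-s-1)) * ?I n (-m-1))) (circlepath z \<rho>)"
  proof (cases "finite I")
    case True
    then show ?thesis
      by (intro has_contour_integral_sum has_contour_integral_lmul circle_integral_powi[OF assms])
  qed (simp add: has_contour_integral_0)
  have "((\<lambda>w. (\<Sum>m\<in>I. (r m * z powi (m-s-1)) * ((w - z) powi n * w powi (-m-1))) +
     (\<Sum>i<N. (c i * z powi (int i - s - 1)) * ((w - z) powi (n - int i - 1) * w powi 0)))
     has_contour_integral ?R) (circlepath z \<rho>)"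
    by (intro has_contour_integral_add sum_I has_contour_integral_sum has_contour_integral_lmul
        circle_integral_powi[OF assms]) auto
  then have "((\<lambda>w. (w - z) powi n * rational2 s I r N c (w, z)) has_contour_integral ?R) (circlepath z \<rho>)"
  proof (rule has_contour_integral_eq)
    fix w assume "w \<in> path_image (circlepath z \<rho>)"
    then have wz: "w - z \<noteq> 0" using assms(1) by (auto simp: path_image_circlepath_nonneg)
    have "(w - z) powi (n - int i - 1) = (w - z) powi n * (w - z) powi (- int i - 1)" for i
      using wz power_int_add[of "w - z" n "- int i - 1"] by (simp add: algebra_simps)
    then show "(\<Sum>m\<in>I. (r m * z powi (m-s-1)) * ((w - z) powi n * w powi (-m-1))) +
       (\<Sum>i<N. (c i * z powi (int i - s - 1)) * ((w - z) powi (n - int i - 1) * w powi 0)) =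
       (w - z) powi n * rational2 s I r N c (w, z)"
      by (simp add: rational2_def distrib_left sum_distrib_left mult_ac)
  qed
  moreover have "?R = 2 * of_real pi * \<i> * (z powi (n - s - 1) *
      (if 0 \<le> n then (if nat n < N then c (nat n) else 0)
       else (\<Sum>m\<in>I. r m * (of_int (-m-1) gchoose nat (- n - 1)))))"
  proof -
    have "(r m * z powi (m-s-1)) * ?I n (-m-1) = 2 * of_real pi * \<i> * (z powi (n - s - 1) *
       (if 0 \<le> n then 0 else r m * (of_int (-m-1) gchoose nat (- n - 1))))" for m
      using z power_int_add[of z "m-s-1" "n-m"] by (simp add: algebra_simps)
    then have "(\<Sum>m\<in>I. (r m * z powi (m-s-1)) * ?I n (-m-1)) =
       (\<Sum>m\<in>I. 2 * of_real pi * \<i> * (z powi (n - s - 1) *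
         (if 0 \<le> n then 0 else r m * (of_int (-m-1) gchoose nat (- n - 1)))))"
      by (simp only:)
    then have 1: "(\<Sum>m\<in>I. (r m * z powi (m-s-1)) * ?I n (-m-1)) = 2 * of_real pi * \<i> * (z powi (n - s - 1) *
       (if 0 \<le> n then 0 else (\<Sum>m\<in>I. r m * (of_int (-m-1) gchoose nat (- n - 1)))))"
      by (cases "0 \<le> n") (simp_all only: if_True if_False sum_distrib_left mult_zero_right sum.neutral_const)
    have "(c i * z powi (int i - s - 1)) * ?I (n - int i - 1) 0 = 2 * of_real pi * \<i> *
       (if int i = n then z powi (n - s - 1) * c i else 0)" for i
    proof (cases "int i = n")
      case False
      then have "\<not> 0 \<le> n - int i - 1 \<Longrightarrow> (0 gchoose nat (- (n - int i - 1) - 1) :: complex) = 0"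
        by (cases "nat (- (n - int i - 1) - 1)") auto
      then show ?thesis using False by simp
    qed simp
    then have "(\<Sum>i<N. (c i * z powi (int i - s - 1)) * ?I (n - int i - 1) 0) =
       2 * of_real pi * \<i> * (\<Sum>i<N. if int i = n then z powi (n - s - 1) * c i else 0)"
      by (simp only: sum_distrib_left)
    also have "(\<Sum>i<N. if int i = n then z powi (n - s - 1) * c i else 0) =
       z powi (n - s - 1) * (if 0 \<le> n \<and> nat n < N then c (nat n) else 0)"
    proof (cases "0 \<le> n")
      case True
      then have "int i = n \<longleftrightarrow> nat n = i" for i by auto
      then show ?thesis using True by (simp add: sum.delta')
    qed auto
    finally have 2: "(\<Sum>i<N. (c i * z powi (int i - s - 1)) * ?I (n - int i - 1) 0) =
       2 * of_real pi * \<i> * (z powi (n - s - 1) * (if 0 \<le> n \<and> nat n < N then c (nat n) else 0))" .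
    show ?thesis unfolding 1 2 by (simp add: distrib_left[symmetric])
  qed
  ultimately show ?thesis by simp
qed

text \<open>
  For \<open>n < 0\<close> this splits the derivative in Cauchy's formula into the two sums that occur in the modes
  of the \<open>n\<close>-th product: the terms with \<open>m \<le> n\<close> form the first one, those with \<open>m \<ge> 0\<close> the second
  one, and for \<open>n < m < 0\<close> the \<open>(- n - 1)\<close>-st derivative of the polynomial \<open>z powi (- m - 1)\<close> is zero.
\<close>

lemma sum_powi_residues:
  fixes r :: "int \<Rightarrow> complex"
  assumes "finite I" "\<And>m. m \<notin> I \<Longrightarrow> r m = 0" "n < 0" and J: "I \<subseteq> {n - int J<..<int J}"
  shows "(\<Sum>m\<in>I. r m * (of_int (-m-1) gchoose nat (- n - 1))) =
    (\<Sum>j<J. (-1) ^ j * (of_int n gchoose j) * r (n - int j)) -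
    (-1) powi n * (\<Sum>j<J. (-1) ^ j * (of_int n gchoose j) * r (int j))"
proof -
  define p where "p = nat (- n - 1)"
  have n: "n = - int p - 1" using assms(3) by (simp add: p_def)
  let ?g = "\<lambda>m. r m * (of_int (-m-1) gchoose p)"
  have binom: "(-1) ^ j * (of_int n gchoose j) = (of_nat (p + j) gchoose p :: complex)" for j
  proof -
    have "(of_int n gchoose j :: complex) = (-1) ^ j * (of_nat (p + j) gchoose j)"
      by (subst gbinomial_negated_upper) (simp add: n add.commute)
    also have "(of_nat (p + j) gchoose j :: complex) = (of_nat (p + j) gchoose p)"
      using binomial_symmetric[of p "p + j"] by (simp flip: binomial_gbinomial del: of_nat_add)
    finally show ?thesis by simp
  qed
  have sign: "(-1) powi n = (- ((-1) ^ p) :: complex)"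
    by (simp add: n powi_minus_Suc minus_one_power_iff)
  have "(\<Sum>m\<in>I. ?g m) = (\<Sum>m\<in>{n - int J<..<int J}. ?g m)"
    using assms(2) J by (intro sum.mono_neutral_left) auto
  also have "{n - int J<..<int J} = {n - int J<..n} \<union> ({n<..<0} \<union> {0..<int J})"
    using n by auto
  also have "(\<Sum>m\<in>\<dots>. ?g m) = (\<Sum>m\<in>{n - int J<..n}. ?g m) + ((\<Sum>m\<in>{n<..<0}. ?g m) + (\<Sum>m\<in>{0..<int J}. ?g m))"
    using n by (subst sum.union_disjoint; (subst sum.union_disjoint)?) auto
  also have "(\<Sum>m\<in>{n<..<0}. ?g m) = 0"
  proof (rule sum.neutral, rule ballI)
    fix m assume m: "m \<in> {n<..<0}"
    define k where "k = nat (- m - 1)"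
    have "k < p" "-m-1 = int k" using m by (auto simp: k_def n)
    then show "?g m = 0" by (simp add: binomial_eq_0 flip: binomial_gbinomial)
  qed
  also have "(\<Sum>m\<in>{n - int J<..n}. ?g m) = (\<Sum>j<J. (-1) ^ j * (of_int n gchoose j) * r (n - int j))"
  proof (rule sum.reindex_bij_witness[of _ "\<lambda>j. n - int j" "\<lambda>m. nat (n - m)"])
    fix m assume m: "m \<in> {n - int J<..n}"
    then have "- m - 1 = int (p + nat (n - m))" by (simp add: n)
    then have "(of_int (- m - 1) gchoose p :: complex) = (of_nat (p + nat (n - m)) gchoose p)"
      by (simp only: of_int_of_nat_eq)
    then show "(-1) ^ nat (n - m) * (of_int n gchoose nat (n - m)) * r (n - int (nat (n - m))) = ?g m"
      using m by (simp add: binom)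
  qed auto
  also have "(\<Sum>m\<in>{0..<int J}. ?g m) = - ((-1) powi n * (\<Sum>j<J. (-1) ^ j * (of_int n gchoose j) * r (int j)))"
  proof -
    have "(\<Sum>m\<in>{0..<int J}. ?g m) = (\<Sum>j<J. (-1) ^ p * ((-1) ^ j * (of_int n gchoose j) * r (int j)))"
    proof (rule sum.reindex_bij_witness[of _ int nat])
      fix m assume m: "m \<in> {0..<int J}"
      have "(of_int (- m - 1) gchoose p :: complex) = (-1) ^ p * (of_nat (p + nat m) gchoose p)"
        using m by (subst gbinomial_negated_upper) simp
      then show "(-1) ^ p * ((-1) ^ nat m * (of_int n gchoose nat m) * r (int (nat m))) = ?g m"
        using m by (simp add: binom)
    qed auto
    then show ?thesis by (simp add: sign sum_distrib_left sum_negf)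
  qed
  finally show ?thesis unfolding p_def by simp
qed

section \<open>Laurent expansions on the two sides of the unit circle\<close>

lemma has_sum_minus:
  fixes f g :: "'a \<Rightarrow> complex"
  assumes "(f has_sum a) A" "(g has_sum b) A"
  shows "((\<lambda>x. f x - g x) has_sum (a - b)) A"
  using has_sum_add[OF assms(1), of "\<lambda>x. - g x" "- b"] assms(2) by (simp add: has_sum_uminus)

lemma has_sum_times_minus_1:
  fixes x :: "int \<Rightarrow> complex" and z :: complex
  assumes "((\<lambda>m. x m * z powi (-m-1)) has_sum S) UNIV" "z \<noteq> 0"
  shows "((\<lambda>m. fdiff x m * z powi (-m-1)) has_sum (z - 1) * S) UNIV"
proof -
  have "((\<lambda>m. z * (x m * z powi (-m-1))) has_sum z * S) UNIV"
    by (rule has_sum_cmult_right[OF assms(1)])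
  also have "(\<lambda>m. z * (x m * z powi (-m-1))) = (\<lambda>m. x m * z powi (-m))"
    using assms(2) by (simp add: power_int_diff fun_eq_iff)
  finally have "((\<lambda>m. x (m + 1) * z powi (-(m+1))) has_sum z * S) UNIV"
    by (subst has_sum_reindex_bij_witness[of _ "\<lambda>m. m - 1" "\<lambda>m. m + 1"]) auto
  then have "((\<lambda>m. x (m + 1) * z powi (-m-1)) has_sum z * S) UNIV" by simp
  from has_sum_minus[OF this assms(1)] show ?thesis
    by (simp add: fdiff_def algebra_simps)
qed

lemma has_sum_times_minus_1_power:
  fixes x :: "int \<Rightarrow> complex" and z :: complex
  assumes "((\<lambda>m. x m * z powi (-m-1)) has_sum S) UNIV" "z \<noteq> 0"
  shows "((\<lambda>m. (fdiff ^^ N) x m * z powi (-m-1)) has_sum (z - 1) ^ N * S) UNIV"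
proof (induction N)
  case (Suc N)
  from has_sum_times_minus_1[OF Suc assms(2)] show ?case by (simp add: mult.assoc)
qed (use assms in simp)

lemma powser_eq_0_imp_coeff_0:
  fixes a :: "nat \<Rightarrow> complex"
  assumes "\<And>t. norm t < 1 \<Longrightarrow> (\<lambda>n. a n * t ^ n) sums 0"
  shows "a n = 0"
proof (cases "n = 0")
  case True
  have "(\<lambda>n. a n * 0 ^ n) sums 0" using assms[of 0] by simp
  then show ?thesis using True by simp
next
  case False
  show ?thesis
  proof (rule ccontr)
    assume "a n \<noteq> 0"
    obtain s where "0 < s" "\<And>z :: complex. z \<in> cball 0 s - {0} \<Longrightarrow> (0 :: complex) \<noteq> 0"
      by (rule powser_0_nonzero[of 1 0 a "\<lambda>_. 0" n]) (use assms False \<open>a n \<noteq> 0\<close> in auto)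
    moreover from this have "of_real s \<in> cball (0 :: complex) s - {0}" by simp
    ultimately show False by blast
  qed
qed

text \<open>
  Subtract from \<open>g\<close> the finite Laurent polynomial \<open>R\<close> that consists of the principal part of the inner
  expansion and the polynomial part of the outer one. What remains is holomorphic at \<open>0\<close> and tends to
  \<open>0\<close> at infinity, hence vanishes by Liouville's theorem, and the coefficients on both sides are
  those of \<open>R\<close>.
\<close>

lemma laurent_coeffs_eq:
  fixes a b :: "int \<Rightarrow> complex" and g :: "complex \<Rightarrow> complex"
  assumes a0: "\<And>m. m < M0 \<Longrightarrow> a m = 0" and b0: "\<And>m. M1 < m \<Longrightarrow> b m = 0"
    and g: "g holomorphic_on - {0}"
    and outer: "\<And>z. 1 < norm z \<Longrightarrow> ((\<lambda>m. a m * z powi (-m-1)) has_sum g z) UNIV"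
    and inner: "\<And>z. z \<noteq> 0 \<Longrightarrow> norm z < 1 \<Longrightarrow> ((\<lambda>m. b m * z powi (-m-1)) has_sum g z) UNIV"
  shows "a = b"
proof -
  define r where "r = (\<lambda>m. if 0 \<le> m then b m else a m)"
  define I where "I = {min M0 0..max M1 0}"
  have r0: "r m = 0" if "m \<notin> I" for m
    using that a0 b0 by (auto simp: r_def I_def)
  define R where "R = (\<lambda>z. \<Sum>m\<in>I. r m * z powi (-m-1))"
  have R: "((\<lambda>m. r m * z powi (-m-1)) has_sum R z) UNIV" for z
    unfolding R_def by (rule has_sum_finite_neutralI[of I]) (auto simp: r0 I_def)
  define p where "p = (\<lambda>n. b (- 1 - int n) - a (- 1 - int n))"
  \<comment> \<open>A vanishing constant term makes the series in \<open>1 / z\<close> tend to \<open>0\<close> at infinity.\<close>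
  define q where "q = (\<lambda>n. case n of 0 \<Rightarrow> 0 | Suc n \<Rightarrow> a (int n) - b (int n))"
  have inner': "(\<lambda>n. p n * z ^ n) sums (g z - R z)" if "z \<noteq> 0" "norm z < 1" for z
  proof -
    have "((\<lambda>m. (b m - r m) * z powi (-m-1)) has_sum (g z - R z)) UNIV"
      using has_sum_minus[OF inner[OF that] R[of z]] by (simp add: algebra_simps)
    then have "((\<lambda>n. (b (-1 - int n) - r (-1 - int n)) * z powi (-(-1 - int n)-1)) has_sum (g z - R z)) UNIV"
      by (subst has_sum_int_down) (auto simp: r_def)
    then show ?thesis by (intro has_sum_imp_sums) (simp add: r_def p_def)
  qed
  have outer': "(\<lambda>n. q n * (1 / z) ^ n) sums (g z - R z)" if "1 < norm z" for z
  proof -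
    have "((\<lambda>m. (a m - r m) * z powi (-m-1)) has_sum (g z - R z)) UNIV"
      using has_sum_minus[OF outer[OF that] R[of z]] by (simp add: algebra_simps)
    then have "((\<lambda>n. (a (-1 + int n) - r (-1 + int n)) * z powi (-(-1 + int n)-1)) has_sum (g z - R z)) UNIV"
      by (subst has_sum_int_up) (auto simp: r_def)
    moreover have "(a (-1 + int n) - r (-1 + int n)) * z powi (-(-1 + int n)-1) = q n * (1 / z) ^ n" for n
      by (cases n) (auto simp: r_def q_def powi_minus_Suc power_one_over)
    ultimately show ?thesis by (intro has_sum_imp_sums) simp
  qed
  define P where "P = (\<lambda>z. \<Sum>n. p n * z ^ n)"
  define Q where "Q = (\<lambda>z. \<Sum>n. q n * z ^ n)"
  have P: "(\<lambda>n. p n * z ^ n) sums P z" if "norm z < 1" for z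
    using inner'[of z] that sums_summable summable_sums powser_sums_zero[of p]
    unfolding P_def by (cases "z = 0") blast+
  have Q: "(\<lambda>n. q n * z ^ n) sums Q z" if "norm z < 1" for z
  proof (cases "z = 0")
    case True
    then show ?thesis
      using sums_summable[OF powser_sums_zero[of q]] summable_sums unfolding Q_def by blast
  next
    case False
    then have "1 < norm (1 / z)" using that by (simp add: norm_divide)
    from outer'[OF this] show ?thesis
      using sums_summable summable_sums unfolding Q_def by fastforce
  qed
  define H where "H = (\<lambda>z. if norm z < 1 then P z else g z - R z)"
  have H1: "H z = P z" if "z \<in> ball 0 1" for z using that by (simp add: H_def)
  have H2: "H z = g z - R z" if "z \<in> - {0}" for z
    using that sums_unique2[OF P[of z] inner'[of z]] by (auto simp: H_def)
  have "P holomorphic_on ball 0 1"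
    using P by (intro power_series_holomorphic[of _ _ p]) auto
  then have "H holomorphic_on ball 0 1" by (rule holomorphic_transform) (simp add: H1)
  moreover have "(\<lambda>z. g z - R z) holomorphic_on - {0}"
    unfolding R_def by (intro holomorphic_intros g) auto
  then have "H holomorphic_on - {0}" by (rule holomorphic_transform) (simp add: H2)
  ultimately have "H holomorphic_on ball 0 1 \<union> - {0}"
    by (intro holomorphic_on_Un) auto
  moreover have "ball 0 1 \<union> - {0} = (UNIV :: complex set)" by auto
  ultimately have holH: "H holomorphic_on UNIV" by simp
  have HQ: "H z = Q (1 / z)" if "1 < norm z" for z
  proof -
    have "norm (1 / z) < 1" using that by (auto simp: norm_divide divide_simps)
    then have "Q (1 / z) = g z - R z" using sums_unique2[OF Q outer'[OF that]] by blast
    moreover have "z \<noteq> 0" using that by auto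
    ultimately show ?thesis using H2[of z] by simp
  qed
  have "Q 0 = 0" using sums_unique2[OF Q[of 0] powser_sums_zero[of q]] by (simp add: q_def)
  moreover have "isCont Q 0"
  proof -
    have "Q holomorphic_on ball 0 1"
      using Q by (intro power_series_holomorphic[of _ _ q]) auto
    then show ?thesis
      using holomorphic_on_imp_continuous_on continuous_on_interior[of "ball 0 1" Q 0] by auto
  qed
  moreover have "((\<lambda>z :: complex. 1 / z) \<longlongrightarrow> 0) at_infinity"
    using tendsto_inverse_0[where 'a = complex] by (simp add: divide_inverse)
  ultimately have "((\<lambda>z. Q (1 / z)) \<longlongrightarrow> 0) at_infinity"
    using isCont_tendsto_compose[of 0 Q "\<lambda>z. 1 / z" at_infinity] by simp
  moreover have "eventually (\<lambda>z. Q (1 / z) = H z) at_infinity"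
    unfolding eventually_at_infinity using HQ by (intro exI[of _ 2]) auto
  ultimately have "(H \<longlongrightarrow> 0) at_infinity" by (rule Lim_transform_eventually)
  then have H0: "H z = 0" for z by (rule Liouville_weak_0[OF holH])
  have "p n = 0" for n
    using P H0 H1 by (intro powser_eq_0_imp_coeff_0) auto
  moreover have "q n = 0" for n
  proof (rule powser_eq_0_imp_coeff_0)
    fix t :: complex assume t: "norm t < 1"
    have "Q t = 0"
    proof (cases "t = 0")
      case False
      then have "1 < norm (1 / t)" using t by (simp add: norm_divide)
      from HQ[OF this] H0 show ?thesis by simp
    qed (use \<open>Q 0 = 0\<close> in simp)
    then show "(\<lambda>n. q n * t ^ n) sums 0" using Q[OF t] by simp
  qed
  ultimately have pq: "p n = 0" "q n = 0" for n by blast+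
  show "a = b"
  proof
    fix m show "a m = b m"
    proof (cases "0 \<le> m")
      case True
      then show ?thesis using pq(2)[of "Suc (nat m)"] by (simp add: q_def)
    next
      case False
      then show ?thesis using pq(1)[of "nat (-1 - m)"] by (simp add: p_def)
    qed
  qed
qed

section \<open>Graded spaces and their graded duals\<close>

lemma linear_simps:
  assumes "Vector_Spaces.linear s1 s2 f"
  shows "f (x + y) = f x + f y" "f (x - y) = f x - f y" "f 0 = 0" "f (s1 c x) = s2 c (f x)"
    "f (\<Sum>i\<in>I. g i) = (\<Sum>i\<in>I. f (g i))"
proof -
  interpret Vector_Spaces.linear s1 s2 f by fact
  show "f (x + y) = f x + f y" "f (x - y) = f x - f y" "f 0 = 0" "f (s1 c x) = s2 c (f x)"
    "f (\<Sum>i\<in>I. g i) = (\<Sum>i\<in>I. f (g i))"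
    by (simp_all add: add diff scale zero sum)
qed

lemma linear_sdiff:
  assumes "Vector_Spaces.linear s1 s2 f"
  shows "f ((sdiff ^^ N) X m k) = (sdiff ^^ N) (\<lambda>m k. f (X m k)) m k"
  by (induction N arbitrary: m k) (simp_all add: sdiff_def linear_simps[OF assms])

context graded_space
begin

lemma proj_props:
  "proj n v \<in> V n" "finite {n. proj n v \<noteq> 0}" "v = (\<Sum>n | proj n v \<noteq> 0. proj n v)"
proof -
  let ?P = "\<lambda>c. (\<forall>m. c m \<in> V m) \<and> finite {m. c m \<noteq> 0} \<and> v = (\<Sum>m | c m \<noteq> 0. c m)"
  have "?P (THE c. ?P c)" by (rule theI'[of ?P, OF direct_sum])
  then have "?P (\<lambda>n. proj n v)" unfolding proj_def by simp
  then show "proj n v \<in> V n" "finite {n. proj n v \<noteq> 0}" "v = (\<Sum>n | proj n v \<noteq> 0. proj n v)"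
    by blast+
qed

lemma proj_eqI:
  assumes "finite I" "\<And>i. c i \<in> V i" "\<And>i. i \<notin> I \<Longrightarrow> c i = 0" "v = (\<Sum>i\<in>I. c i)"
  shows "proj n v = c n"
proof -
  have sub: "{n. c n \<noteq> 0} \<subseteq> I" using assms(3) by blast
  then have "v = (\<Sum>m | c m \<noteq> 0. c m)"
    unfolding assms(4) using assms(1) by (intro sum.mono_neutral_right) auto
  then have "(\<forall>m. c m \<in> V m) \<and> finite {m. c m \<noteq> 0} \<and> v = (\<Sum>m | c m \<noteq> 0. c m)"
    using assms(2) finite_subset[OF sub assms(1)] by blast
  then have "(THE c. (\<forall>m. c m \<in> V m) \<and> finite {m. c m \<noteq> 0} \<and> v = (\<Sum>m | c m \<noteq> 0. c m)) = c"
    by (rule the1_equality[OF direct_sum])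
  then show ?thesis unfolding proj_def by (rule fun_cong)
qed

lemma sum_proj:
  assumes "finite I" "{n. proj n v \<noteq> 0} \<subseteq> I"
  shows "(\<Sum>i\<in>I. proj i v) = v"
  by (subst (2) proj_props(3)) (use assms in \<open>intro sum.mono_neutral_right; auto\<close>)

lemma proj_add: "proj n (x + y) = proj n x + proj n y"
proof (rule proj_eqI[where I = "{n. proj n x \<noteq> 0} \<union> {n. proj n y \<noteq> 0}"])
  show "x + y = (\<Sum>i\<in>{n. proj n x \<noteq> 0} \<union> {n. proj n y \<noteq> 0}. proj i x + proj i y)"
    by (simp add: sum.distrib sum_proj proj_props(2))
qed (auto simp: proj_props subspace_add[OF subspace_V])

lemma proj_scale: "proj n (scale a x) = scale a (proj n x)"
proof (rule proj_eqI[where I = "{n. proj n x \<noteq> 0}"])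
  show "scale a x = (\<Sum>i\<in>{n. proj n x \<noteq> 0}. scale a (proj i x))"
    by (simp add: sum_proj proj_props(2) flip: scale_sum_right)
qed (auto simp: proj_props subspace_scale[OF subspace_V])

lemma linear_proj: "Vector_Spaces.linear scale scale (proj n)"
  by (simp add: Vector_Spaces.linear_iff proj_add proj_scale vector_space_axioms)

lemma proj_mem: "v \<in> V n \<Longrightarrow> proj m v = (if m = n then v else 0)"
  by (rule proj_eqI[where I = "{n}"]) (auto simp: subspace_0[OF subspace_V])

lemma proj_L0: "proj n (L0 x) = scale (of_nat n) (proj n x)"
proof (rule proj_eqI[where I = "{n. proj n x \<noteq> 0}"])
  have "L0 x = L0 (\<Sum>n | proj n x \<noteq> 0. proj n x)"
    using proj_props(3)[of x] by simp
  then show "L0 x = (\<Sum>i\<in>{n. proj n x \<noteq> 0}. scale (of_nat i) (proj i x))"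
    by (simp add: linear_simps[OF linear_L0] L0_eigen[OF proj_props(1)])
qed (auto simp: proj_props subspace_scale[OF subspace_V])

text \<open>
  A linear map is determined by its values on homogeneous vectors. This is how statements
  about all vectors are reduced to homogeneous ones.
\<close>

lemma linear_eq_0I:
  assumes "Vector_Spaces.linear scale s f" "\<And>d x. x \<in> V d \<Longrightarrow> f x = 0"
  shows "f v = 0"
proof -
  have "f v = f (\<Sum>n | proj n v \<noteq> 0. proj n v)" using proj_props(3)[of v] by simp
  then show ?thesis by (simp add: linear_simps[OF assms(1)] assms(2)[OF proj_props(1)])
qed

definition functional_of_degree :: "nat \<Rightarrow> ('v \<Rightarrow> complex) \<Rightarrow> bool" where
  "functional_of_degree e \<phi> \<longleftrightarrow>
     Vector_Spaces.linear scale (*) \<phi> \<and> (\<forall>m. m \<noteq> e \<longrightarrow> (\<forall>v\<in>V m. \<phi> v = 0))"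

lemma functional_of_degree_in_dual: "functional_of_degree e \<phi> \<Longrightarrow> \<phi> \<in> graded_dual"
  unfolding functional_of_degree_def graded_dual_def
  by (auto intro: finite_subset[of _ "{e}"])

lemma functional_of_degree_comp_proj:
  assumes "Vector_Spaces.linear scale (*) \<phi>"
  shows "functional_of_degree e (\<lambda>x. \<phi> (proj e x))"
  using assms unfolding functional_of_degree_def Vector_Spaces.linear_iff
  by (auto simp: proj_add proj_scale proj_mem linear_simps(3)[OF assms])

lemma functional_of_degree_proj:
  assumes "functional_of_degree e \<phi>"
  shows "\<phi> (proj e x) = \<phi> x"
proof -
  have lin: "Vector_Spaces.linear scale (*) \<phi>"
    using assms by (simp add: functional_of_degree_def)
  have "(\<lambda>x. \<phi> (proj e x) - \<phi> x) x = 0"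
  proof (rule linear_eq_0I[where f = "\<lambda>x. \<phi> (proj e x) - \<phi> x" and s = "(*)"])
    show "Vector_Spaces.linear scale (*) (\<lambda>x. \<phi> (proj e x) - \<phi> x)"
      unfolding Vector_Spaces.linear_iff
      by (simp add: vector_space_axioms vector_space_over_itself.vector_space_axioms linear_simps[OF lin]
          linear_simps[OF linear_proj] algebra_simps)
    show "\<phi> (proj e x) - \<phi> x = 0" if "x \<in> V d" for d x
      using assms that by (auto simp: functional_of_degree_def proj_mem linear_simps[OF lin])
  qed
  then show ?thesis by simp
qed

text \<open>
  Some component of \<open>x - y\<close> is nonzero, and a linear functional that does not vanish on it exists even
  if \<open>V e\<close> has infinite dimension; composed with the projection it has a degree.
\<close>

lemma functional_separates:
  assumes "\<And>e \<phi>. functional_of_degree e \<phi> \<Longrightarrow> \<phi> x = \<phi> y"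
  shows "x = y"
proof (rule ccontr)
  assume "x \<noteq> y"
  have "\<exists>e. proj e (x - y) \<noteq> 0"
  proof (rule ccontr)
    assume "\<nexists>e. proj e (x - y) \<noteq> 0"
    then have "x - y = 0" by (subst proj_props(3)) simp
    then show False using \<open>x \<noteq> y\<close> by simp
  qed
  then obtain e where e: "proj e (x - y) \<noteq> 0" by blast
  interpret c: vector_space "(*) :: complex \<Rightarrow> complex \<Rightarrow> complex"
    by (rule vector_space_over_itself.vector_space_axioms)
  interpret vector_space_pair scale "(*) :: complex \<Rightarrow> complex \<Rightarrow> complex" ..
  have "independent {proj e (x - y)}" using e by (simp add: independent_insert)
  then obtain \<psi> where \<psi>: "Vector_Spaces.linear scale (*) \<psi>" "\<psi> (proj e (x - y)) = 1"
    using linear_independent_extend[of "{proj e (x - y)}" "\<lambda>_. 1"] by auto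
  have "functional_of_degree e (\<lambda>x. \<psi> (proj e x))"
    by (rule functional_of_degree_comp_proj[OF \<psi>(1)])
  from assms[OF this] show False
    using \<psi>(2) by (simp add: linear_simps[OF linear_proj] linear_simps[OF \<psi>(1)])
qed

section \<open>Homogeneous fields\<close>

text \<open>
  The notion of a homogeneous field with the weight made explicit. For the zero field the weight
  is not unique.
\<close>

definition has_weight :: "(int \<Rightarrow> 'v \<Rightarrow> 'v) \<Rightarrow> int \<Rightarrow> bool" where
  "has_weight A \<Delta> \<longleftrightarrow> (\<forall>n. Vector_Spaces.linear scale scale (A n)) \<and>
     (\<forall>n v. L0 (A n v) - A n (L0 v) = scale (of_int (\<Delta> - n - 1)) (A n v))"

lemma homogeneous_field_iff: "homogeneous_field A \<longleftrightarrow> (\<exists>\<Delta>. has_weight A \<Delta>)"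
  unfolding homogeneous_field_def has_weight_def by blast

lemma has_weight_linear: "has_weight A \<Delta> \<Longrightarrow> Vector_Spaces.linear scale scale (A n)"
  unfolding has_weight_def by blast

text \<open>
  \<open>A k v\<close> is an eigenvector of \<open>L0\<close>, and eigenvectors lie in a single component.
\<close>

lemma has_weight_proj:
  assumes "has_weight A \<Delta>" "v \<in> V d"
  shows "proj e (A k v) = (if int e = int d + \<Delta> - k - 1 then A k v else 0)"
proof -
  let ?w = "A k v"
  let ?t = "int d + \<Delta> - k - 1"
  have "L0 ?w - A k (L0 v) = scale (of_int (\<Delta> - k - 1)) ?w"
    using assms(1) unfolding has_weight_def by blast
  then have "L0 ?w = scale (of_int (\<Delta> - k - 1)) ?w + scale (of_nat d) ?w"
    using assms by (simp add: L0_eigen linear_simps[OF has_weight_linear] algebra_simps)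
  then have L0: "L0 ?w = scale (of_int ?t) ?w"
    by (simp add: algebra_simps flip: scale_left_distrib)
  have zero: "proj n ?w = 0" if "int n \<noteq> ?t" for n
  proof -
    have "scale (of_nat n) (proj n ?w) = scale (of_int ?t) (proj n ?w)"
      using proj_L0[of n ?w] unfolding L0 proj_scale by (rule sym)
    moreover have "(of_nat n :: complex) \<noteq> of_int ?t"
      using that by (metis of_int_eq_iff of_int_of_nat_eq)
    ultimately show ?thesis using scale_cancel_right by blast
  qed
  show ?thesis
  proof (cases "int e = ?t")
    case True
    then have "{n. proj n ?w \<noteq> 0} \<subseteq> {e}" using zero by (auto, fastforce)
    then show ?thesis using sum_proj[of "{e}" ?w] True by simp
  qed (use zero in auto)
qed

lemma has_weight_mem:
  assumes "has_weight A \<Delta>" "v \<in> V d" "int e = int d + \<Delta> - k - 1"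
  shows "A k v \<in> V e"
  using has_weight_proj[OF assms(1,2), of e k] proj_props(1)[of e "A k v"] assms(3) by simp

lemma has_weight_eq_0:
  assumes "has_weight A \<Delta>" "v \<in> V d" "int d + \<Delta> \<le> k"
  shows "A k v = 0"
proof -
  have "proj n (A k v) = 0" for n
    using has_weight_proj[OF assms(1,2), of n k] assms(3) by auto
  then show ?thesis using proj_props(3)[of "A k v"] by simp
qed

text \<open>
  Large modes lower the degree below \<open>0\<close>; only finitely many components of \<open>v\<close> matter.
\<close>

lemma has_weight_truncated:
  assumes "has_weight A \<Delta>"
  shows "\<exists>K. \<forall>k\<ge>K. A k v = 0"
proof -
  let ?D = "{d. proj d v \<noteq> 0}"
  define K where "K = (if ?D = {} then 0 else int (Max ?D) + \<Delta>)"
  have "A k v = 0" if "K \<le> k" for k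
  proof -
    have "A k v = A k (\<Sum>d\<in>?D. proj d v)" using proj_props(3)[of v] by simp
    also have "\<dots> = (\<Sum>d\<in>?D. A k (proj d v))"
      by (rule linear_simps(5)[OF has_weight_linear[OF assms]])
    also have "\<dots> = 0"
    proof (rule sum.neutral, rule ballI)
      fix d assume d: "d \<in> ?D"
      then have "d \<le> Max ?D" using proj_props(2) by (intro Max_ge)
      then have "int d + \<Delta> \<le> k" using that d unfolding K_def by (auto split: if_splits)
      then show "A k (proj d v) = 0"
        by (rule has_weight_eq_0[OF assms proj_props(1)])
    qed
    finally show ?thesis .
  qed
  then show ?thesis by blast
qed

lemma has_weightI:
  assumes lin: "\<And>n. Vector_Spaces.linear scale scale (A n)"
    and hom: "\<And>n v d. v \<in> V d \<Longrightarrow> L0 (A n v) = scale (of_int (int d + \<Delta> - n - 1)) (A n v)"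
  shows "has_weight A \<Delta>"
  unfolding has_weight_def
proof (intro conjI allI lin)
  fix n v
  let ?f = "\<lambda>v. L0 (A n v) - A n (L0 v) - scale (of_int (\<Delta> - n - 1)) (A n v)"
  have "?f v = 0"
  proof (rule linear_eq_0I[where f = ?f and s = scale])
    show "Vector_Spaces.linear scale scale ?f"
      unfolding Vector_Spaces.linear_iff
      by (simp add: vector_space_axioms linear_simps[OF lin] linear_simps[OF linear_L0] algebra_simps)
    fix d x assume x: "x \<in> V d"
    have "scale (of_int (int d + \<Delta> - n - 1)) (A n x) =
        scale (of_nat d) (A n x) + scale (of_int (\<Delta> - n - 1)) (A n x)"
      by (simp add: algebra_simps flip: scale_left_distrib)
    then show "L0 (A n x) - A n (L0 x) - scale (of_int (\<Delta> - n - 1)) (A n x) = 0"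
      by (simp add: hom[OF x] L0_eigen[OF x] linear_simps[OF lin])
  qed
  then show "L0 (A n v) - A n (L0 v) = scale (of_int (\<Delta> - n - 1)) (A n v)" by simp
qed

lemma field_at_superset:
  assumes "finite K" "{k. proj e (A k v) \<noteq> 0} \<subseteq> K"
  shows "field_at A z v e = (\<Sum>k\<in>K. scale (z powi (-k-1)) (proj e (A k v)))"
  unfolding field_at_def using assms by (intro sum.mono_neutral_left) auto

lemma field_at_homogeneous:
  assumes "has_weight A \<Delta>" "v \<in> V d"
  shows "field_at A z v e = scale (z powi (int e - int d - \<Delta>)) (A (int d + \<Delta> - 1 - int e) v)"
proof -
  have "field_at A z v e = (\<Sum>k\<in>{int d + \<Delta> - 1 - int e}. scale (z powi (-k-1)) (proj e (A k v)))"
    by (rule field_at_superset) (auto simp: has_weight_proj[OF assms] split: if_splits)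
  then show ?thesis by (simp add: has_weight_proj[OF assms] algebra_simps)
qed

lemma field_at_sum:
  assumes "has_weight A \<Delta>" "finite D" "{d. proj d v \<noteq> 0} \<subseteq> D"
  shows "field_at A z v e = (\<Sum>d\<in>D. field_at A z (proj d v) e)"
proof -
  note w = has_weight_proj[OF assms(1) proj_props(1)]
  define K where "K = (\<lambda>d. int d + \<Delta> - 1 - int e) ` D"
  have K: "finite K" using assms(2) by (simp add: K_def)
  have eq: "proj e (A k v) = (\<Sum>d\<in>D. proj e (A k (proj d v)))" for k
  proof -
    have "proj e (A k v) = proj e (A k (\<Sum>d\<in>D. proj d v))"
      by (simp only: sum_proj[OF assms(2,3)])
    then show ?thesis
      by (simp add: linear_simps[OF linear_proj] linear_simps[OF has_weight_linear[OF assms(1)]])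
  qed
  have sub: "{k. proj e (A k (proj d v)) \<noteq> 0} \<subseteq> K" if "d \<in> D" for d
    using that by (auto simp: w K_def split: if_splits)
  have "{k. proj e (A k v) \<noteq> 0} \<subseteq> K"
  proof
    fix k assume "k \<in> {k. proj e (A k v) \<noteq> 0}"
    then have "\<exists>d\<in>D. proj e (A k (proj d v)) \<noteq> 0" unfolding eq using sum.neutral by force
    then show "k \<in> K" using sub by blast
  qed
  then have "field_at A z v e = (\<Sum>k\<in>K. scale (z powi (-k-1)) (proj e (A k v)))"
    by (rule field_at_superset[OF K])
  also have "\<dots> = (\<Sum>d\<in>D. \<Sum>k\<in>K. scale (z powi (-k-1)) (proj e (A k (proj d v))))"
    unfolding eq by (simp add: scale_sum_right sum.swap[of _ D K])
  also have "\<dots> = (\<Sum>d\<in>D. field_at A z (proj d v) e)"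
    by (intro sum.cong refl field_at_superset[OF K, symmetric] sub)
  finally show ?thesis .
qed

lemma field_at_mem:
  "field_at A z v e \<in> V e"
  unfolding field_at_def
  by (intro subspace_sum[OF subspace_V] subspace_scale[OF subspace_V] proj_props(1))

lemma pairing_eq:
  assumes "finite E" "{e. \<exists>v\<in>V e. \<phi> v \<noteq> 0} \<subseteq> E" "\<And>e. w e \<in> V e"
  shows "pairing \<phi> w = (\<Sum>e\<in>E. \<phi> (w e))"
  unfolding pairing_def using assms by (intro sum.mono_neutral_left) auto

lemma pairing_field_at:
  assumes A: "has_weight A \<Delta>" and \<phi>: "Vector_Spaces.linear scale (*) \<phi>"
    and E: "finite E" "{e. \<exists>v\<in>V e. \<phi> v \<noteq> 0} \<subseteq> E"
    and D: "finite D" "{d. proj d v \<noteq> 0} \<subseteq> D"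
  shows "pairing \<phi> (field_at A z v) = (\<Sum>e\<in>E. \<Sum>d\<in>D.
    z powi (int e - int d - \<Delta>) * \<phi> (proj e (A (int d + \<Delta> - 1 - int e) (proj d v))))"
proof -
  have "\<phi> (field_at A z v e) = (\<Sum>d\<in>D. z powi (int e - int d - \<Delta>) * \<phi> (proj e (A (int d + \<Delta> - 1 - int e) (proj d v))))" for e
    by (simp add: field_at_sum[OF A D] field_at_homogeneous[OF A proj_props(1)]
        has_weight_proj[OF A proj_props(1)] linear_simps[OF \<phi>])
  then show ?thesis by (simp add: pairing_eq[OF E field_at_mem])
qed

text \<open>
  The summand that passes through \<open>V n\<close> is, for each pair of degrees \<open>e\<close> and \<open>d\<close>, a single monomial in
  \<open>z1\<close> and \<open>z2\<close>: the degrees determine both modes.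
\<close>

lemma product_term_eq:
  assumes A: "has_weight A \<Delta>A" and B: "has_weight B \<Delta>B"
    and \<phi>: "Vector_Spaces.linear scale (*) \<phi>"
    and E: "finite E" "{e. \<exists>v\<in>V e. \<phi> v \<noteq> 0} \<subseteq> E"
    and D: "finite D" "{d. proj d v \<noteq> 0} \<subseteq> D"
  shows "product_term \<phi> A z1 n B z2 v = (\<Sum>e\<in>E. \<Sum>d\<in>D.
    z1 powi (int e - int n - \<Delta>A) * z2 powi (int n - int d - \<Delta>B) *
    \<phi> (proj e (A (int n + \<Delta>A - 1 - int e) (B (int d + \<Delta>B - 1 - int n) (proj d v)))))"
proof -
  have "\<phi> (field_at A z1 (field_at B z2 v n) e) = (\<Sum>d\<in>D.
    z1 powi (int e - int n - \<Delta>A) * z2 powi (int n - int d - \<Delta>B) *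
    \<phi> (proj e (A (int n + \<Delta>A - 1 - int e) (B (int d + \<Delta>B - 1 - int n) (proj d v)))))" for e
  proof -
    have w: "field_at B z2 v n = (\<Sum>d\<in>D. scale (z2 powi (int n - int d - \<Delta>B))
        (B (int d + \<Delta>B - 1 - int n) (proj d v)))"
      by (simp add: field_at_sum[OF B D] field_at_homogeneous[OF B proj_props(1)])
    have "\<phi> (field_at A z1 (field_at B z2 v n) e) = z1 powi (int e - int n - \<Delta>A) *
        \<phi> (proj e (A (int n + \<Delta>A - 1 - int e) (field_at B z2 v n)))"
      by (simp add: field_at_homogeneous[OF A field_at_mem] has_weight_proj[OF A field_at_mem]
          linear_simps[OF \<phi>])
    then show ?thesis
      by (simp add: w linear_simps[OF has_weight_linear[OF A]] linear_simps[OF linear_proj]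
          linear_simps[OF \<phi>] sum_distrib_left mult.assoc)
  qed
  then show ?thesis unfolding product_term_def by (simp add: pairing_eq[OF E field_at_mem])
qed

end

section \<open>Expansions of a rational two-point function\<close>

lemma summable_shift_powi:
  fixes a :: "nat \<Rightarrow> complex" and t :: complex
  assumes "(\<lambda>n. a n * t powi (k + int n)) sums S" "t \<noteq> 0"
  shows "summable (\<lambda>n. a n * t ^ n)"
proof -
  have "summable (\<lambda>n. t powi (- k) * (a n * t powi (k + int n)))"
    using assms(1) by (intro summable_mult sums_summable)
  moreover have "t powi (- k) * (a n * t powi (k + int n)) = a n * t ^ n" for n
    using assms(2) by (simp add: power_int_add power_int_minus)
  ultimately show ?thesis by simp
qed

text \<open>
  The situation obtained from two local fields between a homogeneous vector and a homogeneous
  functional: \<open>a\<close> and \<open>b\<close> are the coefficients of the two orderings, \<open>s\<close> is the sum of the two mode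
  indices. By Newton's formula \<open>a - b\<close> is a combination of binomial polynomials, whose coefficients \<open>polar\<close>
  are those of the polar part of the common sum; cutting \<open>a\<close> and \<open>b\<close> at \<open>0\<close> and gluing them gives the finitely
  supported sequence \<open>regular\<close>, the Laurent polynomial part.
\<close>

locale two_sided_coefficients =
  fixes a b :: "int \<Rightarrow> complex" and M0 M1 s :: int and N :: nat
  assumes low: "\<And>m. m < M0 \<Longrightarrow> a m = 0"
    and high: "\<And>m. M1 < m \<Longrightarrow> b m = 0"
    and polynomial: "(fdiff ^^ N) (\<lambda>m. a m - b m) = 0"
begin

definition polar :: "nat \<Rightarrow> complex" where
  "polar i = (fdiff ^^ i) (\<lambda>m. a m - b m) 0"

definition regular :: "int \<Rightarrow> complex" where
  "regular m = (if 0 \<le> m then b m else a m)"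

definition supp :: "int set" where
  "supp = {min M0 0..max M1 0}"

definition sum_function :: "complex \<times> complex \<Rightarrow> complex" where
  "sum_function = rational2 s supp regular N polar"

lemma finite_supp: "finite supp"
  by (simp add: supp_def)

lemma regular_eq_0: "m \<notin> supp \<Longrightarrow> regular m = 0"
  using low high by (auto simp: supp_def regular_def)

lemma difference: "a m - b m = (\<Sum>i<N. polar i * (of_int m gchoose i))"
  unfolding polar_def by (rule newton_expansion[OF polynomial])

lemma sums_outer:
  assumes "0 < norm z2" "norm z2 < norm z1"
  shows "(\<lambda>n. a (M0 + int n) * (z1 powi (-(M0 + int n)-1) * z2 powi ((M0 + int n)-s-1)))
    sums sum_function (z1, z2)"
proof -
  have "((\<lambda>m. a m * (z1 powi (-m-1) * z2 powi (m-s-1))) has_sum sum_function (z1, z2)) UNIV"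
    unfolding sum_function_def
  proof (rule rational2_outer)
    show "a m = regular m + (if 0 \<le> m then (\<Sum>i<N. polar i * (of_int m gchoose i)) else 0)" for m
      by (simp add: regular_def flip: difference)
  qed (use assms finite_supp regular_eq_0 in auto)
  then show ?thesis
    by (intro has_sum_imp_sums, subst has_sum_int_up[of M0 "\<lambda>m. a m * (z1 powi (-m-1) * z2 powi (m-s-1))"])
      (auto simp: low)
qed

lemma sums_inner:
  assumes "0 < norm z1" "norm z1 < norm z2"
  shows "(\<lambda>n. b (M1 - int n) * (z1 powi (-(M1 - int n)-1) * z2 powi ((M1 - int n)-s-1)))
    sums sum_function (z1, z2)"
proof -
  have "((\<lambda>m. b m * (z1 powi (-m-1) * z2 powi (m-s-1))) has_sum sum_function (z1, z2)) UNIV"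
    unfolding sum_function_def
  proof (rule rational2_inner)
    show "b m = regular m - (if m < 0 then (\<Sum>i<N. polar i * (of_int m gchoose i)) else 0)" for m
      by (simp add: regular_def flip: difference)
  qed (use assms finite_supp regular_eq_0 in auto)
  then show ?thesis
    by (intro has_sum_imp_sums, subst has_sum_int_down[of M1 "\<lambda>m. b m * (z1 powi (-m-1) * z2 powi (m-s-1))"])
      (auto simp: high)
qed

lemma dominated_outer:
  "locally_dominated (\<lambda>n (z1, z2). a (M0 + int n) * (z1 powi (-(M0 + int n)-1) * z2 powi ((M0 + int n)-s-1)))
     {(z1, z2). 0 < norm z2 \<and> norm z2 < norm z1}" 
  (is "locally_dominated ?f ?T")
proof -
  let ?S = "{x :: complex \<times> complex. 0 < norm (snd x) \<and> norm (snd x) < norm (fst x)}"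
  let ?h = "\<lambda>x :: complex \<times> complex. fst x powi (-M0-1) * snd x powi (M0-s-1)"
  let ?q = "\<lambda>x :: complex \<times> complex. snd x / fst x"
  have nz: "fst x \<noteq> 0" "snd x \<noteq> 0" if "x \<in> ?S" for x :: "complex \<times> complex"
    using that by auto
  have "locally_dominated (\<lambda>n x. ?h x * (a (M0 + int n) * ?q x ^ n)) ?S"
  proof (rule locally_dominated_powser)
    show "open ?S"
      by (intro open_Collect_conj open_Collect_less continuous_intros)
    show "continuous_on ?S ?h" "continuous_on ?S ?q"
      by (intro continuous_intros ballI; use nz in blast)+
    show "norm (?q x) < 1" if "x \<in> ?S" for x
      using that by (auto simp: norm_divide divide_simps)
    show "summable (\<lambda>n. a (M0 + int n) * t ^ n)" if "norm t < 1" for t :: complex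
    proof (cases "t = 0")
      case True
      then show ?thesis using sums_summable[OF powser_sums_zero] by simp
    next
      case False
      have "(\<lambda>n. a (M0 + int n) * t powi ((M0-s-1) + int n)) sums sum_function (1, t)"
        using sums_outer[of t 1] False that by (simp add: algebra_simps)
      then show ?thesis by (rule summable_shift_powi) fact
    qed
  qed
  moreover have "?h x * (a (M0 + int n) * ?q x ^ n) = ?f n x" if "x \<in> ?S" for n x
  proof -
    obtain z1 z2 where x: "x = (z1, z2)" by (cases x)
    then have "z1 \<noteq> 0" "z2 \<noteq> 0" using nz[OF that] by auto
    then have "z1 powi (-(M0 + int n)-1) = z1 powi (-M0-1) / z1 ^ n"
      "z2 powi ((M0 + int n)-s-1) = z2 powi (M0-s-1) * z2 ^ n"
      using power_int_diff[of z1 "-M0-1" "int n"] power_int_add[of z2 "M0-s-1" "int n"]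
      by (simp_all add: algebra_simps)
    then show ?thesis by (simp add: x power_divide)
  qed
  ultimately have "locally_dominated ?f ?S" by (simp add: locally_dominated_def)
  then show ?thesis by (simp add: case_prod_unfold)
qed

lemma dominated_inner:
  "locally_dominated (\<lambda>n (z1, z2). b (M1 - int n) * (z1 powi (-(M1 - int n)-1) * z2 powi ((M1 - int n)-s-1)))
     {(z1, z2). 0 < norm z1 \<and> norm z1 < norm z2}" 
  (is "locally_dominated ?f ?T")
proof -
  let ?S = "{x :: complex \<times> complex. 0 < norm (fst x) \<and> norm (fst x) < norm (snd x)}"
  let ?h = "\<lambda>x :: complex \<times> complex. fst x powi (-M1-1) * snd x powi (M1-s-1)"
  let ?q = "\<lambda>x :: complex \<times> complex. fst x / snd x"
  have nz: "fst x \<noteq> 0" "snd x \<noteq> 0" if "x \<in> ?S" for x :: "complex \<times> complex"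
    using that by auto
  have "locally_dominated (\<lambda>n x. ?h x * (b (M1 - int n) * ?q x ^ n)) ?S"
  proof (rule locally_dominated_powser)
    show "open ?S"
      by (intro open_Collect_conj open_Collect_less continuous_intros)
    show "continuous_on ?S ?h" "continuous_on ?S ?q"
      by (intro continuous_intros ballI; use nz in blast)+
    show "norm (?q x) < 1" if "x \<in> ?S" for x
      using that by (auto simp: norm_divide divide_simps)
    show "summable (\<lambda>n. b (M1 - int n) * t ^ n)" if "norm t < 1" for t :: complex
    proof (cases "t = 0")
      case True
      then show ?thesis using sums_summable[OF powser_sums_zero] by simp
    next
      case False
      have "(\<lambda>n. b (M1 - int n) * t powi ((-M1-1) + int n)) sums sum_function (t, 1)"
        using sums_inner[of t 1] False that by (simp add: algebra_simps)
      then show ?thesis by (rule summable_shift_powi) fact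
    qed
  qed
  moreover have "?h x * (b (M1 - int n) * ?q x ^ n) = ?f n x" if "x \<in> ?S" for n x
  proof -
    obtain z1 z2 where x: "x = (z1, z2)" by (cases x)
    then have "z1 \<noteq> 0" "z2 \<noteq> 0" using nz[OF that] by auto
    then have "z1 powi (-(M1 - int n)-1) = z1 powi (-M1-1) * z1 ^ n"
      "z2 powi ((M1 - int n)-s-1) = z2 powi (M1-s-1) / z2 ^ n"
      using power_int_add[of z1 "-M1-1" "int n"] power_int_diff[of z2 "M1-s-1" "int n"]
      by (simp_all add: algebra_simps)
    then show ?thesis by (simp add: x power_divide)
  qed
  ultimately have "locally_dominated ?f ?S" by (simp add: locally_dominated_def)
  then show ?thesis by (simp add: case_prod_unfold)
qed

lemma holomorphic_sum_function: "holomorphic2_on sum_function Conf2"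
  unfolding sum_function_def by (rule holomorphic2_rational2)

lemma sum_function_pole_cleared:
  "\<exists>g. holomorphic2_on g (punctured \<times> punctured) \<and>
     (\<forall>(z1, z2)\<in>Conf2. g (z1, z2) = (z1 - z2) ^ N * sum_function (z1, z2))"
  unfolding sum_function_def by (rule rational2_pole_cleared)

text \<open>
  The residue that defines the \<open>n\<close>-th product equals the difference of the coefficients at
  \<open>1 / z1\<close> of the two expansions. For \<open>n \<ge> 0\<close> both sides are the \<open>n\<close>-th difference of \<open>a - b\<close>
  at \<open>0\<close>; for \<open>n < 0\<close> the expansions only involve \<open>a\<close> at negative and \<open>b\<close> at nonnegative indices,
  that is, only \<open>regular\<close>.
\<close>

lemma residue_sum_function:
  assumes "0 < \<rho>" "\<rho> < norm z"
    and x: "truncated x" "\<And>m. x m (s - m) = a m"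
    and y: "truncated (\<lambda>k m. y m k)" "\<And>m. y m (s - m) = b m"
  shows "((\<lambda>w. (w - z) powi n * sum_function (w, z)) has_contour_integral
     2 * of_real pi * \<i> * (z powi (n - s - 1) * (iota1 n x 0 (s - n) - iota2 n y 0 (s - n))))
     (circlepath z \<rho>)"
proof -
  have "(if 0 \<le> n then (if nat n < N then polar (nat n) else 0)
       else (\<Sum>m\<in>supp. regular m * (of_int (-m-1) gchoose nat (- n - 1)))) =
      iota1 n x 0 (s - n) - iota2 n y 0 (s - n)"
  proof (cases "0 \<le> n")
    case True
    define q where "q = nat n"
    have n: "n = int q" using True by (simp add: q_def)
    have "iota1 n x 0 (s - n) - iota2 n y 0 (s - n) = ((sdiff ^^ q) x - (sdiff ^^ q) y) 0 (s - n)"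
      unfolding n iota1_nat[OF x(1)] iota2_nat[OF y(1)] by simp
    also have "\<dots> = (sdiff ^^ q) (x - y) 0 (s - n)"
      by (simp only: Modules.additive.diff[OF additive_funpow[OF additive_sdiff]])
    also have "\<dots> = polar q"
      unfolding funpow_sdiff_eq_fdiff polar_def by (simp add: n x(2) y(2))
    also have "\<dots> = (if q < N then polar q else 0)"
      using funpow_eq_0_mono[OF additive_fdiff polynomial] by (simp add: polar_def)
    finally show ?thesis using True by (simp add: q_def)
  next
    case False
    obtain K where K: "\<And>m k. K \<le> k \<Longrightarrow> x m k = 0" using x(1) unfolding truncated_def by metis
    obtain K' where K': "\<And>m k. K' \<le> m \<Longrightarrow> y m k = 0" using y(1) unfolding truncated_def by metis
    \<comment> \<open>Large enough for both expansions and for the support of \<open>regular\<close>.\<close>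
    define J where "J = nat (\<bar>K - s + n\<bar> + \<bar>K'\<bar> + \<bar>M0\<bar> + \<bar>M1\<bar> + \<bar>n\<bar> + 1)"
    have iJ: "int J = \<bar>K - s + n\<bar> + \<bar>K'\<bar> + \<bar>M0\<bar> + \<bar>M1\<bar> + \<bar>n\<bar> + 1" by (simp add: J_def)
    have J: "K \<le> (s - n) + int J" "K' \<le> 0 + int J"
      unfolding iJ by linarith+
    have J': "supp \<subseteq> {n - int J<..<int J}"
    proof
      fix m assume "m \<in> supp"
      then have "- \<bar>M0\<bar> \<le> m" "m \<le> \<bar>M1\<bar>" by (auto simp: supp_def)
      then have "n - int J < m" "m < int J" using iJ by linarith+
      then show "m \<in> {n - int J<..<int J}" by simp
    qed
    have "iota1 n x 0 (s - n) = (\<Sum>j<J. (-1) ^ j * (of_int n gchoose j) * x (0 + n - int j) ((s - n) + int j))"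
      by (rule iota1_eq[OF K J(1)])
    also have "\<dots> = (\<Sum>j<J. (-1) ^ j * (of_int n gchoose j) * regular (n - int j))"
      using False by (simp add: regular_def algebra_simps flip: x(2))
    finally have 1: "iota1 n x 0 (s - n) = (\<Sum>j<J. (-1) ^ j * (of_int n gchoose j) * regular (n - int j))" .
    have "iota1 n (\<lambda>k m. y m k) (s - n) 0 =
        (\<Sum>j<J. (-1) ^ j * (of_int n gchoose j) * y (0 + int j) ((s - n) + n - int j))"
      by (rule iota1_eq[of K' "\<lambda>k m. y m k", OF K' J(2)])
    also have "\<dots> = (\<Sum>j<J. (-1) ^ j * (of_int n gchoose j) * regular (int j))"
      by (simp add: regular_def y(2))
    finally have 2: "iota2 n y 0 (s - n) = (-1) powi n * (\<Sum>j<J. (-1) ^ j * (of_int n gchoose j) * regular (int j))"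
      by (simp add: iota2_def)
    show ?thesis
      using False sum_powi_residues[OF finite_supp regular_eq_0 _ J'] by (simp add: 1 2)
  qed
  then show ?thesis
    using circle_integral_rational2[OF assms(1,2), of n s supp regular N polar]
    unfolding sum_function_def by simp
qed

end

section \<open>Locality in terms of modes\<close>

lemma funpow_fdiff_eq_0:
  assumes "\<And>i. m \<le> i \<Longrightarrow> i \<le> m + int N \<Longrightarrow> x i = 0"
  shows "(fdiff ^^ N) x m = 0"
  using assms
proof (induction N arbitrary: m)
  case (Suc N)
  have "(fdiff ^^ N) x (m + 1) = 0" "(fdiff ^^ N) x m = 0"
    by (intro Suc.IH Suc.prems; simp)+
  then show ?case by (simp add: fdiff_def[of "(fdiff ^^ N) x"])
qed simp

text \<open>
  Exchanging the variables changes \<open>z1 - z2\<close> by a sign, and its powers by a sign as well.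
\<close>

lemma sdiff_transpose_eq_0:
  assumes "(sdiff ^^ N) X = 0"
  shows "(sdiff ^^ N) (\<lambda>k m. - X m k) = 0"
proof -
  have "(sdiff ^^ N) (\<lambda>k m. - X m k) = (\<lambda>k m. - ((sdiff ^^ N) X m k)) \<or>
        (sdiff ^^ N) (\<lambda>k m. - X m k) = (\<lambda>k m. (sdiff ^^ N) X m k)" for N
    by (induction N) (auto simp: fun_eq_iff sdiff_def)
  then show ?thesis using assms by (metis (no_types, lifting) ext neg_0_equal_iff_equal zero_fun_apply)
qed

context graded_space
begin

text \<open>
  The algebraic form of locality: \<open>(z1 - z2) ^ N\<close> annihilates the commutator.
\<close>

definition mode_local :: "nat \<Rightarrow> (int \<Rightarrow> 'v \<Rightarrow> 'v) \<Rightarrow> (int \<Rightarrow> 'v \<Rightarrow> 'v) \<Rightarrow> bool" where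
  "mode_local N A B \<longleftrightarrow> (\<forall>v. (sdiff ^^ N) (\<lambda>m k. A m (B k v) - B k (A m v)) = 0)"

lemma mode_local_sym:
  assumes "mode_local N A B"
  shows "mode_local N B A"
  unfolding mode_local_def
proof
  fix v
  show "(sdiff ^^ N) (\<lambda>m k. B m (A k v) - A k (B m v)) = 0"
    using sdiff_transpose_eq_0[of N "\<lambda>m k. A m (B k v) - B k (A m v)"] assms
    unfolding mode_local_def by simp
qed

lemma mode_local_functional:
  assumes "mode_local N A B" "Vector_Spaces.linear scale (*) \<phi>"
  shows "(sdiff ^^ N) (\<lambda>m k. \<phi> (A m (B k v)) - \<phi> (B k (A m v))) = 0"
proof (intro ext)
  fix m k
  have "(sdiff ^^ N) (\<lambda>m k. \<phi> (A m (B k v) - B k (A m v))) m k =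
      \<phi> ((sdiff ^^ N) (\<lambda>m k. A m (B k v) - B k (A m v)) m k)"
    by (rule linear_sdiff[OF assms(2), symmetric])
  then show "(sdiff ^^ N) (\<lambda>m k. \<phi> (A m (B k v)) - \<phi> (B k (A m v))) m k = 0 m k"
    using assms(1) by (simp add: mode_local_def linear_simps[OF assms(2)])
qed

definition coef_left ::
  "('v \<Rightarrow> complex) \<Rightarrow> (int \<Rightarrow> 'v \<Rightarrow> 'v) \<Rightarrow> (int \<Rightarrow> 'v \<Rightarrow> 'v) \<Rightarrow> int \<Rightarrow> nat \<Rightarrow> nat \<Rightarrow> 'v \<Rightarrow> int \<Rightarrow> complex"
  where "coef_left \<phi> A B s e d v m = \<phi> (proj e (A m (B (s - m) (proj d v))))"

definition coef_right ::
  "('v \<Rightarrow> complex) \<Rightarrow> (int \<Rightarrow> 'v \<Rightarrow> 'v) \<Rightarrow> (int \<Rightarrow> 'v \<Rightarrow> 'v) \<Rightarrow> int \<Rightarrow> nat \<Rightarrow> nat \<Rightarrow> 'v \<Rightarrow> int \<Rightarrow> complex"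
  where "coef_right \<phi> A B s e d v m = \<phi> (proj e (B (s - m) (A m (proj d v))))"

end

locale two_fields = graded_space scale V L0
  for scale :: "complex \<Rightarrow> 'v::ab_group_add \<Rightarrow> 'v" and V and L0 +
  fixes A B :: "int \<Rightarrow> 'v \<Rightarrow> 'v" and \<Delta>A \<Delta>B :: int
  assumes A: "has_weight A \<Delta>A" and B: "has_weight B \<Delta>B"
begin

text \<open>
  The sum of the mode indices that map the component of degree \<open>d\<close> to the one of degree \<open>e\<close>.
  \<open>lower e\<close> is the smallest index of \<open>A\<close> for which an ordering with \<open>A\<close> on the left can contribute,
  \<open>upper d\<close> the largest one for \<open>A\<close> on the right; beyond them the intermediate degree is negative.
\<close>

definition total_degree :: "nat \<Rightarrow> nat \<Rightarrow> int" where
  "total_degree e d = int d - int e + \<Delta>A + \<Delta>B - 2"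

abbreviation "lower e \<equiv> \<Delta>A - 1 - int e"
abbreviation "upper d \<equiv> int d + \<Delta>A - 1"

abbreviation "left \<phi> e d v \<equiv> coef_left \<phi> A B (total_degree e d) e d v"
abbreviation "right \<phi> e d v \<equiv> coef_right \<phi> A B (total_degree e d) e d v"

lemmas linA = has_weight_linear[OF A] and linB = has_weight_linear[OF B]

lemma left_low:
  assumes "Vector_Spaces.linear scale (*) \<phi>" "m < lower e"
  shows "left \<phi> e d v m = 0"
proof -
  have "B (total_degree e d - m) (proj d v) = 0"
    by (rule has_weight_eq_0[OF B proj_props(1)]) (use assms(2) in \<open>simp add: total_degree_def\<close>)
  then show ?thesis
    by (simp add: coef_left_def linear_simps[OF linA] linear_simps[OF linear_proj] linear_simps[OF assms(1)])
qed

lemma right_high: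
  assumes "Vector_Spaces.linear scale (*) \<phi>" "upper d < m"
  shows "right \<phi> e d v m = 0"
proof -
  have "A m (proj d v) = 0"
    by (rule has_weight_eq_0[OF A proj_props(1)]) (use assms(2) in simp)
  then show ?thesis
    by (simp add: coef_right_def linear_simps[OF linB] linear_simps[OF linear_proj] linear_simps[OF assms(1)])
qed

lemma product_term_left:
  assumes "Vector_Spaces.linear scale (*) \<phi>"
    and "finite E" "{e. \<exists>v\<in>V e. \<phi> v \<noteq> 0} \<subseteq> E" "finite D" "{d. proj d v \<noteq> 0} \<subseteq> D"
  shows "product_term \<phi> A z1 n B z2 v = (\<Sum>e\<in>E. \<Sum>d\<in>D. left \<phi> e d v (lower e + int n) *
    (z1 powi (-(lower e + int n)-1) * z2 powi ((lower e + int n) - total_degree e d - 1)))"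
  unfolding product_term_eq[OF A B assms] coef_left_def total_degree_def
  by (simp add: algebra_simps)

lemma product_term_right:
  assumes "Vector_Spaces.linear scale (*) \<phi>"
    and "finite E" "{e. \<exists>v\<in>V e. \<phi> v \<noteq> 0} \<subseteq> E" "finite D" "{d. proj d v \<noteq> 0} \<subseteq> D"
  shows "product_term \<phi> B z2 n A z1 v = (\<Sum>e\<in>E. \<Sum>d\<in>D. right \<phi> e d v (upper d - int n) *
    (z1 powi (-(upper d - int n)-1) * z2 powi ((upper d - int n) - total_degree e d - 1)))"
  unfolding product_term_eq[OF B A assms] coef_right_def total_degree_def
  by (simp add: algebra_simps)

section \<open>From analytic locality to modes\<close>

text \<open>
  By homogeneity nothing is lost on the line \<open>z2 = 1\<close>. There \<open>(z1 - 1) ^ N * f (z1, 1)\<close> extends to a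
  holomorphic function on the punctured plane, and multiplication by \<open>z1 - 1\<close> takes differences of
  coefficients.
\<close>

lemma correlation_imp_coefficients:
  assumes \<phi>: "functional_of_degree e \<phi>" and v: "v \<in> V d"
    and alu1: "alu_convergent_on (\<lambda>n (z1, z2). product_term \<phi> A z1 n B z2 v)
          {(z1, z2). 0 < norm z2 \<and> norm z2 < norm z1}"
    and alu2: "alu_convergent_on (\<lambda>n (z1, z2). product_term \<phi> B z2 n A z1 v)
          {(z1, z2). 0 < norm z1 \<and> norm z1 < norm z2}"
    and f: "is_correlation A B \<phi> v f"
    and g: "holomorphic2_on g (punctured \<times> punctured)"
      "\<forall>(z1, z2)\<in>Conf2. g (z1, z2) = (z1 - z2) ^ N * f (z1, z2)"
  shows "(fdiff ^^ N) (\<lambda>m. left \<phi> e d v m - right \<phi> e d v m) = 0"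
proof -
  have lin: "Vector_Spaces.linear scale (*) \<phi>"
    using \<phi> by (simp add: functional_of_degree_def)
  have E: "finite {e}" "{e. \<exists>v\<in>V e. \<phi> v \<noteq> 0} \<subseteq> {e}"
    using \<phi> by (auto simp: functional_of_degree_def)
  have D: "finite {d}" "{d. proj d v \<noteq> 0} \<subseteq> {d}"
    using v by (auto simp: proj_mem)
  let ?a = "left \<phi> e d v" and ?b = "right \<phi> e d v"
  have outer: "((\<lambda>m. (fdiff ^^ N) ?a m * z powi (-m-1)) has_sum g (z, 1)) UNIV" if "1 < norm z" for z
  proof -
    have z: "z \<noteq> 0" "(z, 1) \<in> Conf2" using that by (auto simp: Conf2_def punctured_def)
    have summand: "product_term \<phi> A z n B 1 v = ?a (lower e + int n) * z powi (-(lower e + int n)-1)" for n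
      by (simp add: product_term_left[OF lin E D])
    have "summable (\<lambda>n. norm (product_term \<phi> A z n B 1 v))"
      using alu_imp_summable[OF alu1, of "(z, 1)"] that by simp
    moreover have "f (z, 1) = (\<Sum>n. product_term \<phi> A z n B 1 v)"
      using f that by (simp add: is_correlation_def)
    ultimately have "((\<lambda>n. product_term \<phi> A z n B 1 v) has_sum f (z, 1)) UNIV"
      by (intro norm_summable_imp_has_sum) (auto intro: summable_sums summable_norm_cancel)
    then have "((\<lambda>m. ?a m * z powi (-m-1)) has_sum f (z, 1)) UNIV"
      unfolding summand by (subst (asm) has_sum_int_up[of _ "\<lambda>m. ?a m * z powi (-m-1)"]) (auto simp: left_low[OF lin])
    from has_sum_times_minus_1_power[OF this z(1), of N] show ?thesis
      using g(2) z(2) by auto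
  qed
  have inner: "((\<lambda>m. (fdiff ^^ N) ?b m * z powi (-m-1)) has_sum g (z, 1)) UNIV" if "z \<noteq> 0" "norm z < 1" for z
  proof -
    have z: "(z, 1) \<in> Conf2" using that by (auto simp: Conf2_def punctured_def)
    have summand: "product_term \<phi> B 1 n A z v = ?b (upper d - int n) * z powi (-(upper d - int n)-1)" for n
      by (simp add: product_term_right[OF lin E D])
    have "summable (\<lambda>n. norm (product_term \<phi> B 1 n A z v))"
      using alu_imp_summable[OF alu2, of "(z, 1)"] that by simp
    moreover have "f (z, 1) = (\<Sum>n. product_term \<phi> B 1 n A z v)"
      using f that by (simp add: is_correlation_def)
    ultimately have "((\<lambda>n. product_term \<phi> B 1 n A z v) has_sum f (z, 1)) UNIV"
      by (intro norm_summable_imp_has_sum) (auto intro: summable_sums summable_norm_cancel)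
    then have "((\<lambda>m. ?b m * z powi (-m-1)) has_sum f (z, 1)) UNIV"
      unfolding summand by (subst (asm) has_sum_int_down[of _ "\<lambda>m. ?b m * z powi (-m-1)"]) (auto simp: right_high[OF lin])
    from has_sum_times_minus_1_power[OF this that(1), of N] show ?thesis
      using g(2) z by auto
  qed
  have "(fdiff ^^ N) ?a = (fdiff ^^ N) ?b"
  proof (rule laurent_coeffs_eq[OF _ _ _ outer inner])
    show "(fdiff ^^ N) ?a m = 0" if "m < lower e - int N" for m
      using that by (intro funpow_fdiff_eq_0 left_low[OF lin]) simp
    show "(fdiff ^^ N) ?b m = 0" if "upper d < m" for m
      using that by (intro funpow_fdiff_eq_0 right_high[OF lin]) simp
    show "(\<lambda>z. g (z, 1)) holomorphic_on - {0}"
      by (rule holomorphic2_restrict_snd[OF g(1)]) (auto simp: punctured_def)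
  qed
  moreover have "(fdiff ^^ N) (?a - ?b) = (fdiff ^^ N) ?a - (fdiff ^^ N) ?b"
    by (rule Modules.additive.diff[OF additive_funpow[OF additive_fdiff]])
  ultimately show ?thesis by (simp add: fun_diff_def)
qed

lemma off_diagonal:
  assumes "Vector_Spaces.linear scale (*) \<phi>" "v \<in> V d" "i + j \<noteq> total_degree e d"
  shows "\<phi> (proj e (A i (B j v))) = 0" "\<phi> (proj e (B j (A i v))) = 0"
proof -
  have "proj e (A i (B j v)) = 0"
  proof (cases "0 \<le> int d + \<Delta>B - j - 1")
    case True
    have "B j v \<in> V (nat (int d + \<Delta>B - j - 1))"
      by (rule has_weight_mem[OF B assms(2)]) (use True in simp)
    then show ?thesis using True assms(3) by (simp add: has_weight_proj[OF A] total_degree_def)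
  next
    case False
    then have "B j v = 0" by (intro has_weight_eq_0[OF B assms(2)]) simp
    then show ?thesis by (simp add: linear_simps[OF linA] linear_simps[OF linear_proj])
  qed
  then show "\<phi> (proj e (A i (B j v))) = 0" by (simp add: linear_simps[OF assms(1)])
  have "proj e (B j (A i v)) = 0"
  proof (cases "0 \<le> int d + \<Delta>A - i - 1")
    case True
    have "A i v \<in> V (nat (int d + \<Delta>A - i - 1))"
      by (rule has_weight_mem[OF A assms(2)]) (use True in simp)
    then show ?thesis using True assms(3) by (simp add: has_weight_proj[OF B] total_degree_def)
  next
    case False
    then have "A i v = 0" by (intro has_weight_eq_0[OF A assms(2)]) simp
    then show ?thesis by (simp add: linear_simps[OF linB] linear_simps[OF linear_proj])
  qed
  then show "\<phi> (proj e (B j (A i v))) = 0" by (simp add: linear_simps[OF assms(1)])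
qed

text \<open>
  The coefficients between homogeneous vectors and functionals suffice, and among these only the
  ones with mode indices that add up to the total degree.
\<close>

lemma mode_localI:
  assumes "\<And>e \<phi> d v. functional_of_degree e \<phi> \<Longrightarrow> v \<in> V d \<Longrightarrow>
    (fdiff ^^ N) (\<lambda>m. left \<phi> e d v m - right \<phi> e d v m) = 0"
  shows "mode_local N A B"
  unfolding mode_local_def
proof (intro allI ext)
  fix v m k
  let ?X = "\<lambda>v m k. A m (B k v) - B k (A m v)"
  have "(sdiff ^^ N) (?X v) m k = 0"
  proof (rule functional_separates)
    fix e \<phi> assume \<phi>: "functional_of_degree e \<phi>"
    then have lin: "Vector_Spaces.linear scale (*) \<phi>"
      by (simp add: functional_of_degree_def)
    have "(\<lambda>v. (sdiff ^^ N) (\<lambda>m k. \<phi> (?X v m k)) m k) v = 0"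
    proof (rule linear_eq_0I[where f = "\<lambda>v. (sdiff ^^ N) (\<lambda>m k. \<phi> (?X v m k)) m k" and s = "(*)"])
      have "(sdiff ^^ N) (\<lambda>m k. \<phi> (?X (x + y) m k)) m k =
          (sdiff ^^ N) (\<lambda>m k. \<phi> (?X x m k)) m k + (sdiff ^^ N) (\<lambda>m k. \<phi> (?X y m k)) m k" for x y N m k
        by (induction N arbitrary: m k)
          (simp_all add: sdiff_def linear_simps[OF lin] linear_simps[OF linA] linear_simps[OF linB])
      moreover have "(sdiff ^^ N) (\<lambda>m k. \<phi> (?X (scale c x) m k)) m k =
          c * (sdiff ^^ N) (\<lambda>m k. \<phi> (?X x m k)) m k" for c x N m k
        by (induction N arbitrary: m k)
          (simp_all add: sdiff_def linear_simps[OF lin] linear_simps[OF linA] linear_simps[OF linB] algebra_simps)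
      ultimately show "Vector_Spaces.linear scale (*) (\<lambda>v. (sdiff ^^ N) (\<lambda>m k. \<phi> (?X v m k)) m k)"
        unfolding Vector_Spaces.linear_iff by (simp add: vector_space_axioms vector_space_over_itself.vector_space_axioms)
    next
      fix d x assume x: "x \<in> V d"
      have eq: "\<phi> (?X x i j) = \<phi> (proj e (A i (B j x))) - \<phi> (proj e (B j (A i x)))" for i j
        by (simp add: functional_of_degree_proj[OF \<phi>] linear_simps[OF lin])
      have "(sdiff ^^ N) (\<lambda>m k. \<phi> (?X x m k)) m k =
          (fdiff ^^ N) (\<lambda>i. \<phi> (?X x i (m + k + int N - i))) m"
        by (rule funpow_sdiff_eq_fdiff)
      also have "\<dots> = 0"
      proof (cases "m + k + int N = total_degree e d")
        case True
        have "(\<lambda>i. \<phi> (?X x i (m + k + int N - i))) = (\<lambda>i. left \<phi> e d x i - right \<phi> e d x i)"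
          unfolding eq coef_left_def coef_right_def True using x by (simp add: proj_mem)
        then show ?thesis using assms[OF \<phi> x] by simp
      next
        case False
        then have "(\<lambda>i. \<phi> (?X x i (m + k + int N - i))) = (\<lambda>_. 0)"
          unfolding eq using off_diagonal[OF lin x] by simp
        then show ?thesis by (simp add: funpow_fdiff_eq_0)
      qed
      finally show "(sdiff ^^ N) (\<lambda>m k. \<phi> (?X x m k)) m k = 0" .
    qed
    then show "\<phi> ((sdiff ^^ N) (?X v) m k) = \<phi> 0"
      by (simp add: linear_sdiff[OF lin] linear_simps(3)[OF lin])
  qed
  then show "(sdiff ^^ N) (?X v) m k = 0 m k" by simp
qed

lemma local_imp_mode_local:
  assumes "local_fields A B"
  shows "\<exists>N. mode_local N A B"
proof -
  obtain N where N: "\<forall>v. \<forall>\<phi>\<in>graded_dual. \<exists>f. is_correlation A B \<phi> v f \<and>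
        (\<exists>g. holomorphic2_on g (punctured \<times> punctured) \<and>
           (\<forall>(z\<^sub>1, z\<^sub>2)\<in>Conf2. g (z\<^sub>1, z\<^sub>2) = (z\<^sub>1 - z\<^sub>2) ^ N * f (z\<^sub>1, z\<^sub>2)))"
    using assms unfolding local_fields_def by meson
  have "mode_local N A B"
  proof (rule mode_localI)
    fix e \<phi> d v assume \<phi>: "functional_of_degree e \<phi>" and v: "v \<in> V d"
    have dual: "\<phi> \<in> graded_dual" by (rule functional_of_degree_in_dual[OF \<phi>])
    obtain f g where "is_correlation A B \<phi> v f" "holomorphic2_on g (punctured \<times> punctured)"
      "\<forall>(z\<^sub>1, z\<^sub>2)\<in>Conf2. g (z\<^sub>1, z\<^sub>2) = (z\<^sub>1 - z\<^sub>2) ^ N * f (z\<^sub>1, z\<^sub>2)"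
      using N dual by meson
    with assms dual show "(fdiff ^^ N) (\<lambda>m. left \<phi> e d v m - right \<phi> e d v m) = 0"
      unfolding local_fields_def by (intro correlation_imp_coefficients[OF \<phi> v]) auto
  qed
  then show ?thesis by blast
qed

end

section \<open>From modes to analytic locality\<close>

context graded_space
begin

definition degrees :: "('v \<Rightarrow> complex) \<Rightarrow> nat set" where
  "degrees \<phi> = {e. \<exists>v\<in>V e. \<phi> v \<noteq> 0}"

definition components :: "'v \<Rightarrow> nat set" where
  "components v = {d. proj d v \<noteq> 0}"

lemma graded_dual_linear: "\<phi> \<in> graded_dual \<Longrightarrow> Vector_Spaces.linear scale (*) \<phi>"
  by (simp add: graded_dual_def)

lemma degrees_finite: "\<phi> \<in> graded_dual \<Longrightarrow> finite (degrees \<phi>)"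
  by (simp add: graded_dual_def degrees_def)

lemma degrees_superset: "{e. \<exists>v\<in>V e. \<phi> v \<noteq> 0} \<subseteq> degrees \<phi>"
  by (simp add: degrees_def)

lemma components_finite: "finite (components v)"
  using proj_props(2) by (simp add: components_def)

lemma components_superset: "{d. proj d v \<noteq> 0} \<subseteq> components v"
  by (simp add: components_def)

lemma linear_comp_weight:
  assumes "Vector_Spaces.linear scale (*) \<phi>" "has_weight C \<Delta>"
  shows "Vector_Spaces.linear scale (*) (\<lambda>x. \<phi> (C l x))"
  using assms(1) unfolding Vector_Spaces.linear_iff
  by (simp add: linear_simps[OF has_weight_linear[OF assms(2)]])

lemma linear_comp_proj:
  assumes "Vector_Spaces.linear scale (*) \<phi>"
  shows "Vector_Spaces.linear scale (*) (\<lambda>x. \<phi> (proj e x))"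
  using functional_of_degree_comp_proj[OF assms] by (simp add: functional_of_degree_def)

lemma truncated_functional:
  assumes "Vector_Spaces.linear scale (*) \<phi>" "has_weight A \<Delta>A" "has_weight B \<Delta>B"
  shows "truncated (\<lambda>m k. \<phi> (A m (B k v)))"
proof -
  obtain K where "\<forall>k\<ge>K. B k v = 0" using has_weight_truncated[OF assms(3)] by blast
  then show ?thesis unfolding truncated_def
    by (intro exI[of _ K])
      (simp add: linear_simps(3)[OF has_weight_linear[OF assms(2)]] linear_simps(3)[OF assms(1)])
qed

end

context two_fields
begin

lemma mode_local_coefficients:
  assumes "mode_local N A B" "Vector_Spaces.linear scale (*) \<phi>"
  shows "(fdiff ^^ N) (\<lambda>m. left \<phi> e d v m - right \<phi> e d v m) = 0"
proof
  fix m
  define X where "X = (\<lambda>m k. \<phi> (proj e (A m (B k (proj d v)))) - \<phi> (proj e (B k (A m (proj d v)))))"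
  have "(sdiff ^^ N) X m (total_degree e d - m - int N) = 0"
    using mode_local_functional[OF assms(1) linear_comp_proj[OF assms(2)], of e "proj d v"]
    by (simp add: X_def)
  then show "(fdiff ^^ N) (\<lambda>m. left \<phi> e d v m - right \<phi> e d v m) m = 0 m"
    unfolding funpow_sdiff_eq_fdiff by (simp add: X_def coef_left_def coef_right_def)
qed

lemma two_sided:
  assumes "mode_local N A B" "Vector_Spaces.linear scale (*) \<phi>"
  shows "two_sided_coefficients (left \<phi> e d v) (right \<phi> e d v) (lower e) (upper d) N"
  by unfold_locales
    (rule left_low right_high mode_local_coefficients assms | assumption)+

definition component_function ::
    "nat \<Rightarrow> ('v \<Rightarrow> complex) \<Rightarrow> nat \<Rightarrow> nat \<Rightarrow> 'v \<Rightarrow> complex \<times> complex \<Rightarrow> complex" where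
  "component_function N \<phi> e d v =
     two_sided_coefficients.sum_function (left \<phi> e d v) (right \<phi> e d v) (lower e) (upper d) (total_degree e d) N"

definition two_point_function ::
    "nat \<Rightarrow> ('v \<Rightarrow> complex) \<Rightarrow> 'v \<Rightarrow> complex \<times> complex \<Rightarrow> complex" where
  "two_point_function N \<phi> v p =
     (\<Sum>e\<in>degrees \<phi>. \<Sum>d\<in>components v. component_function N \<phi> e d v p)"

context
  fixes N \<phi>
  assumes loc: "mode_local N A B" and dual: "\<phi> \<in> graded_dual"
begin

lemmas lin = graded_dual_linear[OF dual]
lemmas supports = degrees_finite[OF dual] degrees_superset components_finite components_superset
lemmas series_left = product_term_left[OF lin supports]
lemmas series_right = product_term_right[OF lin supports]

lemma two_point_function_outer:
  assumes "0 < norm z2" "norm z2 < norm z1"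
  shows "(\<lambda>n. product_term \<phi> A z1 n B z2 v) sums two_point_function N \<phi> v (z1, z2)"
  unfolding series_left two_point_function_def component_function_def
  by (intro sums_sum two_sided_coefficients.sums_outer[OF two_sided[OF loc lin]] assms)

lemma two_point_function_inner:
  assumes "0 < norm z1" "norm z1 < norm z2"
  shows "(\<lambda>n. product_term \<phi> B z2 n A z1 v) sums two_point_function N \<phi> v (z1, z2)"
  unfolding series_right two_point_function_def component_function_def
  by (intro sums_sum two_sided_coefficients.sums_inner[OF two_sided[OF loc lin]] assms)

lemma alu_outer:
  "alu_convergent_on (\<lambda>n (z1, z2). product_term \<phi> A z1 n B z2 v)
     {(z1, z2). 0 < norm z2 \<and> norm z2 < norm z1}"
proof -
  let ?t = "\<lambda>e d n (z1, z2). left \<phi> e d v (lower e + int n) *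
    (z1 powi (-(lower e + int n)-1) * z2 powi ((lower e + int n) - total_degree e d - 1))"
  have "locally_dominated (\<lambda>n x. \<Sum>e\<in>degrees \<phi>. \<Sum>d\<in>components v. ?t e d n x)
     {(z1, z2). 0 < norm z2 \<and> norm z2 < norm z1}"
    by (intro locally_dominated_sum supports
        two_sided_coefficients.dominated_outer[OF two_sided[OF loc lin]])
  also have "(\<lambda>n x. \<Sum>e\<in>degrees \<phi>. \<Sum>d\<in>components v. ?t e d n x) =
      (\<lambda>n (z1, z2). product_term \<phi> A z1 n B z2 v)"
    by (intro ext) (simp add: series_left case_prod_unfold)
  finally show ?thesis by (rule locally_dominated_imp_alu)
qed

lemma alu_inner:
  "alu_convergent_on (\<lambda>n (z1, z2). product_term \<phi> B z2 n A z1 v)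
     {(z1, z2). 0 < norm z1 \<and> norm z1 < norm z2}"
proof -
  let ?t = "\<lambda>e d n (z1, z2). right \<phi> e d v (upper d - int n) *
    (z1 powi (-(upper d - int n)-1) * z2 powi ((upper d - int n) - total_degree e d - 1))"
  have "locally_dominated (\<lambda>n x. \<Sum>e\<in>degrees \<phi>. \<Sum>d\<in>components v. ?t e d n x)
     {(z1, z2). 0 < norm z1 \<and> norm z1 < norm z2}"
    by (intro locally_dominated_sum supports
        two_sided_coefficients.dominated_inner[OF two_sided[OF loc lin]])
  also have "(\<lambda>n x. \<Sum>e\<in>degrees \<phi>. \<Sum>d\<in>components v. ?t e d n x) =
      (\<lambda>n (z1, z2). product_term \<phi> B z2 n A z1 v)"
    by (intro ext) (simp add: series_right case_prod_unfold)
  finally show ?thesis by (rule locally_dominated_imp_alu)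
qed

lemma is_correlation_two_point_function:
  "is_correlation A B \<phi> v (two_point_function N \<phi> v)"
proof -
  have "holomorphic2_on (\<lambda>p. two_point_function N \<phi> v p) Conf2"
    unfolding two_point_function_def component_function_def
    by (intro holomorphic2_sum two_sided_coefficients.holomorphic_sum_function[OF two_sided[OF loc lin]])
  then show ?thesis
    using two_point_function_outer two_point_function_inner
    by (auto simp: is_correlation_def sums_iff)
qed

lemma two_point_function_pole_cleared:
  "\<exists>g. holomorphic2_on g (punctured \<times> punctured) \<and>
     (\<forall>(z1, z2)\<in>Conf2. g (z1, z2) = (z1 - z2) ^ N * two_point_function N \<phi> v (z1, z2))"
proof -
  have "\<exists>g. holomorphic2_on g (punctured \<times> punctured) \<and>
     (\<forall>(z1, z2)\<in>Conf2. g (z1, z2) = (z1 - z2) ^ N * component_function N \<phi> e d v (z1, z2))" for e d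
    unfolding component_function_def
    by (rule two_sided_coefficients.sum_function_pole_cleared[OF two_sided[OF loc lin]])
  then have "\<forall>e d. \<exists>g. holomorphic2_on g (punctured \<times> punctured) \<and>
     (\<forall>(z1, z2)\<in>Conf2. g (z1, z2) = (z1 - z2) ^ N * component_function N \<phi> e d v (z1, z2))"
    by blast
  then obtain g where g': "\<forall>e d. holomorphic2_on (g e d) (punctured \<times> punctured) \<and>
     (\<forall>(z1, z2)\<in>Conf2. g e d (z1, z2) = (z1 - z2) ^ N * component_function N \<phi> e d v (z1, z2))"
    unfolding choice_iff by (elim exE)
  then have g: "holomorphic2_on (g e d) (punctured \<times> punctured)"
    "(z1, z2) \<in> Conf2 \<Longrightarrow> g e d (z1, z2) = (z1 - z2) ^ N * component_function N \<phi> e d v (z1, z2)"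
    for e d z1 z2 by fast+
  show ?thesis
  proof (intro exI conjI)
    show "holomorphic2_on (\<lambda>p. \<Sum>e\<in>degrees \<phi>. \<Sum>d\<in>components v. g e d p) (punctured \<times> punctured)"
      by (intro holomorphic2_sum g(1))
    show "\<forall>(z1, z2)\<in>Conf2. (\<Sum>e\<in>degrees \<phi>. \<Sum>d\<in>components v. g e d (z1, z2)) =
        (z1 - z2) ^ N * two_point_function N \<phi> v (z1, z2)"
      unfolding two_point_function_def sum_distrib_left
      by (clarify, intro sum.cong refl g(2))
  qed
qed

text \<open>
  Hilbert's choice in the definition of the correlation function is harmless: two correlation
  functions agree off the set \<open>norm z1 = norm z2\<close>, hence on all of \<open>Conf2\<close> by continuity.
\<close>

lemma correlation_eq:
  assumes "(z1, z2) \<in> Conf2"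
  shows "correlation A B \<phi> v (z1, z2) = two_point_function N \<phi> v (z1, z2)"
proof -
  have corr: "is_correlation A B \<phi> v (correlation A B \<phi> v)"
    unfolding correlation_def by (rule someI[where P = "is_correlation A B \<phi> v", OF is_correlation_two_point_function])
  show ?thesis
  proof (rule holomorphic2_Conf2_eqI[OF _ _ _ assms])
    fix a b assume "(a, b) \<in> Conf2" "norm a \<noteq> norm b"
    then have "0 < norm b \<and> norm b < norm a \<or> 0 < norm a \<and> norm a < norm b"
      by (auto simp: Conf2_def punctured_def)
    then show "correlation A B \<phi> v (a, b) = two_point_function N \<phi> v (a, b)"
      using corr is_correlation_two_point_function[of v] unfolding is_correlation_def by metis
  qed (use corr is_correlation_two_point_function[of v] in \<open>auto simp: is_correlation_def\<close>)
qed

lemma correlation_residue: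
  assumes "0 < r" "r < norm z"
  shows "contour_integral (circlepath z r) (\<lambda>w. (w - z) powi n * correlation A B \<phi> v (w, z)) /
      (2 * of_real pi * \<i>) = (\<Sum>e\<in>degrees \<phi>. \<Sum>d\<in>components v. z powi (n - total_degree e d - 1) *
        (iota1 n (\<lambda>m k. \<phi> (proj e (A m (B k (proj d v))))) 0 (total_degree e d - n) -
         iota2 n (\<lambda>m k. \<phi> (proj e (B k (A m (proj d v))))) 0 (total_degree e d - n)))"
    (is "_ = (\<Sum>e\<in>_. \<Sum>d\<in>_. ?R e d)")
proof -
  have comp: "((\<lambda>w. (w - z) powi n * component_function N \<phi> e d v (w, z)) has_contour_integral
      2 * of_real pi * \<i> * ?R e d) (circlepath z r)" for e d
    unfolding component_function_def
    by (rule two_sided_coefficients.residue_sum_function[OF two_sided[OF loc lin] assms])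
      (simp_all add: coef_left_def coef_right_def truncated_functional[OF linear_comp_proj[OF lin] A B]
        truncated_functional[OF linear_comp_proj[OF lin] B A])
  have "((\<lambda>w. \<Sum>e\<in>degrees \<phi>. \<Sum>d\<in>components v. (w - z) powi n * component_function N \<phi> e d v (w, z))
      has_contour_integral (\<Sum>e\<in>degrees \<phi>. \<Sum>d\<in>components v. 2 * of_real pi * \<i> * ?R e d)) (circlepath z r)"
    by (intro has_contour_integral_sum supports comp)
  then have "((\<lambda>w. (w - z) powi n * correlation A B \<phi> v (w, z)) has_contour_integral
      (\<Sum>e\<in>degrees \<phi>. \<Sum>d\<in>components v. 2 * of_real pi * \<i> * ?R e d)) (circlepath z r)"
  proof (rule has_contour_integral_eq)
    fix w assume "w \<in> path_image (circlepath z r)"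
    then have "norm (w - z) = r" using assms(1) by (simp add: dist_norm norm_minus_commute)
    then have "(w, z) \<in> Conf2" using assms by (auto simp: Conf2_def punctured_def)
    then show "(\<Sum>e\<in>degrees \<phi>. \<Sum>d\<in>components v. (w - z) powi n * component_function N \<phi> e d v (w, z)) =
        (w - z) powi n * correlation A B \<phi> v (w, z)"
      by (simp add: correlation_eq two_point_function_def sum_distrib_left)
  qed
  then have "contour_integral (circlepath z r) (\<lambda>w. (w - z) powi n * correlation A B \<phi> v (w, z)) =
      2 * of_real pi * \<i> * (\<Sum>e\<in>degrees \<phi>. \<Sum>d\<in>components v. ?R e d)"
    by (simp add: contour_integral_unique sum_distrib_left)
  then show ?thesis by simp
qed

end

text \<open>
  The order of the pole is bounded by the exponent \<open>N\<close> of the mode form, and therefore uniformly in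
  \<open>v\<close> and \<open>\<phi>\<close>.
\<close>

lemma mode_local_imp_local:
  assumes "mode_local N A B"
  shows "local_fields A B"
  unfolding local_fields_def
proof (intro conjI allI ballI)
  show "homogeneous_field A" "homogeneous_field B"
    using A B homogeneous_field_iff by blast+
  show "\<exists>N. \<forall>v. \<forall>\<phi>\<in>graded_dual. \<exists>f. is_correlation A B \<phi> v f \<and>
        (\<exists>g. holomorphic2_on g (punctured \<times> punctured) \<and>
           (\<forall>(z\<^sub>1, z\<^sub>2)\<in>Conf2. g (z\<^sub>1, z\<^sub>2) = (z\<^sub>1 - z\<^sub>2) ^ N * f (z\<^sub>1, z\<^sub>2)))"
    using is_correlation_two_point_function[OF assms] two_point_function_pole_cleared[OF assms]
    by blast
qed (use alu_outer[OF assms] alu_inner[OF assms] in blast)+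

end

section \<open>Modes of the products\<close>

context graded_space
begin

text \<open>
  The coefficient of \<open>1 / z1\<close> in the difference of the two expansions of \<open>(z1 - z2) powi n\<close>, applied
  to \<open>A(z1) B(z2)\<close> and \<open>B(z2) A(z1)\<close>. Again the index sets make the sums finite.
\<close>

definition mode_product :: "(int \<Rightarrow> 'v \<Rightarrow> 'v) \<Rightarrow> int \<Rightarrow> (int \<Rightarrow> 'v \<Rightarrow> 'v) \<Rightarrow> int \<Rightarrow> 'v \<Rightarrow> 'v" where
  "mode_product A n B k v =
     (\<Sum>j | A (n - int j) (B (k + int j) v) \<noteq> 0.
        scale ((-1) ^ j * (of_int n gchoose j)) (A (n - int j) (B (k + int j) v))) -
     (\<Sum>j | B (k + n - int j) (A (int j) v) \<noteq> 0.
        scale ((-1) powi n * ((-1) ^ j * (of_int n gchoose j))) (B (k + n - int j) (A (int j) v)))"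

lemma has_weight_L0:
  assumes "has_weight A \<Delta>A" "has_weight B \<Delta>B" "v \<in> V d"
  shows "L0 (A i (B j v)) = scale (of_int (int d + \<Delta>A + \<Delta>B - i - j - 2)) (A i (B j v))"
proof -
  have "L0 (B j v) = scale (of_int (\<Delta>B - j - 1)) (B j v) + scale (of_nat d) (B j v)"
    using assms(2,3) unfolding has_weight_def
    by (metis L0_eigen diff_add_cancel linear_simps(4)[OF has_weight_linear[OF assms(2)]])
  also have "\<dots> = scale (of_int (int d + \<Delta>B - j - 1)) (B j v)"
    by (simp add: algebra_simps flip: scale_left_distrib)
  finally have "A i (L0 (B j v)) = scale (of_int (int d + \<Delta>B - j - 1)) (A i (B j v))"
    by (simp only: linear_simps[OF has_weight_linear[OF assms(1)]])
  moreover have "L0 (A i (B j v)) - A i (L0 (B j v)) = scale (of_int (\<Delta>A - i - 1)) (A i (B j v))"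
    using assms(1) unfolding has_weight_def by blast
  ultimately have "L0 (A i (B j v)) =
      scale (of_int (\<Delta>A - i - 1)) (A i (B j v)) + scale (of_int (int d + \<Delta>B - j - 1)) (A i (B j v))"
    by (simp add: diff_eq_eq)
  then show ?thesis by (simp add: algebra_simps flip: scale_left_distrib)
qed

text \<open>
  Between homogeneous vectors and functionals each field gives a single monomial in \<open>z\<close>. The two
  weights may differ a priori; then the monomials have different exponents, and comparing their
  values at \<open>1\<close> and \<open>2\<close> shows that both are zero.
\<close>

lemma field_eqI:
  assumes D: "has_weight D \<Delta>" and D': "has_weight D' \<Delta>'"
    and eq: "\<And>v \<phi> z. \<phi> \<in> graded_dual \<Longrightarrow> z \<in> punctured \<Longrightarrow>
      pairing \<phi> (field_at D z v) = pairing \<phi> (field_at D' z v)"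
  shows "D = D'"
proof (intro ext)
  fix k v
  note linD = has_weight_linear[OF D] and linD' = has_weight_linear[OF D']
  have "(\<lambda>v. D k v - D' k v) v = 0"
  proof (rule linear_eq_0I[where f = "\<lambda>v. D k v - D' k v" and s = scale])
    show "Vector_Spaces.linear scale scale (\<lambda>v. D k v - D' k v)"
      unfolding Vector_Spaces.linear_iff
      by (simp add: vector_space_axioms linear_simps[OF linD] linear_simps[OF linD'] algebra_simps)
    fix d x assume x: "x \<in> V d"
    have "D k x = D' k x"
    proof (rule functional_separates)
      fix e \<phi> assume \<phi>: "functional_of_degree e \<phi>"
      then have lin: "Vector_Spaces.linear scale (*) \<phi>" by (simp add: functional_of_degree_def)
      have E: "finite {e}" "{e. \<exists>v\<in>V e. \<phi> v \<noteq> 0} \<subseteq> {e}"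
        using \<phi> by (auto simp: functional_of_degree_def)
      have S: "finite {d}" "{d. proj d x \<noteq> 0} \<subseteq> {d}"
        using x by (auto simp: proj_mem)
      let ?c = "\<phi> (D (int d + \<Delta> - 1 - int e) x)" and ?c' = "\<phi> (D' (int d + \<Delta>' - 1 - int e) x)"
      have mono: "z powi (int e - int d - \<Delta>) * ?c = z powi (int e - int d - \<Delta>') * ?c'" if "z \<noteq> 0" for z
        using eq[OF functional_of_degree_in_dual[OF \<phi>], of z x] that x
        by (simp add: punctured_def pairing_field_at[OF D lin E S] pairing_field_at[OF D' lin E S]
            functional_of_degree_proj[OF \<phi>] proj_mem)
      have c: "?c = ?c'" using mono[of 1] by simp
      have zero: "\<phi> (D k x) = 0" if "k \<noteq> int d + \<Delta> - 1 - int e"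
        using has_weight_proj[OF D x, of e k] that functional_of_degree_proj[OF \<phi>, of "D k x"]
        by (auto simp: linear_simps(3)[OF lin])
      have zero': "\<phi> (D' k x) = 0" if "k \<noteq> int d + \<Delta>' - 1 - int e"
        using has_weight_proj[OF D' x, of e k] that functional_of_degree_proj[OF \<phi>, of "D' k x"]
        by (auto simp: linear_simps(3)[OF lin])
      show "\<phi> (D k x) = \<phi> (D' k x)"
      proof (cases "\<Delta> = \<Delta>'")
        case True
        then show ?thesis using c zero zero' by metis
      next
        case False
        have "?c = 0"
        proof (rule ccontr)
          assume "?c \<noteq> 0"
          then have "(2 :: complex) powi (int e - int d - \<Delta>) = 2 powi (int e - int d - \<Delta>')"
            using mono[of 2] c by simp
          then have "norm ((2 :: complex) powi (int e - int d - \<Delta>)) = norm ((2 :: complex) powi (int e - int d - \<Delta>'))"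
            by simp
          then have "(2 :: real) powi (int e - int d - \<Delta>) = 2 powi (int e - int d - \<Delta>')"
            by (simp add: norm_power_int)
          then have "int e - int d - \<Delta> = int e - int d - \<Delta>'"
            using power_int_strict_increasing[of "int e - int d - \<Delta>" "int e - int d - \<Delta>'" "2 :: real"]
              power_int_strict_increasing[of "int e - int d - \<Delta>'" "int e - int d - \<Delta>" "2 :: real"]
            by (cases "int e - int d - \<Delta>" "int e - int d - \<Delta>'" rule: linorder_cases) auto
          then show False using False by simp
        qed
        then show ?thesis using c zero zero' by metis
      qed
    qed
    then show "D k x - D' k x = 0" by simp
  qed
  then show "D k v = D' k v" by simp
qed

end

context two_fields
begin

lemma mode_product_eq:
  assumes "\<forall>i\<ge>K. A i v = 0" "\<forall>i\<ge>K. B i v = 0" "K \<le> k + int J" "K \<le> int J"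
  shows "mode_product A n B k v =
    (\<Sum>j<J. scale ((-1) ^ j * (of_int n gchoose j)) (A (n - int j) (B (k + int j) v))) -
    (\<Sum>j<J. scale ((-1) powi n * ((-1) ^ j * (of_int n gchoose j))) (B (k + n - int j) (A (int j) v)))"
proof -
  have zero: "A (n - int j) (B (k + int j) v) = 0" "B (k + n - int j) (A (int j) v) = 0" if "J \<le> j" for j
    using assms that by (simp_all add: linear_simps(3)[OF linA] linear_simps(3)[OF linB])
  have "{j. A (n - int j) (B (k + int j) v) \<noteq> 0} \<subseteq> {..<J}"
    "{j. B (k + n - int j) (A (int j) v) \<noteq> 0} \<subseteq> {..<J}"
    using zero not_le_imp_less by auto
  then show ?thesis unfolding mode_product_def
    by (intro arg_cong2[of _ _ _ _ minus] sum.mono_neutral_left) auto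
qed

lemma mode_product_bound:
  obtains K J where "\<forall>i\<ge>K. A i v = 0" "\<forall>i\<ge>K. B i v = 0"
    "\<forall>i\<ge>K. A i w = 0" "\<forall>i\<ge>K. B i w = 0" "K \<le> k + int J" "K \<le> int J"
proof -
  obtain K1 K2 K3 K4 where K: "\<forall>i\<ge>K1. A i v = 0" "\<forall>i\<ge>K2. B i v = 0" "\<forall>i\<ge>K3. A i w = 0" "\<forall>i\<ge>K4. B i w = 0"
    using has_weight_truncated[OF A] has_weight_truncated[OF B] by metis
  define K where "K = max (max K1 K2) (max K3 K4)"
  show ?thesis
  proof (rule that[of K "nat (\<bar>K\<bar> + \<bar>k\<bar>)"])
    have "K1 \<le> i" "K2 \<le> i" "K3 \<le> i" "K4 \<le> i" if "K \<le> i" for i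
      using that by (simp_all add: K_def)
    then show "\<forall>i\<ge>K. A i v = 0" "\<forall>i\<ge>K. B i v = 0" "\<forall>i\<ge>K. A i w = 0" "\<forall>i\<ge>K. B i w = 0"
      using K by blast+
  qed linarith+
qed

lemma mode_product_functional:
  assumes "Vector_Spaces.linear scale (*) \<phi>"
  shows "\<phi> (mode_product A n B k v) =
    iota1 n (\<lambda>m k. \<phi> (A m (B k v))) 0 k - iota2 n (\<lambda>m k. \<phi> (B k (A m v))) 0 k"
proof -
  obtain K J where K: "\<forall>i\<ge>K. A i v = 0" "\<forall>i\<ge>K. B i v = 0" "K \<le> k + int J" "K \<le> int J"
    by (rule mode_product_bound[of v v k])
  have "iota1 n (\<lambda>m k. \<phi> (A m (B k v))) 0 k =
      (\<Sum>j<J. (-1) ^ j * (of_int n gchoose j) * \<phi> (A (0 + n - int j) (B (k + int j) v)))"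
    using K by (intro iota1_eq[of K]) (simp_all add: linear_simps(3)[OF linA] linear_simps(3)[OF assms])
  moreover have "iota1 n (\<lambda>k m. \<phi> (B k (A m v))) k 0 =
      (\<Sum>j<J. (-1) ^ j * (of_int n gchoose j) * \<phi> (B (k + n - int j) (A (0 + int j) v)))"
    using K by (intro iota1_eq[of K "\<lambda>k m. \<phi> (B k (A m v))"])
      (simp_all add: linear_simps(3)[OF linB] linear_simps(3)[OF assms])
  ultimately show ?thesis
    by (simp add: mode_product_eq[OF K] iota2_def linear_simps[OF assms] sum_distrib_left mult.assoc)
qed

lemma mode_product_weight: "has_weight (mode_product A n B) (\<Delta>A + \<Delta>B - n - 1)"
proof (rule has_weightI)
  fix k
  show "Vector_Spaces.linear scale scale (mode_product A n B k)"
    unfolding Vector_Spaces.linear_iff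
  proof (intro conjI allI vector_space_axioms)
    fix x y
    obtain K J where K: "\<forall>i\<ge>K. A i x = 0" "\<forall>i\<ge>K. B i x = 0"
      "\<forall>i\<ge>K. A i y = 0" "\<forall>i\<ge>K. B i y = 0" "K \<le> k + int J" "K \<le> int J"
      by (rule mode_product_bound[of x y k])
    then have K': "\<forall>i\<ge>K. A i (x + y) = 0" "\<forall>i\<ge>K. B i (x + y) = 0"
      by (simp_all add: linear_simps[OF linA] linear_simps[OF linB])
    show "mode_product A n B k (x + y) = mode_product A n B k x + mode_product A n B k y"
      unfolding mode_product_eq[OF K' K(5,6)] mode_product_eq[OF K(1,2,5,6)] mode_product_eq[OF K(3,4,5,6)]
      by (simp add: linear_simps[OF linA] linear_simps[OF linB] scale_right_distrib sum.distrib)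
  next
    fix c x
    obtain K J where K: "\<forall>i\<ge>K. A i x = 0" "\<forall>i\<ge>K. B i x = 0"
      "K \<le> k + int J" "K \<le> int J"
      by (rule mode_product_bound[of x x k])
    then have K': "\<forall>i\<ge>K. A i (scale c x) = 0" "\<forall>i\<ge>K. B i (scale c x) = 0"
      by (simp_all add: linear_simps[OF linA] linear_simps[OF linB])
    show "mode_product A n B k (scale c x) = scale c (mode_product A n B k x)"
      unfolding mode_product_eq[OF K' K(3,4)] mode_product_eq[OF K]
      by (simp add: linear_simps[OF linA] linear_simps[OF linB] scale_right_diff_distrib
          scale_sum_right mult.commute)
  qed
next
  fix k v d assume v: "v \<in> V d"
  obtain K J where K: "\<forall>i\<ge>K. A i v = 0" "\<forall>i\<ge>K. B i v = 0"
      "K \<le> k + int J" "K \<le> int J"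
    by (rule mode_product_bound[of v v k])
  let ?w = "of_int (int d + (\<Delta>A + \<Delta>B - n - 1) - k - 1) :: complex"
  have 1: "L0 (A (n - int j) (B (k + int j) v)) = scale ?w (A (n - int j) (B (k + int j) v))" for j
    unfolding has_weight_L0[OF A B v] by (simp add: algebra_simps)
  have 2: "L0 (B (k + n - int j) (A (int j) v)) = scale ?w (B (k + n - int j) (A (int j) v))" for j
    unfolding has_weight_L0[OF B A v] by (simp add: algebra_simps)
  show "L0 (mode_product A n B k v) = scale ?w (mode_product A n B k v)"
    unfolding mode_product_eq[OF K]
    by (simp only: linear_simps[OF linear_L0] 1 2 scale_right_diff_distrib scale_sum_right
        scale_left_commute)
qed

text \<open>
  The residue formula shows that the explicit modes satisfy the defining integral identity, and by
  \<open>field_eqI\<close> they are the only ones that do.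
\<close>

lemma nth_product_eq:
  assumes "mode_local N A B"
  shows "nth_product A n B = mode_product A n B"
proof -
  let ?P = "\<lambda>D. homogeneous_field D \<and>
     (\<forall>v. \<forall>\<phi>\<in>graded_dual. \<forall>z\<in>punctured. \<forall>r. 0 < r \<and> r < norm z \<longrightarrow>
        pairing \<phi> (field_at D z v) =
          contour_integral (circlepath z r)
            (\<lambda>z\<^sub>1. (z\<^sub>1 - z) powi n * correlation A B \<phi> v (z\<^sub>1, z)) / (2 * of_real pi * \<i>))"
  have P: "?P (mode_product A n B)"
  proof (intro conjI allI ballI impI)
    show "homogeneous_field (mode_product A n B)"
      using mode_product_weight homogeneous_field_iff by blast
    fix v \<phi> and z :: complex and r assume dual: "\<phi> \<in> graded_dual" and r: "0 < r \<and> r < norm z"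
    have "pairing \<phi> (field_at (mode_product A n B) z v) = (\<Sum>e\<in>degrees \<phi>. \<Sum>d\<in>components v.
        z powi (n - total_degree e d - 1) * \<phi> (proj e (mode_product A n B (total_degree e d - n) (proj d v))))"
      unfolding pairing_field_at[OF mode_product_weight graded_dual_linear[OF dual]
          degrees_finite[OF dual] degrees_superset components_finite components_superset] total_degree_def
      by (simp add: algebra_simps)
    then show "pairing \<phi> (field_at (mode_product A n B) z v) =
        contour_integral (circlepath z r)
          (\<lambda>z\<^sub>1. (z\<^sub>1 - z) powi n * correlation A B \<phi> v (z\<^sub>1, z)) / (2 * of_real pi * \<i>)"
      using r by (simp add: correlation_residue[OF assms dual]
          mode_product_functional[OF linear_comp_proj[OF graded_dual_linear[OF dual]]])
  qed
  show ?thesis unfolding nth_product_def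
  proof (rule the_equality)
    show "?P (mode_product A n B)" by (rule P)
    fix D assume D: "?P D"
    then obtain \<Delta> where \<Delta>: "has_weight D \<Delta>" using homogeneous_field_iff by blast
    show "D = mode_product A n B"
    proof (rule field_eqI[OF \<Delta> mode_product_weight])
      fix v \<phi> z assume dual: "\<phi> \<in> graded_dual" and z: "z \<in> punctured"
      then have r: "0 < norm z / 2 \<and> norm z / 2 < norm z" by (simp add: punctured_def)
      show "pairing \<phi> (field_at D z v) = pairing \<phi> (field_at (mode_product A n B) z v)"
        using conjunct2[OF D, rule_format, OF dual z r] conjunct2[OF P, rule_format, OF dual z r]
        by (simp only:)
    qed
  qed
qed

end

section \<open>Dong's lemma\<close>

lemma diff13_diff23_eq_0:
  assumes "(diff23 ^^ r) x = 0" "(diff13 ^^ q) y = 0"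
  shows "(diff13 ^^ q) ((diff23 ^^ r) (x + y)) = 0"
proof -
  note add = additive_funpow[OF additive_diff(2), of q] additive_funpow[OF additive_diff(3), of r]
  have "(diff13 ^^ q) ((diff23 ^^ r) y) = 0"
    unfolding funpow_funpow_commute[of diff13 diff23, OF diff_commute(3)] assms(2)
    by (rule Modules.additive.zero[OF add(2)])
  then show ?thesis
    by (simp add: Modules.additive.add[OF add(1)] Modules.additive.add[OF add(2)] assms(1)
        Modules.additive.zero[OF add(1)])
qed

context graded_space
begin

text \<open>
  Dong's lemma for modes. Moving \<open>C\<close> from the right to the left of \<open>A B\<close> or \<open>B A\<close> takes one
  exchange with \<open>B\<close>, which costs \<open>(z2 - z3) ^ r\<close>, and one with \<open>A\<close>, which costs \<open>(z1 - z3) ^ q\<close>.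
\<close>

lemma mode_local_mode_product:
  assumes A: "has_weight A \<Delta>A" and B: "has_weight B \<Delta>B" and C: "has_weight C \<Delta>C"
    and AB: "mode_local p A B" and AC: "mode_local q A C" and BC: "mode_local r B C"
  shows "mode_local (q + (p + nat (- n)) + r) (mode_product A n B) C"
  unfolding mode_local_def
proof (intro allI ext)
  fix v k l
  interpret two_fields scale V L0 A B \<Delta>A \<Delta>B by unfold_locales (rule A B)+
  let ?M = "q + (p + nat (- n)) + r"
  let ?D = "mode_product A n B"
  have "(sdiff ^^ ?M) (\<lambda>k l. ?D k (C l v) - C l (?D k v)) k l = 0"
  proof (rule functional_separates)
    fix e \<phi> assume "functional_of_degree e \<phi>"
    then have \<phi>: "Vector_Spaces.linear scale (*) \<phi>" by (simp add: functional_of_degree_def)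
    note \<phi>A = linear_comp_weight[OF \<phi> A] and \<phi>B = linear_comp_weight[OF \<phi> B]
      and \<phi>C = linear_comp_weight[OF \<phi> C]
    \<comment> \<open>The four orderings, and the intermediate ones with \<open>C\<close> in the middle.\<close>
    define a where "a = (\<lambda>m k l. \<phi> (A m (B k (C l v))))"
    define b where "b = (\<lambda>m k l. \<phi> (B k (A m (C l v))))"
    define c where "c = (\<lambda>m k l. \<phi> (C l (A m (B k v))))"
    define d where "d = (\<lambda>m k l. \<phi> (C l (B k (A m v))))"
    define x where "x = (\<lambda>m k l. \<phi> (A m (C l (B k v))))"
    define y where "y = (\<lambda>m k l. \<phi> (B k (C l (A m v))))"
    let ?u = "(expand1 n a - expand2 n b) - (expand1 n c - expand2 n d)"
    have "(diff23 ^^ ?M) ?u = 0"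
    proof (rule dong_array)
      show "trunc1 a" "trunc2 b" "trunc1 c" "trunc2 d"
        unfolding trunc1_def trunc2_def a_def b_def c_def d_def
        using truncated_functional[OF \<phi> A B] truncated_functional[OF \<phi> B A]
          truncated_functional[OF \<phi>C A B] truncated_functional[OF \<phi>C B A] by blast+
      show "(diff12 ^^ p) (a - b) = 0"
        using mode_local_functional[OF AB \<phi>]
        by (simp add: fun_eq_iff funpow_diff12 a_def b_def)
      show "(diff12 ^^ p) (c - d) = 0"
        using mode_local_functional[OF AB \<phi>C]
        by (simp add: fun_eq_iff funpow_diff12 c_def d_def)
      have "(diff23 ^^ r) (a - x) = 0"
        using mode_local_functional[OF BC \<phi>A]
        by (simp add: fun_eq_iff funpow_diff23 a_def x_def fun_diff_def)
      moreover have "(diff13 ^^ q) (x - c) = 0"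
        using mode_local_functional[OF AC \<phi>]
        by (simp add: fun_eq_iff funpow_diff13 x_def c_def)
      ultimately show "(diff13 ^^ q) ((diff23 ^^ r) (a - c)) = 0"
        using diff13_diff23_eq_0[of r "a - x" q "x - c"] by simp
      have "(diff23 ^^ r) (y - d) = 0"
        using mode_local_functional[OF BC \<phi>]
        by (simp add: fun_eq_iff funpow_diff23 y_def d_def fun_diff_def)
      moreover have "(diff13 ^^ q) (b - y) = 0"
        using mode_local_functional[OF AC \<phi>B]
        by (simp add: fun_eq_iff funpow_diff13 b_def y_def)
      ultimately show "(diff13 ^^ q) ((diff23 ^^ r) (b - d)) = 0"
        using diff13_diff23_eq_0[of r "y - d" q "b - y"] by simp
    qed
    then have "(sdiff ^^ ?M) (?u 0) k l = 0"
      by (simp only: flip: funpow_diff23) simp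
    moreover have "?u 0 = (\<lambda>k l. \<phi> (?D k (C l v) - C l (?D k v)))"
      by (simp add: fun_eq_iff linear_simps[OF \<phi>] mode_product_functional[OF \<phi>]
          mode_product_functional[OF \<phi>C] expand1_def expand2_def a_def b_def c_def d_def)
    ultimately show "\<phi> ((sdiff ^^ ?M) (\<lambda>k l. ?D k (C l v) - C l (?D k v)) k l) = \<phi> 0"
      by (simp only: linear_sdiff[OF \<phi>] linear_simps(3)[OF \<phi>])
  qed
  then show "(sdiff ^^ ?M) (\<lambda>k l. ?D k (C l v) - C l (?D k v)) k l = 0 k l" by simp
qed

end

theorem proposition8p9:
  fixes scale :: "complex \<Rightarrow> 'v::ab_group_add \<Rightarrow> 'v"
    and V :: "nat \<Rightarrow> 'v set"
    and L0 :: "'v \<Rightarrow> 'v"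
    and A B C :: "int \<Rightarrow> 'v \<Rightarrow> 'v"
    and n :: int
  assumes "graded_space scale V L0"
    and "graded_space.homogeneous_field scale L0 A"
    and "graded_space.homogeneous_field scale L0 B"
    and "graded_space.homogeneous_field scale L0 C"
    and "graded_space.local_fields scale V L0 A B"
    and "graded_space.local_fields scale V L0 A C"
    and "graded_space.local_fields scale V L0 B C"
  shows "graded_space.local_fields scale V L0 C (graded_space.nth_product scale V L0 A n B)"
proof -
  interpret graded_space scale V L0 by fact
  obtain \<Delta>A \<Delta>B \<Delta>C where w: "has_weight A \<Delta>A" "has_weight B \<Delta>B" "has_weight C \<Delta>C"
    using assms(2-4) homogeneous_field_iff by blast
  interpret AB: two_fields scale V L0 A B \<Delta>A \<Delta>B by unfold_locales (rule w)+
  interpret AC: two_fields scale V L0 A C \<Delta>A \<Delta>C by unfold_locales (rule w)+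
  interpret BC: two_fields scale V L0 B C \<Delta>B \<Delta>C by unfold_locales (rule w)+
  interpret CD: two_fields scale V L0 C "mode_product A n B" \<Delta>C "\<Delta>A + \<Delta>B - n - 1"
    by unfold_locales (rule w AB.mode_product_weight)+
  obtain p q r where loc: "mode_local p A B" "mode_local q A C" "mode_local r B C"
    using AB.local_imp_mode_local AC.local_imp_mode_local BC.local_imp_mode_local assms(5-7) by blast
  have "local_fields C (mode_product A n B)"
    by (rule CD.mode_local_imp_local, rule mode_local_sym, rule mode_local_mode_product[OF w loc])
  then show ?thesis by (simp add: AB.nth_product_eq[OF loc(1)])
qed

end
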